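(* Let $\nu$ be a non-degenerate probability measure on $\mathbb{R}^d$ such that the interior of $D_L=\{u\in\mathbb{R}^d: L(u)<+\infty\}$ is non-empty, where $L(u)=\ln\int_{\mathbb{R}^d}e^{\langle u,x\rangle}d\nu(x)$. Let $J(x)=\sup_{u\in\mathbb{R}^d}(\langle u,x\rangle-L(u))$ be its Cramér transform, let $A_J=\nabla L(\mathrm{int}\,D_L)$ be the admissible domain of $J$ (on which $J$ is $C^\infty$), and let $K_J$ be a compact subset of $A_J$. Define $k(x)=\prod_{j=1}^d\max(1-|x_j|,0)$ for $x\in\mathbb{R}^d$, $k_c(x)=c^{-d}k(x/c)$ for $c>0$, and \[\phi_{n,c}(x)=\int_{\mathbb{R}^d}k_c(s-nx)\,d\nu^{*n}(s),\qquad x\in\mathbb{R}^d,\ n\ge1,\ c>0.\] If $\nu$ satisfies the Cramér condition $\forall\alpha>0,\ \sup_{\|s\|\ge\alpha}\left|\int_{\mathbb{R}^d}e^{i\langle s,x\rangle}d\nu(x)\right|<1$, then there exists $\gamma>0$ such that, as $n\to+\infty$ and $c\to0$, uniformly over $x\in K_J$, \[\phi_{n,c}(x)=(2\pi n)^{-d/2}\left(\det \mathrm{D}^2_xJ\right)^{1/2}e^{-nJ(x)}\left(1+o(1)+O\left(n^{d/2}e^{-\gamma n}c^{-d}\right)\right).\]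
   Context: Non-degenerate means $\nu$ is not supported on an affine hyperplane. $\nu^{*n}$ is the $n$-fold convolution of $\nu$; $\mathrm{D}^2_xJ$ is the Hessian of $J$ at $x$. The $o(1)$ term tends to $0$ as $n\to\infty$ and $c\to0$ jointly, uniformly in $x\in K_J$, and the $O(\cdot)$ term is bounded by a constant (independent of $x\in K_J$, $n$, $c$) times $n^{d/2}e^{-\gamma n}c^{-d}$. *)

theory Defs
  imports "HOL-Probability.Probability"
begin

type_synonym 'n vect = "real ^ 'n"

definition nondegenerate :: "('n::finite) vect measure \<Rightarrow> bool" where
  "nondegenerate \<nu> \<longleftrightarrow>
     (\<forall>a b. a \<noteq> 0 \<longrightarrow> \<not> (AE x in \<nu>. inner a x = b))"

definition laplace :: "('n::finite) vect measure \<Rightarrow> 'n vect \<Rightarrow> ennreal" where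
  "laplace \<nu> u = (\<integral>\<^sup>+ x. ennreal (exp (inner u x)) \<partial>\<nu>)"

definition dom_L :: "('n::finite) vect measure \<Rightarrow> 'n vect set" where
  "dom_L \<nu> = {u. laplace \<nu> u < \<infinity>}"

text \<open>Log-Laplace L (meaningful on dom_L, where it is finite).\<close>
definition logL :: "('n::finite) vect measure \<Rightarrow> 'n vect \<Rightarrow> real" where
  "logL \<nu> u = ln (enn2real (laplace \<nu> u))"

text \<open>Cramer transform J(x) = sup_u (<u,x> - L(u)); points with L(u) = +infinity
  contribute -infinity, so the sup is over dom_L.\<close>
definition cramer :: "('n::finite) vect measure \<Rightarrow> 'n vect \<Rightarrow> ereal" where
  "cramer \<nu> x = (SUP u\<in>dom_L \<nu>. ereal (inner u x - logL \<nu> u))"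

definition admissible :: "('n::finite) vect measure \<Rightarrow> 'n vect set" where
  "admissible \<nu> = {g. \<exists>u\<in>interior (dom_L \<nu>). GDERIV (logL \<nu>) u :> g}"

definition grad :: "(('n::finite) vect \<Rightarrow> real) \<Rightarrow> 'n vect \<Rightarrow> 'n vect" where
  "grad f y = (\<chi> i. frechet_derivative f (at y) (axis i 1))"

definition hess :: "(('n::finite) vect \<Rightarrow> real) \<Rightarrow> 'n vect \<Rightarrow> real^'n^'n" where
  "hess f x = (\<chi> i j. frechet_derivative (\<lambda>y. grad f y $ i) (at x) (axis j 1))"

primrec conv_pow :: "('n::finite) vect measure \<Rightarrow> nat \<Rightarrow> 'n vect measure" where
  "conv_pow \<nu> 0 = return borel 0"
| "conv_pow \<nu> (Suc n) = convolution \<nu> (conv_pow \<nu> n)"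

definition tent :: "('n::finite) vect \<Rightarrow> real" where
  "tent x = (\<Prod>j\<in>UNIV. max (1 - \<bar>x $ j\<bar>) 0)"

definition tent_c :: "real \<Rightarrow> ('n::finite) vect \<Rightarrow> real" where
  "tent_c c x = c powr (- real CARD('n)) * tent ((1 / c) *\<^sub>R x)"

definition phi :: "('n::finite) vect measure \<Rightarrow> nat \<Rightarrow> real \<Rightarrow> 'n vect \<Rightarrow> real" where
  "phi \<nu> n c x = (\<integral> s. tent_c c (s - real n *\<^sub>R x) \<partial>(conv_pow \<nu> n))"

definition charf :: "('n::finite) vect measure \<Rightarrow> 'n vect \<Rightarrow> complex" where
  "charf \<nu> s = (CLINT x|\<nu>. cis (inner s x))"

definition cramer_condition :: "('n::finite) vect measure \<Rightarrow> bool" where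
  "cramer_condition \<nu> \<longleftrightarrow>
     (\<forall>\<alpha>>0. (SUP s\<in>{s. norm s \<ge> \<alpha>}. norm (charf \<nu> s)) < 1)"

end

theory Submission
  imports Defs
begin

text \<open>
  For \<open>x = \<nabla>L(u)\<close> the exponentially tilted probability \<open>\<nu>\<^sub>u = e\<^bsup>\<langle>u,y\<rangle> - L(u)\<^esup> \<nu>(dy)\<close> has mean \<open>x\<close> and
  covariance \<open>D\<^sup>2L(u) = (D\<^sup>2J(x))\<^sup>-\<^sup>1\<close>, and tilting commutes with convolution powers.  On the support of
  \<open>k\<^sub>c\<close> the tilting density is constant up to a factor \<open>1 + O(c)\<close>, so \<open>\<phi>\<^sub>n\<^sub>,\<^sub>c(x)\<close> is \<open>e\<^bsup>-nJ(x)\<^esup>\<close> times the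
  same functional of \<open>\<nu>\<^sub>u\<close>, for which a local limit theorem is proved by Fourier inversion.  Since \<open>k\<close>
  has the integrable nonnegative Fourier transform \<open>\<Prod>\<^sub>j sinc(\<xi>\<^sub>j/2)\<^sup>2\<close>, the contribution of frequencies
  away from \<open>0\<close> is at most \<open>\<rho>\<^sup>n c\<^sup>-\<^sup>d\<close> by the Cramer condition (which survives tilting, with one \<open>\<rho> < 1\<close>
  for all \<open>u\<close> in a compact set), and low frequencies give a Gaussian integral by dominated convergence
  with a majorant independent of \<open>u\<close>.
\<close>

subsection \<open>Linear changes of variables and Gaussian integrals\<close>

lemma prod_Basis_cart: "(\<Prod>b\<in>(Basis :: (real^'n) set). g b) = (\<Prod>i\<in>UNIV. g (axis i 1))"
proof -
  have B: "(Basis :: (real^'n) set) = (\<lambda>i. axis i 1) ` UNIV"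
    by (auto simp: Basis_vec_def)
  show ?thesis
    unfolding B by (subst prod.reindex) (auto simp: inj_on_def axis_eq_axis)
qed

lemma measurable_vec_lambda [measurable]:
  fixes f :: "'n::finite \<Rightarrow> 'a \<Rightarrow> real"
  assumes [measurable]: "\<And>i. f i \<in> borel_measurable M"
  shows "(\<lambda>x. \<chi> i. f i x) \<in> borel_measurable M"
proof -
  have "(\<lambda>x. (\<chi> i. f i x) :: real^'n) = (\<lambda>x. \<Sum>i\<in>UNIV. f i x *\<^sub>R axis i 1)"
    by (rule ext) (simp add: vec_eq_iff axis_def if_distrib[where f="\<lambda>z. c * z" for c] cong: if_cong)
  then show ?thesis by simp
qed

lemma lborel_cart:
  "lborel = distr (\<Pi>\<^sub>M i\<in>UNIV. lborel) borel (\<lambda>f. (\<chi> i. f i) :: real^'n)"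
proof (rule lborel_eqI)
  interpret product_sigma_finite "\<lambda>_::'n. lborel :: real measure" ..
  fix l u :: "real^'n" assume le: "\<And>b. b \<in> Basis \<Longrightarrow> l \<bullet> b \<le> u \<bullet> b"
  have le': "l $ i \<le> u $ i" for i
    using le[of "axis i 1"] by (auto simp: inner_axis Basis_vec_def)
  have eq: "(\<lambda>f. (\<chi> i. f i) :: real^'n) -` box l u \<inter> space (\<Pi>\<^sub>M i\<in>UNIV. lborel) = (\<Pi>\<^sub>E i\<in>UNIV. {l$i<..<u$i})"
    by (auto simp: mem_box_cart space_PiM PiE_def Pi_def)
  have "emeasure (distr (\<Pi>\<^sub>M i\<in>UNIV. lborel) borel (\<lambda>f. (\<chi> i. f i) :: real^'n)) (box l u)
     = emeasure (\<Pi>\<^sub>M i\<in>UNIV. lborel) (\<Pi>\<^sub>E i\<in>(UNIV::'n set). {l$i<..<u$i})"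
    by (subst emeasure_distr) (auto simp: eq)
  also have "\<dots> = (\<Prod>i\<in>UNIV. emeasure lborel {l$i<..<u$i})"
    by (rule emeasure_PiM) auto
  also have "\<dots> = (\<Prod>b\<in>Basis. (u - l) \<bullet> b)"
    using le' by (simp add: prod_Basis_cart inner_axis prod_ennreal)
  finally show "emeasure (distr (\<Pi>\<^sub>M i\<in>UNIV. lborel) borel (\<lambda>f. (\<chi> i. f i) :: real^'n)) (box l u) = (\<Prod>b\<in>Basis. (u - l) \<bullet> b)" .
qed simp

lemma nn_integral_lborel_cart:
  fixes f :: "real^'n \<Rightarrow> ennreal"
  assumes [measurable]: "f \<in> borel_measurable borel"
  shows "(\<integral>\<^sup>+x. f x \<partial>lborel) = (\<integral>\<^sup>+g. f (\<chi> i. g i) \<partial>(\<Pi>\<^sub>M i\<in>UNIV. lborel))"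
  by (subst lborel_cart, subst nn_integral_distr) auto

lemma
  fixes f :: "'n::finite \<Rightarrow> real \<Rightarrow> 'b::{real_normed_field,banach,second_countable_topology}"
  assumes "\<And>i. integrable lborel (f i)"
  shows integrable_lborel_prod_cart: "integrable lborel (\<lambda>x::real^'n. \<Prod>i\<in>UNIV. f i (x $ i))"
    and integral_lborel_prod_cart: "(\<integral>x. (\<Prod>i\<in>UNIV. f i ((x::real^'n) $ i)) \<partial>lborel) = (\<Prod>i\<in>UNIV. \<integral>x. f i x \<partial>lborel)"
proof -
  interpret product_sigma_finite "\<lambda>_::'n. lborel :: real measure" ..
  have [measurable]: "f i \<in> borel_measurable borel" for i
    using assms[of i] by auto
  show "integrable lborel (\<lambda>x::real^'n. \<Prod>i\<in>UNIV. f i (x $ i))"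
    using product_integrable_prod[of UNIV f] assms
    by (subst lborel_cart, subst integrable_distr_eq) auto
  show "(\<integral>x. (\<Prod>i\<in>UNIV. f i ((x::real^'n) $ i)) \<partial>lborel) = (\<Prod>i\<in>UNIV. \<integral>x. f i x \<partial>lborel)"
    using product_integral_prod[of UNIV f] assms
    by (subst lborel_cart, subst integral_distr) auto
qed

lemma borel_measurable_matrix_vector_mult [measurable]:
  fixes A :: "real^'n^'m"
  shows "(\<lambda>x. A *v x) \<in> borel_measurable borel"
  by (intro borel_measurable_continuous_onI matrix_vector_mult_linear_continuous_on)

lemma nn_integral_lborel_permute:
  fixes f :: "real^'n \<Rightarrow> ennreal"
  assumes p: "p permutes UNIV" and f: "f \<in> borel_measurable borel"
  shows "(\<integral>\<^sup>+x. f (\<chi> i. x $ p i) \<partial>lborel) = (\<integral>\<^sup>+x. f x \<partial>lborel)"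
proof -
  note f[measurable]
  have bij: "bij p" using p by (rule permutes_bij)
  have "lborel = distr lborel borel (\<lambda>x. (\<chi> i. x $ p i) :: real^'n)"
  proof (rule lborel_eqI)
    fix l u :: "real^'n" assume le: "\<And>b. b \<in> Basis \<Longrightarrow> l \<bullet> b \<le> u \<bullet> b"
    have le': "l $ i \<le> u $ i" for i
      using le[of "axis i 1"] by (auto simp: inner_axis Basis_vec_def)
    define q where "q = inv p"
    have q: "q permutes UNIV" unfolding q_def using p by (rule permutes_inv)
    have pq: "p (q i) = i" "q (p i) = i" for i
      using permutes_inverses[OF p] by (auto simp: q_def)
    have eq: "(\<lambda>x. (\<chi> i. x $ p i) :: real^'n) -` box l u \<inter> space lborel = box (\<chi> i. l $ q i) (\<chi> i. u $ q i)"
      by (auto simp: mem_box_cart) (metis pq)+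
    have "emeasure (distr lborel borel (\<lambda>x. (\<chi> i. x $ p i) :: real^'n)) (box l u)
      = emeasure lborel (box (\<chi> i. l $ q i) (\<chi> i. u $ q i) :: (real^'n) set)"
      by (subst emeasure_distr) (auto simp: eq[symmetric])
    also have "\<dots> = (\<Prod>i\<in>UNIV. (u $ q i - l $ q i))"
      by (subst emeasure_lborel_box) (use le' in \<open>auto simp: prod_Basis_cart inner_axis, auto simp: Basis_vec_def inner_axis\<close>)
    also have "(\<Prod>i\<in>UNIV. (u $ q i - l $ q i)) = (\<Prod>i\<in>UNIV. u $ i - l $ i)"
      using prod.permute[OF q, of "\<lambda>i. u $ i - l $ i"] by (simp add: o_def)
    also have "ennreal \<dots> = (\<Prod>b\<in>Basis. (u - l) \<bullet> b)"
      by (simp add: prod_Basis_cart inner_axis)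
    finally show "emeasure (distr lborel borel (\<lambda>x. (\<chi> i. x $ p i) :: real^'n)) (box l u) = (\<Prod>b\<in>Basis. (u - l) \<bullet> b)" .
  qed simp
  then have "(\<integral>\<^sup>+x. f x \<partial>lborel) = (\<integral>\<^sup>+x. f x \<partial>distr lborel borel (\<lambda>x. (\<chi> i. x $ p i) :: real^'n))"
    by (rule arg_cong[where f="\<lambda>M. integral\<^sup>N M f"])
  then show ?thesis by (simp add: nn_integral_distr)
qed

lemma nn_integral_lborel_shear:
  fixes f :: "real^'n \<Rightarrow> ennreal"
  assumes mn: "m \<noteq> n" and f[measurable]: "f \<in> borel_measurable borel"
  shows "(\<integral>\<^sup>+x. f (\<chi> i. if i = m then x $ m + c * x $ n else x $ i) \<partial>lborel) = (\<integral>\<^sup>+x. f x \<partial>lborel)"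
proof -
  interpret product_sigma_finite "\<lambda>_::'n. lborel :: real measure" ..
  have U: "UNIV = insert m (UNIV - {m})" by auto
  let ?h = "\<lambda>x. (\<chi> i. if i = m then x m + c * x n else x i) :: real^'n"
  have "(\<integral>\<^sup>+x. f (\<chi> i. if i = m then x $ m + c * x $ n else x $ i) \<partial>lborel)
      = (\<integral>\<^sup>+g. f (?h g) \<partial>(\<Pi>\<^sub>M i\<in>UNIV. lborel))"
    by (subst nn_integral_lborel_cart) (auto cong: if_cong)
  also have "\<dots> = (\<integral>\<^sup>+g. (\<integral>\<^sup>+y. f (?h (g(m := y))) \<partial>lborel) \<partial>(\<Pi>\<^sub>M i\<in>UNIV-{m}. lborel))"
  proof -
    have "(\<lambda>g. f (?h g)) \<in> borel_measurable (\<Pi>\<^sub>M i\<in>UNIV. lborel)" by measurable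
    then show ?thesis by (subst U, subst product_nn_integral_insert) (auto simp flip: U)
  qed
  also have "\<dots> = (\<integral>\<^sup>+g. (\<integral>\<^sup>+y. f (\<chi> i. (g(m := y)) i) \<partial>lborel) \<partial>(\<Pi>\<^sub>M i\<in>UNIV-{m}. lborel))"
  proof (rule nn_integral_cong)
    fix g :: "'n \<Rightarrow> real"
    have "(\<integral>\<^sup>+y. f (\<chi> i. (g(m := y)) i) \<partial>lborel) = (\<integral>\<^sup>+y. f (\<chi> i. (g(m := c * g n + 1 * y)) i) \<partial>lborel)"
    proof -
      have "(\<lambda>y. f (\<chi> i. if i = m then y else g i)) \<in> borel_measurable borel" by measurable
      from nn_integral_real_affine[OF this, of 1 "c * g n"] show ?thesis
        by (simp add: fun_upd_def cong: if_cong)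
    qed
    also have "\<dots> = (\<integral>\<^sup>+y. f (?h (g(m := y))) \<partial>lborel)"
      using mn by (intro nn_integral_cong arg_cong[where f=f]) (auto simp: vec_eq_iff)
    finally show "(\<integral>\<^sup>+y. f (?h (g(m := y))) \<partial>lborel) = (\<integral>\<^sup>+y. f (\<chi> i. (g(m := y)) i) \<partial>lborel)" by simp
  qed
  also have "\<dots> = (\<integral>\<^sup>+g. f (\<chi> i. g i) \<partial>(\<Pi>\<^sub>M i\<in>UNIV. lborel))"
  proof -
    have "(\<lambda>g. f (\<chi> i. g i)) \<in> borel_measurable (\<Pi>\<^sub>M i\<in>UNIV. lborel)" by measurable
    then show ?thesis by (subst (2) U, subst product_nn_integral_insert) (auto simp flip: U)
  qed
  also have "\<dots> = (\<integral>\<^sup>+x. f x \<partial>lborel)"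
    by (subst nn_integral_lborel_cart) auto
  finally show ?thesis .
qed

lemma nn_integral_lborel_diagonal:
  fixes f :: "real^'n \<Rightarrow> ennreal"
  assumes a: "\<And>i. a i \<noteq> 0" and f[measurable]: "f \<in> borel_measurable borel"
  shows "(\<integral>\<^sup>+x. f x \<partial>lborel) = ennreal \<bar>\<Prod>i\<in>UNIV. a i\<bar> * (\<integral>\<^sup>+x. f (\<chi> i. a i * x $ i) \<partial>lborel)"
proof -
  let ?c = "\<lambda>b::real^'n. \<Sum>i\<in>UNIV. b $ i * a i"
  have c: "?c (axis k 1) = a k" for k
    by (simp add: axis_def if_distrib[where f="\<lambda>z. z * c" for c] cong: if_cong)
  have sB: "(\<Sum>b\<in>(Basis::(real^'n) set). g b) = (\<Sum>i\<in>UNIV. g (axis i 1))" for g :: "real^'n \<Rightarrow> real^'n"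
  proof -
    have B: "(Basis :: (real^'n) set) = (\<lambda>i. axis i 1) ` UNIV"
      by (auto simp: Basis_vec_def)
    show ?thesis unfolding B by (subst sum.reindex) (auto simp: inj_on_def axis_eq_axis)
  qed
  have "?c b \<noteq> 0" if "b \<in> Basis" for b
    using that a by (auto simp: Basis_vec_def c)
  note aff = lborel_affine_euclidean[of ?c 0, OF this]
  have T: "0 + (\<Sum>i\<in>UNIV. (a i * (x \<bullet> axis i 1)) *\<^sub>R axis i 1) = (\<chi> i. a i * x $ i)" for x :: "real^'n"
    by (simp add: vec_eq_iff inner_axis) (simp add: axis_def if_distrib[where f="\<lambda>z. c * z" for c] cong: if_cong)
  from aff
  have eq: "lborel = density (distr lborel borel (\<lambda>x. \<chi> i. a i * x $ i)) (\<lambda>_. ennreal (\<Prod>i\<in>UNIV. \<bar>a i\<bar>))"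
    unfolding prod_Basis_cart sB c
    by (simp only: T)
  have "(\<integral>\<^sup>+x. f x \<partial>lborel) = (\<integral>\<^sup>+x. f x \<partial>density (distr lborel borel (\<lambda>x. \<chi> i. a i * x $ i)) (\<lambda>_. ennreal (\<Prod>i\<in>UNIV. \<bar>a i\<bar>)))"
    by (rule arg_cong[where f="\<lambda>M. integral\<^sup>N M f", OF eq])
  also have "\<dots> = ennreal \<bar>\<Prod>i\<in>UNIV. a i\<bar> * (\<integral>\<^sup>+x. f (\<chi> i. a i * x $ i) \<partial>lborel)"
    by (simp add: nn_integral_density nn_integral_distr nn_integral_cmult abs_prod)
  finally show ?thesis .
qed

text \<open>
  The change of variables theorems of \<open>HOL-Analysis\<close> need a well-ordered index type; reducing to elementary
  matrices gives the linear case for an arbitrary finite one.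
\<close>

lemma nn_integral_lborel_linear:
  fixes A :: "real^'n^'n" and f :: "real^'n \<Rightarrow> ennreal"
  assumes "det A \<noteq> 0" "f \<in> borel_measurable borel"
  shows "(\<integral>\<^sup>+x. f x \<partial>lborel) = ennreal \<bar>det A\<bar> * (\<integral>\<^sup>+x. f (A *v x) \<partial>lborel)"
proof -
  let ?P = "\<lambda>A::real^'n^'n. det A \<noteq> 0 \<longrightarrow> (\<forall>f\<in>borel_measurable borel.
       (\<integral>\<^sup>+x. f x \<partial>lborel) = ennreal \<bar>det A\<bar> * (\<integral>\<^sup>+x. f (A *v x) \<partial>lborel))"
  have "?P A"
  proof (rule induct_matrix_elementary[of ?P])
    fix A B :: "real^'n^'n" assume A: "?P A" and B: "?P B"
    show "?P (A ** B)"
    proof (intro impI ballI)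
      fix f :: "real^'n \<Rightarrow> ennreal" assume nz: "det (A ** B) \<noteq> 0" and f[measurable]: "f \<in> borel_measurable borel"
      have "(\<integral>\<^sup>+x. f x \<partial>lborel) = ennreal \<bar>det A\<bar> * (\<integral>\<^sup>+x. f (A *v x) \<partial>lborel)"
        by (rule A[rule_format, OF _ f]) (use nz in \<open>simp add: det_mul\<close>)
      also have "(\<integral>\<^sup>+x. f (A *v x) \<partial>lborel) = ennreal \<bar>det B\<bar> * (\<integral>\<^sup>+x. f (A *v (B *v x)) \<partial>lborel)"
        by (rule B[rule_format, of "\<lambda>x. f (A *v x)"]) (use nz in \<open>simp_all add: det_mul\<close>)
      finally show "(\<integral>\<^sup>+x. f x \<partial>lborel) = ennreal \<bar>det (A ** B)\<bar> * (\<integral>\<^sup>+x. f ((A ** B) *v x) \<partial>lborel)"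
        by (simp add: det_mul abs_mult ennreal_mult mult.assoc matrix_vector_mul_assoc)
    qed
  next
    fix A :: "real^'n^'n" and i assume "row i A = 0"
    then show "?P A" using det_zero_row(1)[of i A] by blast
  next
    fix A :: "real^'n^'n" assume d: "\<And>i j. i \<noteq> j \<Longrightarrow> A$i$j = 0"
    have det: "det A = (\<Prod>i\<in>UNIV. A$i$i)" by (rule det_diagonal) (rule d)
    have mv: "A *v x = (\<chi> i. A$i$i * x $ i)" for x
    proof -
      have "(\<Sum>j\<in>UNIV. A $ i $ j * x $ j) = A$i$i * x$i" for i
        using d[of i] by (subst sum.remove[of _ i]) (auto intro!: sum.neutral)
      then show ?thesis by (simp add: matrix_vector_mult_def vec_eq_iff)
    qed
    show "?P A"
    proof (intro impI ballI)
      fix f :: "real^'n \<Rightarrow> ennreal" assume nz: "det A \<noteq> 0" and f: "f \<in> borel_measurable borel"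
      have "A$i$i \<noteq> 0" for i using nz det by auto
      from nn_integral_lborel_diagonal[OF this f]
      show "(\<integral>\<^sup>+x. f x \<partial>lborel) = ennreal \<bar>det A\<bar> * (\<integral>\<^sup>+x. f (A *v x) \<partial>lborel)"
        unfolding mv det .
    qed
  next
    fix m n :: 'n assume mn: "m \<noteq> n"
    let ?t = "Transposition.transpose m n"
    let ?A = "(\<chi> i j. mat 1 $ i $ ?t j) :: real^'n^'n"
    have p: "?t permutes UNIV" by (rule permutes_swap_id) auto
    have det: "\<bar>det ?A\<bar> = 1"
      using det_permute_columns[OF p, of "mat 1 :: real^'n^'n"] mn by (simp add: sign_swap_id)
    have eq: "?A *v x = (\<chi> i. x $ ?t i)" for x
    proof -
      have "(\<Sum>j\<in>UNIV. (if i = ?t j then 1 else 0) * x $ j) = x $ ?t i" for i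
      proof -
        have *: "(i = ?t j) = (j = ?t i)" for j by (metis transpose_involutory)
        show ?thesis unfolding * by (simp add: if_distrib[where f="\<lambda>z. z * c" for c] cong: if_cong)
      qed
      then show ?thesis by (simp add: matrix_vector_mult_def vec_eq_iff mat_def)
    qed
    show "?P ?A"
      using nn_integral_lborel_permute[OF p] unfolding eq det by simp
  next
    fix m n :: 'n and c :: real assume mn: "m \<noteq> n"
    let ?A = "(\<chi> i j. if i = m \<and> j = n then c else of_bool (i = j)) :: real^'n^'n"
    have "?A = (\<chi> k. if k = m then row m (mat 1) + c *s row n (mat 1) else row k (mat 1))"
      using mn by (auto simp: vec_eq_iff row_def mat_def)
    then have det: "det ?A = 1" using det_row_operation[OF mn, of "mat 1 :: real^'n^'n" c] by simp
    have eq: "?A *v x = (\<chi> i. if i = m then x $ m + c * x $ n else x $ i)" for x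
    proof -
      have "(\<Sum>j\<in>UNIV. (if i = m \<and> j = n then c else of_bool (i = j)) * x $ j) = (if i = m then x $ m + c * x $ n else x $ i)" for i
      proof -
        have *: "(if i = m \<and> j = n then c else of_bool (i = j)) * x $ j = (if j = i then x $ i else 0) + (if j = n then (if i = m then c * x $ n else 0) else 0)" for j
          using mn by auto
        show ?thesis unfolding * by (simp add: sum.distrib)
      qed
      then show ?thesis by (simp add: matrix_vector_mult_def vec_eq_iff)
    qed
    show "?P ?A"
      using nn_integral_lborel_shear[OF mn] unfolding eq det by simp
  qed
  with assms show ?thesis by blast
qed

lemma symmetric_form_commute:
  fixes H :: "real^'n^'n"
  assumes "transpose H = H"
  shows "x \<bullet> (H *v y) = y \<bullet> (H *v x)"
  using assms by (metis dot_lmul_matrix inner_commute transpose_matrix_vector)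

lemma exists_form_orthonormal_basis:
  fixes H :: "real^'n^'n"
  assumes sym: "transpose H = H" and pos: "\<And>x. x \<noteq> 0 \<Longrightarrow> 0 < x \<bullet> (H *v x)"
  shows "\<exists>b::'n \<Rightarrow> real^'n. \<forall>i j. b i \<bullet> (H *v b j) = of_bool (i = j)"
proof -
  have "\<exists>b::'n \<Rightarrow> real^'n. \<forall>i\<in>S. \<forall>j\<in>S. b i \<bullet> (H *v b j) = of_bool (i = j)" if "finite S" for S
    using that
  proof induction
    case (insert k S)
    then obtain b :: "'n \<Rightarrow> real^'n" where b: "\<And>i j. i \<in> S \<Longrightarrow> j \<in> S \<Longrightarrow> b i \<bullet> (H *v b j) = of_bool (i = j)"
      by blast
    let ?W = "(\<lambda>i. H *v b i) ` S"
    have "dim ?W \<le> card ?W" using insert by (intro dim_le_card') auto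
    also have "\<dots> \<le> card S" using insert by (intro card_image_le)
    also have "\<dots> < card (insert k S)" using insert by simp
    also have "\<dots> \<le> CARD('n)" by (intro card_mono) auto
    finally have "dim ?W < DIM(real^'n)" by simp
    from orthogonal_to_subspace_exists[OF this] obtain v :: "real^'n" where v0: "v \<noteq> 0"
      and v: "\<And>y. y \<in> span ?W \<Longrightarrow> orthogonal v y" by blast
    have vS: "v \<bullet> (H *v b i) = 0" if "i \<in> S" for i
      using v[of "H *v b i"] that by (auto intro: span_base simp: orthogonal_def)
    let ?s = "sqrt (v \<bullet> (H *v v))"
    have s: "?s > 0" using pos[OF v0] by simp
    have s2: "?s * ?s = v \<bullet> (H *v v)" using pos[OF v0] by simp
    define w where "w = (1 / ?s) *\<^sub>R v"
    have wS: "w \<bullet> (H *v b i) = 0" "b i \<bullet> (H *v w) = 0" if "i \<in> S" for i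
      using vS[OF that] symmetric_form_commute[OF sym, of "b i" w] by (auto simp: w_def)
    have ww: "w \<bullet> (H *v w) = 1"
      using s s2 by (simp add: w_def matrix_vector_mult_scaleR field_simps)
    show ?case
      using wS ww b insert(2) by (intro exI[of _ "b(k := w)"]) auto
  qed simp
  from this[of UNIV] show ?thesis by auto
qed

lemma exists_form_diagonalization:
  fixes H :: "real^'n^'n"
  assumes "transpose H = H" "\<And>x. x \<noteq> 0 \<Longrightarrow> 0 < x \<bullet> (H *v x)"
  obtains B :: "real^'n^'n" where "transpose B ** H ** B = mat 1"
proof -
  obtain b :: "'n \<Rightarrow> real^'n" where b: "\<And>i j. b i \<bullet> (H *v b j) = of_bool (i = j)"
    using exists_form_orthonormal_basis[OF assms] by blast
  let ?B = "(\<chi> i j. b j $ i) :: real^'n^'n"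
  have "(transpose ?B ** H ** ?B) $ i $ j = b i \<bullet> (H *v b j)" for i j
  proof -
    have "(transpose ?B ** H ** ?B) $ i $ j = (\<Sum>k\<in>UNIV. (\<Sum>l\<in>UNIV. b i $ l * H $ l $ k) * b j $ k)"
      by (simp add: matrix_matrix_mult_def transpose_def)
    also have "\<dots> = (\<Sum>k\<in>UNIV. \<Sum>l\<in>UNIV. b i $ l * H $ l $ k * b j $ k)"
      by (simp add: sum_distrib_right)
    also have "\<dots> = (\<Sum>l\<in>UNIV. \<Sum>k\<in>UNIV. b i $ l * H $ l $ k * b j $ k)"
      by (rule sum.swap)
    also have "\<dots> = b i \<bullet> (H *v b j)"
      by (simp add: matrix_vector_mult_def inner_vec_def sum_distrib_left mult.assoc)
    finally show ?thesis .
  qed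
  then have "transpose ?B ** H ** ?B = mat 1"
    by (simp add: vec_eq_iff b mat_def)
  then show ?thesis by (rule that)
qed

lemma posdef_det_pos:
  fixes H :: "real^'n^'n"
  assumes "transpose H = H" "\<And>x. x \<noteq> 0 \<Longrightarrow> 0 < x \<bullet> (H *v x)"
  shows "0 < det H"
proof -
  obtain B :: "real^'n^'n" where B: "transpose B ** H ** B = mat 1"
    by (rule exists_form_diagonalization[OF assms])
  then have "det (transpose B ** H ** B) = 1" by simp
  then have "(det B)\<^sup>2 * det H = 1" by (simp add: det_mul power2_eq_square mult_ac)
  then show ?thesis by (smt (verit) mult_nonneg_nonpos zero_le_power2)
qed

lemma sqrt_2pi_power: "sqrt (2 * pi) ^ n = (2 * pi) powr (real n / 2)"
proof -
  have "sqrt (2 * pi) ^ n = ((2 * pi) powr (1/2)) powr real n"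
    by (subst powr_realpow) (auto simp: powr_half_sqrt)
  then show ?thesis by (simp add: powr_powr)
qed

lemma has_bochner_integral_gaussian:
  "has_bochner_integral lborel (\<lambda>x::real^'n. exp (- (x \<bullet> x) / 2)) ((2 * pi) powr (real CARD('n) / 2))"
proof -
  have "has_bochner_integral lborel (\<lambda>x. sqrt (2 * pi) * std_normal_density x) (sqrt (2 * pi) * 1)"
    using std_normal_moment_even[of 0] by (intro has_bochner_integral_mult_right) simp
  then have 1: "has_bochner_integral lborel (\<lambda>x::real. exp (- x\<^sup>2 / 2)) (sqrt (2 * pi))"
    by (simp add: std_normal_density_def)
  then have int: "integrable lborel (\<lambda>x::real. exp (- x\<^sup>2 / 2))" by (rule integrable.intros)
  have eq: "exp (- (x \<bullet> x) / 2) = (\<Prod>i\<in>UNIV. exp (- (x $ i)\<^sup>2 / 2))" for x :: "real^'n"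
    by (simp add: exp_sum[symmetric] inner_vec_def sum_negf sum_divide_distrib power2_eq_square)
  show ?thesis
    unfolding eq has_bochner_integral_iff
    using integrable_lborel_prod_cart[OF int] integral_lborel_prod_cart[OF int] has_bochner_integral_integral_eq[OF 1]
    by (simp add: sqrt_2pi_power)
qed

lemma has_bochner_integral_gaussian_form:
  fixes H :: "real^'n^'n"
  assumes sym: "transpose H = H" and pos: "\<And>x. x \<noteq> 0 \<Longrightarrow> 0 < x \<bullet> (H *v x)"
  shows "has_bochner_integral lborel (\<lambda>x. exp (- (x \<bullet> (H *v x)) / 2)) ((2 * pi) powr (real CARD('n) / 2) / sqrt (det H))"
proof -
  obtain B :: "real^'n^'n" where B: "transpose B ** H ** B = mat 1"
    by (rule exists_form_diagonalization[OF assms])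
  then have "det (transpose B ** H ** B) = 1" by simp
  then have d: "(det B)\<^sup>2 * det H = 1" by (simp add: det_mul power2_eq_square mult_ac)
  then have d0: "det B \<noteq> 0" by auto
  have dH: "det H > 0" by (rule posdef_det_pos[OF assms])
  have "sqrt ((det B)\<^sup>2 * det H) = 1" using d by simp
  then have dB: "\<bar>det B\<bar> = 1 / sqrt (det H)" using dH by (simp add: real_sqrt_mult field_simps)
  have form: "(B *v x) \<bullet> (H *v (B *v x)) = x \<bullet> x" for x
  proof -
    have "(B *v x) \<bullet> (H *v (B *v x)) = (H *v (B *v x)) \<bullet> (B *v x)"
      by (rule inner_commute)
    also have "\<dots> = ((H *v (B *v x)) v* B) \<bullet> x"
      by (rule dot_lmul_matrix[symmetric])
    also have "\<dots> = ((transpose B ** H ** B) *v x) \<bullet> x"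
      by (simp only: transpose_matrix_vector[symmetric] matrix_vector_mul_assoc matrix_mul_assoc)
    finally have "(B *v x) \<bullet> (H *v (B *v x)) = ((transpose B ** H ** B) *v x) \<bullet> x" .
    then show ?thesis by (simp add: B)
  qed
  have "(\<integral>\<^sup>+x. ennreal (exp (- (x \<bullet> (H *v x)) / 2)) \<partial>lborel)
      = ennreal \<bar>det B\<bar> * (\<integral>\<^sup>+x. ennreal (exp (- ((x::real^'n) \<bullet> x) / 2)) \<partial>lborel)"
    by (subst nn_integral_lborel_linear[OF d0]) (auto simp: form)
  also have "(\<integral>\<^sup>+x. ennreal (exp (- ((x::real^'n) \<bullet> x) / 2)) \<partial>lborel) = ennreal ((2 * pi) powr (real CARD('n) / 2))"
    using has_bochner_integral_gaussian by (subst nn_integral_eq_integral) (auto simp: has_bochner_integral_iff)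
  finally have "(\<integral>\<^sup>+x. ennreal (exp (- (x \<bullet> (H *v x)) / 2)) \<partial>lborel) = ennreal ((2 * pi) powr (real CARD('n) / 2) / sqrt (det H))"
    using dH by (simp add: dB ennreal_mult[symmetric])
  then show ?thesis
    by (intro has_bochner_integral_nn_integral) (use dH in auto)
qed

subsection \<open>Fourier inversion for the tent function\<close>

definition sinc_sq :: "real \<Rightarrow> real" where
  "sinc_sq x = (sinc (x / 2))\<^sup>2"

lemma sinc_sq_nz: "x \<noteq> 0 \<Longrightarrow> sinc_sq x = 2 * (1 - cos x) / x\<^sup>2"
proof -
  assume x: "x \<noteq> 0"
  have "cos x = 1 - 2 * (sin (x/2))\<^sup>2"
    using cos_double_sin[of "x/2"] by simp
  with x show ?thesis by (simp add: sinc_sq_def power_divide field_simps)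
qed

lemma sinc_sq_0 [simp]: "sinc_sq 0 = 1"
  by (simp add: sinc_sq_def)

lemma sinc_sq_minus [simp]: "sinc_sq (- x) = sinc_sq x"
  by (simp add: sinc_sq_def)

lemma sinc_sq_nonneg [simp]: "0 \<le> sinc_sq x"
  by (simp add: sinc_sq_def)

lemma continuous_on_sinc_sq [continuous_intros]:
  "continuous_on S f \<Longrightarrow> continuous_on S (\<lambda>x. sinc_sq (f x))"
  unfolding sinc_sq_def by (intro continuous_intros) auto

lemma isCont_sinc_sq: "isCont sinc_sq x"
  using continuous_on_sinc_sq[of UNIV "\<lambda>x. x"] by (simp add: continuous_on_eq_continuous_at)

lemma borel_measurable_sinc_sq [measurable]: "sinc_sq \<in> borel_measurable borel"
  by (intro borel_measurable_continuous_onI continuous_on_sinc_sq continuous_on_id)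

lemma has_bochner_integral_1_minus_cos_half:
  "has_bochner_integral lborel (\<lambda>x::real. (1 - cos x) / x\<^sup>2 * indicator {0<..} x) (pi / 2)"
proof -
  define f where "f x = (if x = 0 then 1/2 else (1 - cos x) / x\<^sup>2)" for x :: real
  have f_sinc: "f x = sinc_sq x / 2" for x
    using sinc_sq_nz[of x] by (auto simp: f_def)
  \<comment> \<open>\<open>Si x - (1 - cos x) / x\<close> is an antiderivative of \<open>(1 - cos x) / x\<^sup>2\<close>; here both are extended by continuity to \<open>0\<close>.\<close>
  define F where "F x = Si x - x / 2 * sinc_sq x" for x :: real
  have F_alt: "F x = Si x - (1 - cos x) / x" if "x \<noteq> 0" for x
    using that by (simp add: F_def sinc_sq_nz power2_eq_square field_simps)
  have f_cont: "isCont f x" for x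
    unfolding f_sinc[abs_def] by (intro continuous_intros isCont_sinc_sq) auto
  have F_cont: "isCont F x" for x
    unfolding F_def[abs_def] by (intro continuous_intros isCont_Si isCont_sinc_sq) auto
  have deriv: "(F has_real_derivative f x) (at x)" if "x > 0" for x
  proof -
    have "((\<lambda>x. Si x - (1 - cos x) / x) has_real_derivative f x) (at x)"
      using that by (auto intro!: derivative_eq_intros DERIV_Si simp: f_def field_simps power2_eq_square)
    moreover have "\<forall>\<^sub>F y in nhds x. F y = Si y - (1 - cos y) / y"
      using that by (intro eventually_mono[OF eventually_nhds_in_open[of "{0<..}" x]]) (auto simp: F_alt)
    ultimately show ?thesis by (subst DERIV_cong_ev[OF refl _ refl]) auto
  qed
  have lim_top: "(F \<longlongrightarrow> pi / 2) at_top"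
  proof -
    have "((\<lambda>x::real. (1 - cos x) / x) \<longlongrightarrow> 0) at_top"
    proof (rule Lim_null_comparison)
      show "\<forall>\<^sub>F x::real in at_top. norm ((1 - cos x) / x) \<le> 2 / x"
        using eventually_gt_at_top[of 0]
      proof eventually_elim
        case (elim x)
        have "\<bar>1 - cos x\<bar> \<le> 2" using cos_ge_minus_one[of x] cos_le_one[of x] by linarith
        with elim show ?case by (simp add: divide_right_mono)
      qed
      show "((\<lambda>x::real. 2 / x) \<longlongrightarrow> 0) at_top" by real_asymp
    qed
    from tendsto_diff[OF Si_at_top this]
    have "((\<lambda>x. Si x - (1 - cos x) / x) \<longlongrightarrow> pi / 2) at_top" by simp
    moreover have "\<forall>\<^sub>F x in at_top. F x = Si x - (1 - cos x) / x"
      using eventually_gt_at_top[of 0] by eventually_elim (simp add: F_alt)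
    ultimately show ?thesis by (simp add: tendsto_cong)
  qed
  have F0: "F 0 = 0" by (simp add: F_def Si_def zero_ereal_def[symmetric])
  have A: "((F \<circ> real_of_ereal) \<longlongrightarrow> 0) (at_right 0)"
    using F_cont[of 0] F0 unfolding isCont_def zero_ereal_def
    by (auto simp: ereal_tendsto_simps intro: filterlim_at_split[THEN iffD1, THEN conjunct2])
  have B: "((F \<circ> real_of_ereal) \<longlongrightarrow> pi / 2) (at_left \<infinity>)"
    using lim_top by (simp add: ereal_tendsto_simps)
  have FTC: "set_integrable lborel (einterval 0 \<infinity>) f" "(LBINT x=0..\<infinity>. f x) = pi / 2 - 0"
    by (rule interval_integral_FTC_nonneg[of 0 \<infinity> F f 0 "pi/2"];
        use A B deriv f_cont in \<open>auto simp: f_sinc zero_ereal_def\<close>)+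
  have "einterval 0 \<infinity> = {0::real<..}" by (auto simp: einterval_def zero_ereal_def)
  with FTC have "has_bochner_integral lborel (\<lambda>x. f x * indicator {0<..} x) (pi / 2)"
    by (simp add: has_bochner_integral_iff set_integrable_def set_lebesgue_integral_def
        interval_lebesgue_integral_def mult.commute zero_ereal_def)
  moreover have "(\<lambda>x. f x * indicator {0<..} x) = (\<lambda>x. (1 - cos x) / x\<^sup>2 * indicator {0<..} x)"
    by (auto simp: f_def indicator_def)
  ultimately show ?thesis by simp
qed

text \<open>The integrand is \<open>0\<close> at the origin because \<open>0 / 0 = 0\<close>.\<close>

lemma has_bochner_integral_1_minus_cos:
  "has_bochner_integral lborel (\<lambda>x::real. (1 - cos (t * x)) / x\<^sup>2) (pi * \<bar>t\<bar>)"
proof (cases "t = 0")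
  case False
  let ?g = "\<lambda>x::real. (1 - cos x) / x\<^sup>2"
  have "has_bochner_integral lborel (\<lambda>x. ?g (0 + (-1) * x) * indicator {0<..} (0 + (-1) * x)) ((pi / 2) /\<^sub>R \<bar>-1\<bar>)"
    using has_bochner_integral_1_minus_cos_half
    by (subst lborel_has_bochner_integral_real_affine_iff[symmetric, where f="\<lambda>x. ?g x * indicator {0<..} x"]) auto
  then have "has_bochner_integral lborel (\<lambda>x. ?g x * indicator {..<0} x) (pi / 2)"
    by (simp add: indicator_def)
  from has_bochner_integral_add[OF this has_bochner_integral_1_minus_cos_half]
  have "has_bochner_integral lborel (\<lambda>x. ?g x * indicator {..<0} x + ?g x * indicator {0<..} x) pi"
    by simp
  also have "(\<lambda>x. ?g x * indicator {..<0} x + ?g x * indicator {0<..} x) = ?g"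
    by (rule ext) (auto simp: indicator_def)
  finally have "has_bochner_integral lborel (\<lambda>x. ?g (0 + t * x)) (pi /\<^sub>R \<bar>t\<bar>)"
    using False by (subst (asm) lborel_has_bochner_integral_real_affine_iff[where c=t and t=0]) auto
  from has_bochner_integral_mult_right[OF this, of "t\<^sup>2"]
  have int: "has_bochner_integral lborel (\<lambda>x. t\<^sup>2 * ?g (0 + t * x)) (t\<^sup>2 * (pi /\<^sub>R \<bar>t\<bar>))" .
  show ?thesis
  proof -
    have "(\<lambda>x. t\<^sup>2 * ?g (0 + t * x)) = (\<lambda>x. (1 - cos (t * x)) / x\<^sup>2)"
      using False by (simp add: power_mult_distrib)
    moreover have "t\<^sup>2 * (pi /\<^sub>R \<bar>t\<bar>) = pi * \<bar>t\<bar>"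
      using False by (simp add: power2_eq_square abs_if field_simps)
    ultimately show ?thesis using int by (simp only:)
  qed
qed (simp add: has_bochner_integral_zero)

lemma has_bochner_integral_sinc_sq_cos:
  "has_bochner_integral lborel (\<lambda>x::real. sinc_sq x * cos (z * x)) (2 * pi * max (1 - \<bar>z\<bar>) 0)"
proof -
  let ?g = "\<lambda>t x::real. (1 - cos (t * x)) / x\<^sup>2"
  have "has_bochner_integral lborel (\<lambda>x. ?g (z + 1) x + ?g (z - 1) x - 2 * ?g z x) (pi * \<bar>z + 1\<bar> + pi * \<bar>z - 1\<bar> - 2 * (pi * \<bar>z\<bar>))"
    by (intro has_bochner_integral_add has_bochner_integral_diff has_bochner_integral_mult_right
        has_bochner_integral_1_minus_cos)
  moreover have "pi * \<bar>z + 1\<bar> + pi * \<bar>z - 1\<bar> - 2 * (pi * \<bar>z\<bar>) = 2 * pi * max (1 - \<bar>z\<bar>) 0"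
  proof -
    have "\<bar>z + 1\<bar> + \<bar>z - 1\<bar> - 2 * \<bar>z\<bar> = 2 * max (1 - \<bar>z\<bar>) 0" by (auto simp: abs_if max_def)
    from arg_cong[OF this, of "\<lambda>t. pi * t"] show ?thesis by (simp add: algebra_simps)
  qed
  moreover have "AE x in lborel. ?g (z + 1) x + ?g (z - 1) x - 2 * ?g z x = sinc_sq x * cos (z * x)"
    using AE_lborel_singleton[of 0]
  proof eventually_elim
    case (elim x)
    have "?g (z + 1) x + ?g (z - 1) x - 2 * ?g z x
        = ((1 - cos (z * x + x)) + (1 - cos (z * x - x)) - 2 * (1 - cos (z * x))) / x\<^sup>2"
      by (simp add: diff_divide_distrib add_divide_distrib algebra_simps)
    also have "\<dots> = (2 * (1 - cos x) * cos (z * x)) / x\<^sup>2"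
      by (simp add: cos_add cos_diff algebra_simps)
    finally show ?case using elim by (simp add: sinc_sq_nz)
  qed
  ultimately show ?thesis
    by (subst has_bochner_integral_cong_AE[THEN iffD1]) (auto)
qed

lemma has_bochner_integral_sinc_sq_sin:
  "has_bochner_integral lborel (\<lambda>x::real. sinc_sq x * sin (z * x)) 0"
proof -
  let ?h = "\<lambda>x::real. sinc_sq x * sin (z * x)"
  have "integrable lborel (\<lambda>x::real. sinc_sq x * cos (0 * x))"
    using has_bochner_integral_sinc_sq_cos[of 0] by (rule integrable.intros)
  then have int: "integrable lborel ?h"
    by (rule Bochner_Integration.integrable_bound)
       (auto simp: abs_mult intro!: mult_left_le)
  have "integral\<^sup>L lborel ?h = \<bar>-1\<bar> *\<^sub>R (\<integral>x. ?h (0 + (-1) * x) \<partial>lborel)"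
    by (rule lborel_integral_real_affine) simp
  also have "\<dots> = - integral\<^sup>L lborel ?h" by simp
  finally show ?thesis using int by (simp add: has_bochner_integral_iff)
qed

lemma has_bochner_integral_sinc_sq_cis:
  "has_bochner_integral lborel (\<lambda>x::real. complex_of_real (sinc_sq x) * cis (z * x))
     (complex_of_real (2 * pi * max (1 - \<bar>z\<bar>) 0))"
proof -
  let ?c = "\<lambda>x::real. sinc_sq x * cos (z * x)" and ?s = "\<lambda>x::real. sinc_sq x * sin (z * x)"
  have "has_bochner_integral lborel (\<lambda>x. complex_of_real (?c x) + \<i> * complex_of_real (?s x))
      (complex_of_real (2 * pi * max (1 - \<bar>z\<bar>) 0) + \<i> * complex_of_real 0)"
    by (intro has_bochner_integral_add has_bochner_integral_mult_right has_bochner_integral_of_real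
        has_bochner_integral_sinc_sq_cos has_bochner_integral_sinc_sq_sin)
  also have "(\<lambda>x. complex_of_real (?c x) + \<i> * complex_of_real (?s x))
      = (\<lambda>x. complex_of_real (sinc_sq x) * cis (z * x))"
    by (rule ext) (simp add: complex_eq_iff)
  finally show ?thesis by simp
qed

text \<open>The Fourier transform of \<open>tent\<close>.\<close>

definition fejer :: "real^'n \<Rightarrow> real" where
  "fejer x = (\<Prod>i\<in>UNIV. sinc_sq (x $ i))"

lemma fejer_nonneg: "0 \<le> fejer x"
  by (simp add: fejer_def prod_nonneg)

lemma has_bochner_integral_fejer_cis:
  "has_bochner_integral lborel (\<lambda>x. complex_of_real (fejer x) * cis (z \<bullet> x))
     (complex_of_real ((2 * pi) ^ CARD('n) * tent (z::real^'n)))"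
proof -
  let ?f = "\<lambda>i (x::real). complex_of_real (sinc_sq x) * cis (z $ i * x)"
  have int: "integrable lborel (?f i)" for i
    using has_bochner_integral_sinc_sq_cis by (rule integrable.intros)
  have "(\<Prod>i\<in>UNIV. cis (g i)) = cis (\<Sum>i\<in>UNIV. g i)" for g :: "'n \<Rightarrow> real"
    by (simp add: cis_conv_exp sum_distrib_left exp_sum)
  then have eq: "complex_of_real (fejer x) * cis (z \<bullet> x) = (\<Prod>i\<in>UNIV. ?f i (x $ i))" for x
    by (simp add: fejer_def prod.distrib inner_vec_def)
  show ?thesis
    unfolding eq has_bochner_integral_iff
    using integrable_lborel_prod_cart[of ?f, OF int] integral_lborel_prod_cart[of ?f, OF int]
      has_bochner_integral_integral_eq[OF has_bochner_integral_sinc_sq_cis]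
    by (simp add: prod.distrib tent_def)
qed

subsection \<open>Moments of exponential tilts\<close>

lemma power_le_fact_exp:
  fixes s :: real
  assumes "0 \<le> s"
  shows "s ^ m \<le> fact m * exp s"
proof -
  have "(\<Sum>n\<in>{m}. s ^ n /\<^sub>R fact n) \<le> (\<Sum>n. s ^ n /\<^sub>R fact n)"
    using assms by (intro sum_le_suminf summable_exp_generic) auto
  then have "s ^ m / fact m \<le> exp s" by (simp add: exp_def field_simps)
  then show ?thesis by (simp add: field_simps)
qed

lemma abs_exp_minus_linear_le:
  fixes t :: real
  shows "\<bar>exp t - 1 - t\<bar> \<le> t\<^sup>2 * exp \<bar>t\<bar>"
proof -
  obtain s where s: "\<bar>s\<bar> \<le> \<bar>t\<bar>" "exp t = (\<Sum>m<2. t ^ m / fact m) + (exp s / fact 2) * t ^ 2"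
    using Maclaurin_exp_le[of t 2] by blast
  have "exp t - 1 - t = exp s / 2 * t\<^sup>2"
    using s(2) by (simp add: numeral_2_eq_2)
  then have "\<bar>exp t - 1 - t\<bar> = exp s / 2 * t\<^sup>2" by (simp only: abs_of_nonneg zero_le_mult_iff) simp
  also have "\<dots> \<le> exp \<bar>t\<bar> * t\<^sup>2"
  proof (rule mult_right_mono)
    have "exp s \<le> exp \<bar>t\<bar>" using s(1) by simp
    then show "exp s / 2 \<le> exp \<bar>t\<bar>" using exp_gt_zero[of s] by linarith
  qed simp
  finally show ?thesis by (simp add: mult.commute)
qed

definition emom :: "(real^'n) measure \<Rightarrow> (real^'n \<Rightarrow> real) \<Rightarrow> real^'n \<Rightarrow> real" where
  "emom \<nu> f u = (\<integral>y. exp (u \<bullet> y) * f y \<partial>\<nu>)"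

definition mgf :: "(real^'n) measure \<Rightarrow> real^'n \<Rightarrow> real" where
  "mgf \<nu> u = emom \<nu> (\<lambda>_. 1) u"

definition tilt_mean :: "(real^'n) measure \<Rightarrow> real^'n \<Rightarrow> real^'n" where
  "tilt_mean \<nu> u = (\<chi> i. emom \<nu> (\<lambda>y. y $ i) u / mgf \<nu> u)"

definition tilt_cov :: "(real^'n) measure \<Rightarrow> real^'n \<Rightarrow> real^'n^'n" where
  "tilt_cov \<nu> u = (\<chi> i j. emom \<nu> (\<lambda>y. y $ i * y $ j) u / mgf \<nu> u - tilt_mean \<nu> u $ i * tilt_mean \<nu> u $ j)"

locale borel_prob = prob_space \<nu> for \<nu> :: "(real^'n) measure" +
  assumes sets_eq_borel [measurable_cong, simp]: "sets \<nu> = sets borel"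
begin

abbreviation "D \<equiv> interior (dom_L \<nu>)"

lemma space_eq_UNIV [simp]: "space \<nu> = UNIV"
  using sets_eq_imp_space_eq[OF sets_eq_borel] by simp

lemma integrable_exp_dom_L: "u \<in> dom_L \<nu> \<Longrightarrow> integrable \<nu> (\<lambda>y. exp (u \<bullet> y))"
  by (intro integrableI_nonneg) (auto simp: dom_L_def laplace_def)

lemma integrable_exp_norm:
  assumes "u \<in> D"
  obtains \<rho> where "\<rho> > 0" "integrable \<nu> (\<lambda>y. exp (u \<bullet> y + \<rho> * norm y))"
proof -
  obtain r where r: "r > 0" "ball u r \<subseteq> dom_L \<nu>"
    using assms by (auto simp: mem_interior)
  define \<rho> where "\<rho> = r / (2 * real CARD('n))"
  have \<rho>: "\<rho> > 0" using r by (simp add: \<rho>_def)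
  let ?e = "\<lambda>i. (r / 2) *\<^sub>R (axis i 1 :: real^'n)"
  have in_dom: "u + ?e i \<in> dom_L \<nu>" "u - ?e i \<in> dom_L \<nu>" for i
    using r by (auto intro!: subsetD[OF r(2)] simp: dist_norm norm_axis_1)
  let ?g = "\<lambda>y. \<Sum>i\<in>UNIV. exp ((u + ?e i) \<bullet> y) + exp ((u - ?e i) \<bullet> y)"
  have int: "integrable \<nu> ?g"
    by (intro Bochner_Integration.integrable_sum Bochner_Integration.integrable_add integrable_exp_dom_L in_dom)
  have le: "exp (u \<bullet> y + \<rho> * norm y) \<le> ?g y" for y
  proof -
    obtain k where k: "\<And>i. \<bar>y $ i\<bar> \<le> \<bar>y $ k\<bar>"
    proof -
      have "Max (range (\<lambda>i. \<bar>y $ i\<bar>)) \<in> range (\<lambda>i. \<bar>y $ i\<bar>)" by (intro Max_in) auto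
      then obtain k where "Max (range (\<lambda>i. \<bar>y $ i\<bar>)) = \<bar>y $ k\<bar>" by (rule imageE)
      moreover have "\<bar>y $ i\<bar> \<le> Max (range (\<lambda>i. \<bar>y $ i\<bar>))" for i by (intro Max_ge) auto
      ultimately show ?thesis using that by metis
    qed
    have "norm y \<le> (\<Sum>i\<in>UNIV. \<bar>y $ i\<bar>)" by (rule norm_le_l1_cart)
    also have "\<dots> \<le> (\<Sum>i\<in>(UNIV::'n set). \<bar>y $ k\<bar>)" by (intro sum_mono k)
    finally have "\<rho> * norm y \<le> \<rho> * (real CARD('n) * \<bar>y $ k\<bar>)" using \<rho> by simp
    also have "\<dots> = r / 2 * \<bar>y $ k\<bar>" by (simp add: \<rho>_def)
    finally have 1: "\<rho> * norm y \<le> r / 2 * \<bar>y $ k\<bar>" .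
    have e: "(u + ?e i) \<bullet> y = u \<bullet> y + r / 2 * y $ i" "(u - ?e i) \<bullet> y = u \<bullet> y - r / 2 * y $ i" for i
      by (simp_all add: inner_add_left inner_diff_left inner_axis')
    have "exp (u \<bullet> y + \<rho> * norm y) \<le> exp (u \<bullet> y + r / 2 * \<bar>y $ k\<bar>)" using 1 by simp
    also have "\<dots> \<le> exp ((u + ?e k) \<bullet> y) + exp ((u - ?e k) \<bullet> y)"
      unfolding e by (cases "y $ k \<ge> 0") auto
    also have "\<dots> \<le> ?g y"
      by (rule member_le_sum) (auto intro: add_nonneg_nonneg)
    finally show ?thesis .
  qed
  have "integrable \<nu> (\<lambda>y. exp (u \<bullet> y + \<rho> * norm y))"
    by (rule Bochner_Integration.integrable_bound[OF int]) (use le in \<open>auto intro: order_trans[OF le abs_ge_self]\<close>)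
  with \<rho> show ?thesis by (rule that)
qed

lemma integrable_exp_poly_norm:
  assumes "u \<in> D"
  obtains \<rho> where "\<rho> > 0" "\<And>m. integrable \<nu> (\<lambda>y. exp (u \<bullet> y + \<rho> * norm y) * norm y ^ m)"
proof -
  obtain r where r: "r > 0" "integrable \<nu> (\<lambda>y. exp (u \<bullet> y + r * norm y))"
    by (rule integrable_exp_norm[OF assms])
  have "integrable \<nu> (\<lambda>y. exp (u \<bullet> y + r / 2 * norm y) * norm y ^ m)" for m
  proof (rule Bochner_Integration.integrable_bound)
    show "integrable \<nu> (\<lambda>y. (fact m * (2 / r) ^ m) * exp (u \<bullet> y + r * norm y))"
      using r by (intro integrable_mult_right)
    have "exp (u \<bullet> y + r / 2 * norm y) * norm y ^ m \<le> (fact m * (2 / r) ^ m) * exp (u \<bullet> y + r * norm y)" for y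
    proof -
      have "norm y ^ m = (2 / r) ^ m * (r / 2 * norm y) ^ m"
        using r by (simp add: power_mult_distrib[symmetric])
      also have "\<dots> \<le> (2 / r) ^ m * (fact m * exp (r / 2 * norm y))"
        using r by (intro mult_left_mono power_le_fact_exp) auto
      finally have "exp (u \<bullet> y + r / 2 * norm y) * norm y ^ m
        \<le> exp (u \<bullet> y + r / 2 * norm y) * ((2 / r) ^ m * (fact m * exp (r / 2 * norm y)))"
        by (intro mult_left_mono) auto
      also have "\<dots> = (fact m * (2 / r) ^ m) * exp (u \<bullet> y + r * norm y)"
        by (simp add: exp_add[symmetric] mult_ac)
      finally show ?thesis .
    qed
    then show "AE y in \<nu>. norm (exp (u \<bullet> y + r / 2 * norm y) * norm y ^ m) \<le> norm ((fact m * (2 / r) ^ m) * exp (u \<bullet> y + r * norm y))"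
      using r by simp
  qed measurable
  with r show ?thesis by (intro that[of "r / 2"]) auto
qed

lemma integrable_emom:
  assumes u: "u \<in> D" and f[measurable]: "f \<in> borel_measurable borel" and le: "\<And>y. \<bar>f y\<bar> \<le> norm y ^ m"
  shows "integrable \<nu> (\<lambda>y. exp (u \<bullet> y) * f y)"
proof -
  obtain r where r: "r > 0" "\<And>m. integrable \<nu> (\<lambda>y. exp (u \<bullet> y + r * norm y) * norm y ^ m)"
    using integrable_exp_poly_norm[OF u] by metis
  show ?thesis
  proof (rule Bochner_Integration.integrable_bound[OF r(2)[of m]])
    show "AE y in \<nu>. norm (exp (u \<bullet> y) * f y) \<le> norm (exp (u \<bullet> y + r * norm y) * norm y ^ m)"
      using r(1) by (intro AE_I2) (auto simp: abs_mult intro!: mult_mono le)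
  qed measurable
qed

lemma has_derivative_emom:
  assumes u: "u \<in> D" and f[measurable]: "f \<in> borel_measurable borel" and le: "\<And>y. \<bar>f y\<bar> \<le> norm y ^ m"
  shows "(emom \<nu> f has_derivative (\<lambda>h. \<Sum>i\<in>UNIV. h $ i * emom \<nu> (\<lambda>y. y $ i * f y) u)) (at u)"
proof -
  obtain r where r: "r > 0" "\<And>m. integrable \<nu> (\<lambda>y. exp (u \<bullet> y + r * norm y) * norm y ^ m)"
    using integrable_exp_poly_norm[OF u] by metis
  obtain r1 where r1: "r1 > 0" "ball u r1 \<subseteq> D"
    using u open_contains_ball[of D] by auto
  define C where "C = (\<integral>y. exp (u \<bullet> y + r * norm y) * norm y ^ (m + 2) \<partial>\<nu>)"
  have bl: "bounded_linear (\<lambda>h. \<Sum>i\<in>UNIV. h $ i * emom \<nu> (\<lambda>y. y $ i * f y) u)"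
    by (intro bounded_linear_sum bounded_linear_mult_const bounded_linear_vec_nth)
  have int_yf: "integrable \<nu> (\<lambda>y. exp (u \<bullet> y) * (y $ i * f y))" for i
  proof (rule integrable_emom[OF u, of _ "Suc m"])
    show "\<bar>y $ i * f y\<bar> \<le> norm y ^ Suc m" for y
      using component_le_norm_cart[of y i] le[of y] by (auto simp: abs_mult intro!: mult_mono)
  qed measurable
  have int_f: "integrable \<nu> (\<lambda>y. exp (v \<bullet> y) * f y)" if "v \<in> D" for v
    by (rule integrable_emom[OF that f le])
  show ?thesis
  proof (rule has_derivativeI_sandwich[where e="min r r1" and H="\<lambda>v. C * norm (v - u)"])
    show "0 < min r r1" using r r1 by simp
    show "bounded_linear (\<lambda>h. \<Sum>i\<in>UNIV. h $ i * emom \<nu> (\<lambda>y. y $ i * f y) u)" by (rule bl)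
    show "((\<lambda>v. C * norm (v - u)) \<longlongrightarrow> 0) (at u)"
      by (auto intro!: tendsto_eq_intros)
    fix v assume v: "v \<noteq> u" "dist v u < min r r1"
    define h where "h = v - u"
    have vD: "v \<in> D" using v r1 by (auto simp: dist_commute)
    have h: "norm h < r" using v by (simp add: h_def dist_norm)
    have "emom \<nu> f v - emom \<nu> f u - (\<Sum>i\<in>UNIV. (v - u) $ i * emom \<nu> (\<lambda>y. y $ i * f y) u)
        = (\<integral>y. exp (v \<bullet> y) * f y - exp (u \<bullet> y) * f y - (\<Sum>i\<in>UNIV. h $ i * (exp (u \<bullet> y) * (y $ i * f y))) \<partial>\<nu>)"
      unfolding emom_def h_def[symmetric]
      by (subst Bochner_Integration.integral_diff Bochner_Integration.integral_sum; (intro Bochner_Integration.integrable_diff Bochner_Integration.integrable_sum integrable_mult_right int_f int_yf vD u)?)+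
         (simp add: Bochner_Integration.integral_sum int_yf)
    also have "\<dots> = (\<integral>y. exp (u \<bullet> y) * (exp (h \<bullet> y) - 1 - h \<bullet> y) * f y \<partial>\<nu>)"
    proof (rule Bochner_Integration.integral_cong[OF refl])
      fix y
      have "exp (v \<bullet> y) = exp (u \<bullet> y) * exp (h \<bullet> y)"
        by (simp add: h_def exp_add[symmetric] inner_diff_left)
      moreover have "(\<Sum>i\<in>UNIV. h $ i * (exp (u \<bullet> y) * (y $ i * f y))) = exp (u \<bullet> y) * (h \<bullet> y) * f y"
        by (simp add: inner_vec_def sum_distrib_left sum_distrib_right mult_ac)
      ultimately show "exp (v \<bullet> y) * f y - exp (u \<bullet> y) * f y - (\<Sum>i\<in>UNIV. h $ i * (exp (u \<bullet> y) * (y $ i * f y)))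
        = exp (u \<bullet> y) * (exp (h \<bullet> y) - 1 - h \<bullet> y) * f y"
        by (simp add: algebra_simps)
    qed
    finally have eq: "emom \<nu> f v - emom \<nu> f u - (\<Sum>i\<in>UNIV. (v - u) $ i * emom \<nu> (\<lambda>y. y $ i * f y) u)
       = (\<integral>y. exp (u \<bullet> y) * (exp (h \<bullet> y) - 1 - h \<bullet> y) * f y \<partial>\<nu>)" .
    have ptw: "norm (exp (u \<bullet> y) * (exp (h \<bullet> y) - 1 - h \<bullet> y) * f y)
        \<le> (norm h)\<^sup>2 * (exp (u \<bullet> y + r * norm y) * norm y ^ (m + 2))" for y
    proof -
      have hy: "\<bar>h \<bullet> y\<bar> \<le> norm h * norm y" by (rule Cauchy_Schwarz_ineq2)
      also have "\<dots> \<le> r * norm y" using h by (intro mult_right_mono) auto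
      finally have hr: "\<bar>h \<bullet> y\<bar> \<le> r * norm y" .
      have "\<bar>exp (h \<bullet> y) - 1 - h \<bullet> y\<bar> \<le> (h \<bullet> y)\<^sup>2 * exp \<bar>h \<bullet> y\<bar>"
        by (rule abs_exp_minus_linear_le)
      also have "\<dots> \<le> (norm h * norm y)\<^sup>2 * exp (r * norm y)"
      proof (rule mult_mono)
        show "(h \<bullet> y)\<^sup>2 \<le> (norm h * norm y)\<^sup>2"
          using hy by (simp add: abs_le_square_iff[symmetric] abs_mult)
      qed (use hr in auto)
      finally have "\<bar>exp (h \<bullet> y) - 1 - h \<bullet> y\<bar> \<le> (norm h * norm y)\<^sup>2 * exp (r * norm y)" .
      then have "norm (exp (u \<bullet> y) * (exp (h \<bullet> y) - 1 - h \<bullet> y) * f y)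
        \<le> exp (u \<bullet> y) * ((norm h * norm y)\<^sup>2 * exp (r * norm y)) * norm y ^ m"
        unfolding real_norm_def abs_mult abs_exp_cancel by (intro mult_mono le order_refl mult_nonneg_nonneg) auto
      then show ?thesis
        by (simp add: exp_add power_add power2_eq_square mult_ac)
    qed
    have int_bd: "integrable \<nu> (\<lambda>y. (norm h)\<^sup>2 * (exp (u \<bullet> y + r * norm y) * norm y ^ (m + 2)))"
      by (intro integrable_mult_right r)
    have "integrable \<nu> (\<lambda>y. exp (u \<bullet> y) * (exp (h \<bullet> y) - 1 - h \<bullet> y) * f y)"
      by (rule Bochner_Integration.integrable_bound[OF int_bd]) (measurable, use ptw in simp)
    from Bochner_Integration.integral_norm_bound_integral[OF this int_bd ptw]
    have "norm (\<integral>y. exp (u \<bullet> y) * (exp (h \<bullet> y) - 1 - h \<bullet> y) * f y \<partial>\<nu>)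
        \<le> (\<integral>y. (norm h)\<^sup>2 * (exp (u \<bullet> y + r * norm y) * norm y ^ (m + 2)) \<partial>\<nu>)" .
    also have "\<dots> = (norm h)\<^sup>2 * C" unfolding C_def by simp
    finally show "norm (emom \<nu> f v - emom \<nu> f u - (\<Sum>i\<in>UNIV. (v - u) $ i * emom \<nu> (\<lambda>y. y $ i * f y) u)) / norm (v - u) \<le> C * norm (v - u)"
      unfolding eq using v by (simp add: h_def[symmetric] divide_le_eq power2_eq_square mult_ac)
  qed
qed

lemma mgf_pos:
  assumes "u \<in> D" shows "0 < mgf \<nu> u"
proof -
  have "integrable \<nu> (\<lambda>y. exp (u \<bullet> y))"
    using assms interior_subset by (intro integrable_exp_dom_L) auto
  then have "0 < (\<integral>y. exp (u \<bullet> y) \<partial>\<nu>)"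
    by (subst integral_less_AE_space[of "\<lambda>_. 0", simplified]) (use emeasure_space_1 in auto)
  then show ?thesis by (simp add: mgf_def emom_def)
qed

lemma logL_eq: "logL \<nu> u = ln (mgf \<nu> u)"
proof -
  have "(\<integral>y. exp (u \<bullet> y) \<partial>\<nu>) = enn2real (laplace \<nu> u)"
    unfolding laplace_def by (rule integral_eq_nn_integral) auto
  then show ?thesis by (simp add: logL_def mgf_def emom_def)
qed

lemma has_derivative_mgf:
  assumes u: "u \<in> D"
  shows "(mgf \<nu> has_derivative (\<lambda>h. mgf \<nu> u * (tilt_mean \<nu> u \<bullet> h))) (at u)"
proof -
  have "(mgf \<nu> has_derivative (\<lambda>h. \<Sum>i\<in>UNIV. h $ i * emom \<nu> (\<lambda>y. y $ i) u)) (at u)"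
    unfolding mgf_def[abs_def] using has_derivative_emom[OF u, of "\<lambda>_. 1" 0] by simp
  also have "(\<lambda>h. \<Sum>i\<in>UNIV. h $ i * emom \<nu> (\<lambda>y. y $ i) u) = (\<lambda>h. mgf \<nu> u * (tilt_mean \<nu> u \<bullet> h))"
    using mgf_pos[OF u] by (simp add: tilt_mean_def inner_vec_def sum_distrib_left mult_ac)
  finally show ?thesis .
qed

lemma has_derivative_logL:
  assumes u: "u \<in> D"
  shows "(logL \<nu> has_derivative (\<lambda>h. tilt_mean \<nu> u \<bullet> h)) (at u)"
proof -
  have "((\<lambda>v. ln (mgf \<nu> v)) has_derivative (\<lambda>h. tilt_mean \<nu> u \<bullet> h)) (at u)"
    using mgf_pos[OF u] by (auto intro!: derivative_eq_intros has_derivative_mgf[OF u])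
  then show ?thesis by (simp add: logL_eq[abs_def])
qed

lemma abs_component_mult_le: "\<bar>y $ i * y $ j\<bar> \<le> norm (y::real^'n) ^ 2"
  using component_le_norm_cart[of y i] component_le_norm_cart[of y j]
  by (auto simp: abs_mult power2_eq_square intro!: mult_mono)

lemma has_derivative_tilt_mean:
  assumes u: "u \<in> D"
  shows "(tilt_mean \<nu> has_derivative (\<lambda>h. tilt_cov \<nu> u *v h)) (at u)"
proof (subst has_derivative_componentwise_within, intro ballI)
  fix b :: "real^'n" assume "b \<in> Basis"
  then obtain i where b: "b = axis i 1" by (auto simp: Basis_vec_def)
  have "(emom \<nu> (\<lambda>y. y $ i) has_derivative (\<lambda>h. \<Sum>j\<in>UNIV. h $ j * emom \<nu> (\<lambda>y. y $ j * y $ i) u)) (at u)"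
    by (rule has_derivative_emom[OF u, of _ 1]) (auto intro: component_le_norm_cart)
  then have "((\<lambda>v. emom \<nu> (\<lambda>y. y $ i) v / mgf \<nu> v) has_derivative
     (\<lambda>h. - emom \<nu> (\<lambda>y. y $ i) u * (inverse (mgf \<nu> u) * (mgf \<nu> u * (tilt_mean \<nu> u \<bullet> h)) * inverse (mgf \<nu> u))
        + (\<Sum>j\<in>UNIV. h $ j * emom \<nu> (\<lambda>y. y $ j * y $ i) u) / mgf \<nu> u)) (at u)"
    using mgf_pos[OF u] by (intro has_derivative_divide has_derivative_mgf u) auto
  moreover have "- emom \<nu> (\<lambda>y. y $ i) u * (inverse (mgf \<nu> u) * (mgf \<nu> u * (tilt_mean \<nu> u \<bullet> h)) * inverse (mgf \<nu> u))
        + (\<Sum>j\<in>UNIV. h $ j * emom \<nu> (\<lambda>y. y $ j * y $ i) u) / mgf \<nu> u = (tilt_cov \<nu> u *v h) $ i" for h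
  proof -
    have c: "emom \<nu> (\<lambda>y. y $ j * y $ i) u = emom \<nu> (\<lambda>y. y $ i * y $ j) u" for j
      by (simp add: mult.commute)
    have "(tilt_cov \<nu> u *v h) $ i = (\<Sum>j\<in>UNIV. h $ j * emom \<nu> (\<lambda>y. y $ i * y $ j) u) / mgf \<nu> u
        - tilt_mean \<nu> u $ i * (tilt_mean \<nu> u \<bullet> h)"
      by (simp add: matrix_vector_mult_def tilt_cov_def inner_vec_def sum_distrib_left sum_subtractf
          left_diff_distrib right_diff_distrib sum_divide_distrib mult_ac)
    moreover have "tilt_mean \<nu> u $ i = emom \<nu> (\<lambda>y. y $ i) u / mgf \<nu> u"
      by (simp add: tilt_mean_def)
    ultimately show ?thesis
      unfolding c using mgf_pos[OF u] by (simp add: divide_inverse mult_ac)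
  qed
  ultimately show "((\<lambda>v. tilt_mean \<nu> v \<bullet> b) has_derivative (\<lambda>h. (tilt_cov \<nu> u *v h) \<bullet> b)) (at u)"
    by (simp add: b inner_axis tilt_mean_def)
qed

lemma continuous_on_emom:
  assumes f: "f \<in> borel_measurable borel" and le: "\<And>y. \<bar>f y\<bar> \<le> norm y ^ m"
  shows "continuous_on D (emom \<nu> f)"
  using has_derivative_emom[OF _ f le]
  by (intro continuous_at_imp_continuous_on ballI has_derivative_continuous) blast

lemma continuous_on_mgf: "continuous_on D (mgf \<nu>)"
  unfolding mgf_def[abs_def] by (rule continuous_on_emom[of _ 0]) auto

lemma continuous_on_tilt_mean: "continuous_on D (tilt_mean \<nu>)"
  using has_derivative_tilt_mean
  by (intro continuous_at_imp_continuous_on ballI has_derivative_continuous) blast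

lemma continuous_on_tilt_cov: "continuous_on D (tilt_cov \<nu>)"
  unfolding tilt_cov_def[abs_def]
  by (intro continuous_on_vec_lambda continuous_intros continuous_on_mgf continuous_on_tilt_mean
        continuous_on_emom[of _ 2] abs_component_mult_le) (auto dest: mgf_pos)

lemma transpose_tilt_cov: "transpose (tilt_cov \<nu> u) = tilt_cov \<nu> u"
  by (simp add: transpose_def tilt_cov_def vec_eq_iff mult.commute)

lemma inner_tilt_mean:
  assumes u: "u \<in> D"
  shows "x \<bullet> tilt_mean \<nu> u = emom \<nu> (\<lambda>y. x \<bullet> y) u / mgf \<nu> u"
proof -
  have int: "integrable \<nu> (\<lambda>y. exp (u \<bullet> y) * y $ i)" for i
    by (rule integrable_emom[OF u, of _ 1]) (auto intro: component_le_norm_cart)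
  have "emom \<nu> (\<lambda>y. x \<bullet> y) u = (\<integral>y. (\<Sum>i\<in>UNIV. x $ i * (exp (u \<bullet> y) * y $ i)) \<partial>\<nu>)"
    by (simp add: emom_def inner_vec_def[of x] sum_distrib_left mult_ac)
  also have "\<dots> = (\<Sum>i\<in>UNIV. x $ i * emom \<nu> (\<lambda>y. y $ i) u)"
    by (subst Bochner_Integration.integral_sum) (auto simp: emom_def int)
  finally show ?thesis
    by (simp add: tilt_mean_def inner_vec_def sum_divide_distrib)
qed

lemma integrable_emom_inner:
  assumes u: "u \<in> D"
  shows "integrable \<nu> (\<lambda>y. exp (u \<bullet> y) * (x \<bullet> y))" "integrable \<nu> (\<lambda>y. exp (u \<bullet> y) * (x \<bullet> y)\<^sup>2)"
proof -
  have "integrable \<nu> (\<lambda>y. exp (u \<bullet> y) * norm y ^ m)" for m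
    by (rule integrable_emom[OF u, of _ m]) auto
  note int = this
  show "integrable \<nu> (\<lambda>y. exp (u \<bullet> y) * (x \<bullet> y))"
    by (rule Bochner_Integration.integrable_bound[OF integrable_mult_right[OF int[of 1], of "norm x"]])
       (auto simp: abs_mult mult_ac intro!: AE_I2 Cauchy_Schwarz_ineq2 mult_left_mono
          order_trans[OF Cauchy_Schwarz_ineq2])
  have "(x \<bullet> y)\<^sup>2 \<le> (norm x)\<^sup>2 * norm y ^ 2" for y
    using Cauchy_Schwarz_ineq2[of x y] by (simp add: abs_le_square_iff[symmetric] abs_mult power_mult_distrib[symmetric])
  then show "integrable \<nu> (\<lambda>y. exp (u \<bullet> y) * (x \<bullet> y)\<^sup>2)"
    by (intro Bochner_Integration.integrable_bound[OF integrable_mult_right[OF int[of 2], of "(norm x)\<^sup>2"]])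
       (auto simp: abs_mult mult.left_commute intro!: AE_I2 mult_left_mono)
qed

lemma tilt_cov_form:
  assumes u: "u \<in> D"
  shows "x \<bullet> (tilt_cov \<nu> u *v x) = emom \<nu> (\<lambda>y. (x \<bullet> y - x \<bullet> tilt_mean \<nu> u)\<^sup>2) u / mgf \<nu> u"
proof -
  let ?b = "x \<bullet> tilt_mean \<nu> u"
  have int: "integrable \<nu> (\<lambda>y. exp (u \<bullet> y) * (y $ i * y $ j))" for i j
    by (rule integrable_emom[OF u, of _ 2]) (auto intro: abs_component_mult_le)
  have int0: "integrable \<nu> (\<lambda>y. exp (u \<bullet> y))" using integrable_emom[OF u, of "\<lambda>_. 1" 0] by simp
  have sq: "(x \<bullet> y)\<^sup>2 = (\<Sum>i\<in>UNIV. \<Sum>j\<in>UNIV. x $ i * x $ j * (y $ i * y $ j))" for y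
    by (simp add: power2_eq_square inner_vec_def sum_product mult_ac)
  have e2: "emom \<nu> (\<lambda>y. (x \<bullet> y)\<^sup>2) u = (\<Sum>i\<in>UNIV. \<Sum>j\<in>UNIV. x $ i * x $ j * emom \<nu> (\<lambda>y. y $ i * y $ j) u)"
  proof -
    have "emom \<nu> (\<lambda>y. (x \<bullet> y)\<^sup>2) u = (\<integral>y. (\<Sum>i\<in>UNIV. \<Sum>j\<in>UNIV. x $ i * x $ j * (exp (u \<bullet> y) * (y $ i * y $ j))) \<partial>\<nu>)"
      by (simp add: emom_def sq sum_distrib_left mult_ac)
    also have "\<dots> = (\<Sum>i\<in>UNIV. \<Sum>j\<in>UNIV. x $ i * x $ j * emom \<nu> (\<lambda>y. y $ i * y $ j) u)"
      by (simp add: Bochner_Integration.integral_sum Bochner_Integration.integrable_sum int emom_def)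
    finally show ?thesis .
  qed
  have "x \<bullet> (tilt_cov \<nu> u *v x) = (\<Sum>i\<in>UNIV. \<Sum>j\<in>UNIV. x $ i * x $ j * (emom \<nu> (\<lambda>y. y $ i * y $ j) u / mgf \<nu> u))
      - (\<Sum>i\<in>UNIV. \<Sum>j\<in>UNIV. (x $ i * tilt_mean \<nu> u $ i) * (x $ j * tilt_mean \<nu> u $ j))"
    by (simp add: inner_vec_def matrix_vector_mult_def tilt_cov_def sum_distrib_left sum_subtractf[symmetric] algebra_simps)
  also have "\<dots> = emom \<nu> (\<lambda>y. (x \<bullet> y)\<^sup>2) u / mgf \<nu> u - ?b\<^sup>2"
    by (simp add: e2 sum_divide_distrib sum_product[symmetric] inner_vec_def[of x "tilt_mean \<nu> u"]
        power2_eq_square[of "sum f A" for f A])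
  finally have lhs: "x \<bullet> (tilt_cov \<nu> u *v x) = emom \<nu> (\<lambda>y. (x \<bullet> y)\<^sup>2) u / mgf \<nu> u - ?b\<^sup>2" .
  have "emom \<nu> (\<lambda>y. (x \<bullet> y - ?b)\<^sup>2) u
      = (\<integral>y. exp (u \<bullet> y) * (x \<bullet> y)\<^sup>2 - 2 * ?b * (exp (u \<bullet> y) * (x \<bullet> y)) + ?b\<^sup>2 * exp (u \<bullet> y) \<partial>\<nu>)"
    by (simp add: emom_def power2_eq_square algebra_simps)
  also have "\<dots> = emom \<nu> (\<lambda>y. (x \<bullet> y)\<^sup>2) u - 2 * ?b * emom \<nu> (\<lambda>y. x \<bullet> y) u + ?b\<^sup>2 * mgf \<nu> u"
    by (simp add: integrable_emom_inner[OF u] int0 emom_def mgf_def)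
  also have "emom \<nu> (\<lambda>y. x \<bullet> y) u = ?b * mgf \<nu> u"
    using inner_tilt_mean[OF u, of x] mgf_pos[OF u] by simp
  finally have "emom \<nu> (\<lambda>y. (x \<bullet> y - ?b)\<^sup>2) u = emom \<nu> (\<lambda>y. (x \<bullet> y)\<^sup>2) u - ?b\<^sup>2 * mgf \<nu> u"
    by (simp add: power2_eq_square)
  then show ?thesis using mgf_pos[OF u] by (simp add: lhs field_simps)
qed

lemma tilt_cov_pos:
  assumes nd: "nondegenerate \<nu>" and u: "u \<in> D" and x: "x \<noteq> 0"
  shows "0 < x \<bullet> (tilt_cov \<nu> u *v x)"
proof (rule ccontr)
  let ?b = "x \<bullet> tilt_mean \<nu> u"
  let ?f = "\<lambda>y. exp (u \<bullet> y) * (x \<bullet> y - ?b)\<^sup>2"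
  assume "\<not> ?thesis"
  then have "emom \<nu> (\<lambda>y. (x \<bullet> y - ?b)\<^sup>2) u \<le> 0"
    unfolding tilt_cov_form[OF u] using mgf_pos[OF u] by (simp add: divide_le_0_iff not_less)
  then have z: "integral\<^sup>L \<nu> ?f = 0"
    using integral_nonneg_AE[where M=\<nu> and f="\<lambda>y. ?f y"] by (intro antisym) (simp_all add: emom_def)
  have int0: "integrable \<nu> (\<lambda>y. exp (u \<bullet> y))" using integrable_emom[OF u, of "\<lambda>_. 1" 0] by simp
  have "integrable \<nu> (\<lambda>y. exp (u \<bullet> y) * (x \<bullet> y)\<^sup>2 - 2 * ?b * (exp (u \<bullet> y) * (x \<bullet> y)) + ?b\<^sup>2 * exp (u \<bullet> y))"
    by (intro Bochner_Integration.integrable_add Bochner_Integration.integrable_diff integrable_mult_right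
        integrable_emom_inner[OF u] int0)
  also have "(\<lambda>y. exp (u \<bullet> y) * (x \<bullet> y)\<^sup>2 - 2 * ?b * (exp (u \<bullet> y) * (x \<bullet> y)) + ?b\<^sup>2 * exp (u \<bullet> y)) = ?f"
    by (simp add: power2_eq_square algebra_simps)
  finally have "AE y in \<nu>. ?f y = 0"
    using z by (subst (asm) integral_nonneg_eq_0_iff_AE) auto
  then have "AE y in \<nu>. x \<bullet> y = ?b" by simp
  with nd x show False unfolding nondegenerate_def by blast
qed

end

subsection \<open>Tilting and convolution powers\<close>

lemma lborel_integral_scaleR:
  fixes F :: "'a::euclidean_space \<Rightarrow> 'b::{banach, second_countable_topology}"
  assumes a: "0 < a" and [measurable]: "F \<in> borel_measurable borel"
  shows "integral\<^sup>L lborel F = a ^ DIM('a) *\<^sub>R (\<integral>x. F (a *\<^sub>R x) \<partial>lborel)"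
proof -
  have "integral\<^sup>L lborel F = integral\<^sup>L (density (distr lborel borel (\<lambda>x. 0 + a *\<^sub>R x)) (\<lambda>_. \<bar>a\<bar> ^ DIM('a))) F"
    using a by (intro arg_cong[where f="\<lambda>M. integral\<^sup>L M F"] lborel_affine) simp
  also have "\<dots> = a ^ DIM('a) *\<^sub>R (\<integral>x. F (a *\<^sub>R x) \<partial>lborel)"
    using a by (subst integral_density) (auto simp: integral_distr)
  finally show ?thesis .
qed

lemma tent_nonneg: "0 \<le> tent x"
  by (simp add: tent_def prod_nonneg)

lemma tent_le_1: "tent x \<le> 1"
  unfolding tent_def by (intro prod_le_1) auto

lemma tent_eq_0: "1 \<le> \<bar>x $ i\<bar> \<Longrightarrow> tent x = 0"
  unfolding tent_def by (intro prod_zero bexI[of _ i]) auto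

lemma borel_measurable_tent [measurable]: "tent \<in> borel_measurable borel"
  unfolding tent_def[abs_def] by measurable

lemma borel_measurable_fejer [measurable]: "fejer \<in> borel_measurable borel"
  unfolding fejer_def[abs_def] by measurable

lemma borel_measurable_tent_c [measurable]: "tent_c c \<in> borel_measurable borel"
  unfolding tent_c_def[abs_def] by measurable

lemma tent_c_nonneg: "0 \<le> tent_c c x"
  unfolding tent_c_def by (intro mult_nonneg_nonneg tent_nonneg) auto

lemma tent_c_le: "tent_c c (x::real^'n) \<le> c powr - real CARD('n)"
  unfolding tent_c_def by (intro mult_left_le tent_le_1) auto

lemma tent_c_eq_0:
  assumes "0 < c" "c \<le> \<bar>x $ i\<bar>"
  shows "tent_c c x = 0"
  using assms tent_eq_0[of "(1 / c) *\<^sub>R x" i] by (simp add: tent_c_def abs_mult)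

lemma integrable_fejer: "integrable lborel fejer"
proof -
  have "integrable lborel (\<lambda>x. complex_of_real (fejer x) * cis ((0::real^'n) \<bullet> x))"
    using has_bochner_integral_fejer_cis by (rule integrable.intros)
  from integrable_norm[OF this] show ?thesis by (simp add: norm_mult fejer_nonneg)
qed

lemma borel_measurable_cis [measurable]: "cis \<in> borel_measurable borel"
  by (intro borel_measurable_continuous_onI continuous_on_cis continuous_on_id)

context borel_prob
begin

lemma prob_UNIV [simp]: "prob UNIV = 1"
  using prob_space by simp

lemma borel_measurable_charf [measurable]: "charf \<nu> \<in> borel_measurable borel"
  unfolding charf_def[abs_def] by measurable

lemma norm_charf_le_1: "norm (charf \<nu> s) \<le> 1"
proof -
  have "norm (charf \<nu> s) \<le> (\<integral>y. norm (cis (s \<bullet> y)) \<partial>\<nu>)"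
    unfolding charf_def by (rule integral_norm_bound)
  then show ?thesis by simp
qed

lemma borel_prob_conv_pow: "borel_prob (conv_pow \<nu> n)"
proof (induction n)
  case 0
  interpret R: prob_space "return borel (0 :: real^'n)" by (rule prob_space_return) simp
  show ?case unfolding conv_pow.simps by unfold_locales simp
next
  case (Suc n)
  interpret N: borel_prob "conv_pow \<nu> n" by fact
  interpret P: pair_prob_space \<nu> "conv_pow \<nu> n" ..
  have "(\<lambda>(x, y). x + y) \<in> \<nu> \<Otimes>\<^sub>M conv_pow \<nu> n \<rightarrow>\<^sub>M borel" by measurable
  then have "prob_space (conv_pow \<nu> (Suc n))"
    unfolding conv_pow.simps convolution_def by (rule P.prob_space_distr)
  then interpret S: prob_space "conv_pow \<nu> (Suc n)" .
  show ?case by unfold_locales simp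
qed

lemma charf_conv_pow: "charf (conv_pow \<nu> n) s = charf \<nu> s ^ n"
proof (induction n)
  case 0
  show ?case by (simp add: charf_def integral_return)
next
  case (Suc n)
  interpret N: borel_prob "conv_pow \<nu> n" by (rule borel_prob_conv_pow)
  interpret P: pair_prob_space \<nu> "conv_pow \<nu> n" ..
  have int: "integrable (\<nu> \<Otimes>\<^sub>M conv_pow \<nu> n) (\<lambda>(x, y). cis (s \<bullet> x) * cis (s \<bullet> y))"
    by (rule P.integrable_const_bound[where B=1]) (auto simp: norm_mult split_beta)
  have "charf (conv_pow \<nu> (Suc n)) s = (\<integral>z. cis (s \<bullet> (fst z + snd z)) \<partial>(\<nu> \<Otimes>\<^sub>M conv_pow \<nu> n))"
    unfolding charf_def conv_pow.simps convolution_def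
    by (subst integral_distr) (auto simp: split_beta)
  also have "\<dots> = (\<integral>z. (\<lambda>(x, y). cis (s \<bullet> x) * cis (s \<bullet> y)) z \<partial>(\<nu> \<Otimes>\<^sub>M conv_pow \<nu> n))"
    by (intro Bochner_Integration.integral_cong) (auto simp: inner_add_right cis_mult)
  also have "\<dots> = (\<integral>x. \<integral>y. cis (s \<bullet> x) * cis (s \<bullet> y) \<partial>conv_pow \<nu> n \<partial>\<nu>)"
    using P.integral_fst'[OF int] by simp
  also have "\<dots> = charf \<nu> s * charf (conv_pow \<nu> n) s"
    by (simp add: charf_def)
  finally show ?case using Suc by simp
qed

definition tilt :: "real^'n \<Rightarrow> (real^'n) measure" where
  "tilt u = density \<nu> (\<lambda>y. ennreal (exp (u \<bullet> y) / mgf \<nu> u))"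

lemma integral_tilt:
  fixes g :: "real^'n \<Rightarrow> 'b::{banach, second_countable_topology}"
  assumes u: "u \<in> D" and [measurable]: "g \<in> borel_measurable borel"
  shows "(\<integral>y. g y \<partial>tilt u) = (\<integral>y. (exp (u \<bullet> y) / mgf \<nu> u) *\<^sub>R g y \<partial>\<nu>)"
  unfolding tilt_def using mgf_pos[OF u] by (subst integral_density) auto

lemma integrable_tilt_iff:
  fixes g :: "real^'n \<Rightarrow> 'b::{banach, second_countable_topology}"
  assumes u: "u \<in> D" and [measurable]: "g \<in> borel_measurable borel"
  shows "integrable (tilt u) g \<longleftrightarrow> integrable \<nu> (\<lambda>y. (exp (u \<bullet> y) / mgf \<nu> u) *\<^sub>R g y)"
  unfolding tilt_def using mgf_pos[OF u] by (subst integrable_density) auto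

lemma borel_prob_tilt:
  assumes u: "u \<in> D"
  shows "borel_prob (tilt u)"
proof -
  have int: "integrable \<nu> (\<lambda>y. exp (u \<bullet> y))" using integrable_emom[OF u, of "\<lambda>_. 1" 0] by simp
  have "emeasure (tilt u) (space (tilt u)) = (\<integral>\<^sup>+y. ennreal (exp (u \<bullet> y) / mgf \<nu> u) \<partial>\<nu>)"
    by (simp add: tilt_def emeasure_density)
  also have "\<dots> = ennreal (\<integral>y. exp (u \<bullet> y) / mgf \<nu> u \<partial>\<nu>)"
    using int mgf_pos[OF u] by (intro nn_integral_eq_integral) auto
  also have "\<dots> = 1"
    using mgf_pos[OF u] by (simp add: mgf_def emom_def)
  finally interpret T: prob_space "tilt u" by (rule prob_spaceI)
  show ?thesis by unfold_locales (simp add: tilt_def)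
qed

lemma nn_integral_conv_pow_tilt:
  assumes u: "u \<in> D" and f: "f \<in> borel_measurable borel"
  shows "(\<integral>\<^sup>+s. f s \<partial>conv_pow (tilt u) n) = (\<integral>\<^sup>+s. ennreal (exp (u \<bullet> s) / mgf \<nu> u ^ n) * f s \<partial>conv_pow \<nu> n)"
  using f
proof (induction n arbitrary: f)
  case 0
  then show ?case by (simp add: nn_integral_return)
next
  case (Suc n)
  note [measurable] = Suc.prems
  interpret T: borel_prob "tilt u" by (rule borel_prob_tilt[OF u])
  interpret N: borel_prob "conv_pow \<nu> n" by (rule borel_prob_conv_pow)
  interpret TN: borel_prob "conv_pow (tilt u) n" by (rule T.borel_prob_conv_pow)
  note M = mgf_pos[OF u]
  have "(\<integral>\<^sup>+s. f s \<partial>conv_pow (tilt u) (Suc n)) = (\<integral>\<^sup>+x. \<integral>\<^sup>+y. f (x + y) \<partial>conv_pow (tilt u) n \<partial>tilt u)"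
    unfolding conv_pow.simps
    by (rule nn_integral_convolution) (auto intro: T.finite_measure_axioms TN.finite_measure_axioms)
  also have "\<dots> = (\<integral>\<^sup>+x. \<integral>\<^sup>+y. ennreal (exp (u \<bullet> y) / mgf \<nu> u ^ n) * f (x + y) \<partial>conv_pow \<nu> n \<partial>tilt u)"
    by (intro nn_integral_cong Suc.IH) measurable
  also have "\<dots> = (\<integral>\<^sup>+x. ennreal (exp (u \<bullet> x) / mgf \<nu> u) * (\<integral>\<^sup>+y. ennreal (exp (u \<bullet> y) / mgf \<nu> u ^ n) * f (x + y) \<partial>conv_pow \<nu> n) \<partial>\<nu>)"
    unfolding tilt_def by (subst nn_integral_density) auto
  also have "\<dots> = (\<integral>\<^sup>+x. \<integral>\<^sup>+y. ennreal (exp (u \<bullet> (x + y)) / mgf \<nu> u ^ Suc n) * f (x + y) \<partial>conv_pow \<nu> n \<partial>\<nu>)"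
  proof (intro nn_integral_cong)
    fix x
    have "(\<integral>\<^sup>+y. ennreal (exp (u \<bullet> (x + y)) / mgf \<nu> u ^ Suc n) * f (x + y) \<partial>conv_pow \<nu> n)
      = (\<integral>\<^sup>+y. ennreal (exp (u \<bullet> x) / mgf \<nu> u) * (ennreal (exp (u \<bullet> y) / mgf \<nu> u ^ n) * f (x + y)) \<partial>conv_pow \<nu> n)"
      using M by (intro nn_integral_cong)
        (auto simp: mult.assoc[symmetric] ennreal_mult'[symmetric] inner_add_right exp_add)
    then show "ennreal (exp (u \<bullet> x) / mgf \<nu> u) * (\<integral>\<^sup>+y. ennreal (exp (u \<bullet> y) / mgf \<nu> u ^ n) * f (x + y) \<partial>conv_pow \<nu> n)
      = (\<integral>\<^sup>+y. ennreal (exp (u \<bullet> (x + y)) / mgf \<nu> u ^ Suc n) * f (x + y) \<partial>conv_pow \<nu> n)"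
      by (simp add: nn_integral_cmult)
  qed
  also have "\<dots> = (\<integral>\<^sup>+s. ennreal (exp (u \<bullet> s) / mgf \<nu> u ^ Suc n) * f s \<partial>conv_pow \<nu> (Suc n))"
    unfolding conv_pow.simps
    by (rule nn_integral_convolution[symmetric]) (auto intro: finite_measure_axioms N.finite_measure_axioms)
  finally show ?case .
qed

lemma integrable_tent_c: "integrable \<nu> (\<lambda>s. tent_c c (s - z))"
  using tent_c_le by (intro integrable_const_bound[where B="c powr - real CARD('n)"]) (auto simp: tent_c_nonneg)

lemma phi_tilt:
  assumes u: "u \<in> D"
  shows "phi \<nu> n c x = mgf \<nu> u ^ n * (\<integral>s. tent_c c (s - real n *\<^sub>R x) * exp (- (u \<bullet> s)) \<partial>conv_pow (tilt u) n)"
proof -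
  interpret T: borel_prob "tilt u" by (rule borel_prob_tilt[OF u])
  interpret N: borel_prob "conv_pow \<nu> n" by (rule borel_prob_conv_pow)
  interpret TN: borel_prob "conv_pow (tilt u) n" by (rule T.borel_prob_conv_pow)
  note M = mgf_pos[OF u]
  let ?t = "\<lambda>s. tent_c c (s - real n *\<^sub>R x)"
  have "(\<integral>s. mgf \<nu> u ^ n * (?t s * exp (- (u \<bullet> s))) \<partial>conv_pow (tilt u) n)
     = enn2real (\<integral>\<^sup>+s. ennreal (mgf \<nu> u ^ n * (?t s * exp (- (u \<bullet> s)))) \<partial>conv_pow (tilt u) n)"
    using M by (intro integral_eq_nn_integral) (auto simp: tent_c_nonneg)
  also have "(\<integral>\<^sup>+s. ennreal (mgf \<nu> u ^ n * (?t s * exp (- (u \<bullet> s)))) \<partial>conv_pow (tilt u) n)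
     = (\<integral>\<^sup>+s. ennreal (exp (u \<bullet> s) / mgf \<nu> u ^ n) * ennreal (mgf \<nu> u ^ n * (?t s * exp (- (u \<bullet> s)))) \<partial>conv_pow \<nu> n)"
    by (rule nn_integral_conv_pow_tilt[OF u]) measurable
  also have "\<dots> = (\<integral>\<^sup>+s. ennreal (?t s) \<partial>conv_pow \<nu> n)"
    using M by (intro nn_integral_cong)
      (auto simp: ennreal_mult'[symmetric] tent_c_nonneg exp_minus field_simps)
  also have "enn2real \<dots> = phi \<nu> n c x"
    unfolding phi_def by (rule integral_eq_nn_integral[symmetric]) (auto simp: tent_c_nonneg)
  finally show ?thesis by simp
qed

lemma phi_tilt_bounds:
  fixes n :: nat and c :: real and x :: "real^'n"
  assumes u: "u \<in> D" and R: "norm u \<le> R" and c: "0 < c"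
  defines "I \<equiv> phi (tilt u) n c x" and "A \<equiv> mgf \<nu> u ^ n * exp (- real n * (u \<bullet> x))"
  shows "A * exp (- (R * real CARD('n) * c)) * I \<le> phi \<nu> n c x"
    and "phi \<nu> n c x \<le> A * exp (R * real CARD('n) * c) * I"
proof -
  interpret T: borel_prob "tilt u" by (rule borel_prob_tilt[OF u])
  interpret TN: borel_prob "conv_pow (tilt u) n" by (rule T.borel_prob_conv_pow)
  note M = mgf_pos[OF u]
  let ?t = "\<lambda>s. tent_c c (s - real n *\<^sub>R x)" and ?r = "R * real CARD('n) * c" and ?e = "exp (- real n * (u \<bullet> x))"
  have bd: "\<bar>u \<bullet> z\<bar> \<le> ?r" if "\<And>i. \<bar>z $ i\<bar> < c" for z
  proof -
    have "norm z \<le> (\<Sum>i\<in>UNIV. \<bar>z $ i\<bar>)" by (rule norm_le_l1_cart)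
    also have "\<dots> \<le> (\<Sum>i\<in>(UNIV::'n set). c)" by (intro sum_mono less_imp_le that)
    finally have "norm z \<le> real CARD('n) * c" by simp
    moreover have "\<bar>u \<bullet> z\<bar> \<le> norm u * norm z" by (rule Cauchy_Schwarz_ineq2)
    ultimately show ?thesis
      using mult_mono[OF R \<open>norm z \<le> real CARD('n) * c\<close>] R norm_ge_zero[of u] by (simp add: mult.assoc)
  qed
  have e: "exp (- (u \<bullet> s)) = ?e * exp (- (u \<bullet> (s - real n *\<^sub>R x)))" for s
    by (simp add: exp_add[symmetric] inner_diff_right)
  have ptw: "?e * exp (- ?r) * ?t s \<le> ?t s * exp (- (u \<bullet> s)) \<and> ?t s * exp (- (u \<bullet> s)) \<le> ?e * exp ?r * ?t s" for s
  proof (cases "\<forall>i. \<bar>(s - real n *\<^sub>R x) $ i\<bar> < c")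
    case True
    then have "\<bar>u \<bullet> (s - real n *\<^sub>R x)\<bar> \<le> ?r" by (intro bd) auto
    then have "exp (- ?r) \<le> exp (- (u \<bullet> (s - real n *\<^sub>R x)))" "exp (- (u \<bullet> (s - real n *\<^sub>R x))) \<le> exp ?r"
      by auto
    then have "?e * ?t s * exp (- ?r) \<le> ?e * ?t s * exp (- (u \<bullet> (s - real n *\<^sub>R x)))"
       "?e * ?t s * exp (- (u \<bullet> (s - real n *\<^sub>R x))) \<le> ?e * ?t s * exp ?r"
      by (intro mult_left_mono mult_nonneg_nonneg tent_c_nonneg; simp)+
    then show ?thesis unfolding e[of s] by (simp add: mult_ac)
  next
    case False
    then have "?t s = 0" using tent_c_eq_0[OF c] by (metis not_less)
    then show ?thesis by simp
  qed
  have int: "integrable (conv_pow (tilt u) n) ?t" by (rule TN.integrable_tent_c)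
  have int2: "integrable (conv_pow (tilt u) n) (\<lambda>s. ?t s * exp (- (u \<bullet> s)))"
    by (rule Bochner_Integration.integrable_bound[OF integrable_mult_right[OF int, of "?e * exp ?r"]])
       (use ptw in \<open>auto simp: tent_c_nonneg abs_mult\<close>)
  have I: "I = integral\<^sup>L (conv_pow (tilt u) n) ?t" by (simp add: I_def phi_def)
  have "?e * exp (- ?r) * I \<le> (\<integral>s. ?t s * exp (- (u \<bullet> s)) \<partial>conv_pow (tilt u) n)"
    unfolding I integral_mult_right_zero[symmetric] using ptw by (intro integral_mono integrable_mult_right int int2) auto
  then show "A * exp (- ?r) * I \<le> phi \<nu> n c x"
    unfolding phi_tilt[OF u] A_def using mult_left_mono[of _ _ "mgf \<nu> u ^ n"] M by (simp add: mult.assoc)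
  have "(\<integral>s. ?t s * exp (- (u \<bullet> s)) \<partial>conv_pow (tilt u) n) \<le> ?e * exp ?r * I"
    unfolding I integral_mult_right_zero[symmetric] using ptw by (intro integral_mono integrable_mult_right int int2) auto
  then show "phi \<nu> n c x \<le> A * exp ?r * I"
    unfolding phi_tilt[OF u] A_def using mult_left_mono[of _ _ "mgf \<nu> u ^ n"] M by (simp add: mult.assoc)
qed

definition ccharf :: "real^'n \<Rightarrow> real^'n \<Rightarrow> complex" where
  "ccharf x s = cis (- (s \<bullet> x)) * charf \<nu> s"

lemma borel_measurable_ccharf [measurable]: "ccharf x \<in> borel_measurable borel"
  unfolding ccharf_def[abs_def] by measurable

lemma norm_ccharf: "norm (ccharf x s) = norm (charf \<nu> s)"
  by (simp add: ccharf_def norm_mult)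

lemma tent_fourier:
  assumes c: "0 < c"
  shows "complex_of_real (phi \<nu> n c x)
    = complex_of_real ((2 * pi * c) powr - real CARD('n)) * (\<integral>z. complex_of_real (fejer z) * ccharf x ((1 / c) *\<^sub>R z) ^ n \<partial>lborel)"
proof -
  interpret N: borel_prob "conv_pow \<nu> n" by (rule borel_prob_conv_pow)
  interpret P: pair_sigma_finite "conv_pow \<nu> n" "lborel :: (real^'n) measure" ..
  let ?w = "\<lambda>s. (1 / c) *\<^sub>R (s - real n *\<^sub>R x)"
  let ?F = "\<lambda>s z. complex_of_real (fejer z) * cis (?w s \<bullet> z)"
  let ?K = "(2 * pi) ^ CARD('n)"
  have intz: "integrable lborel (?F s)" for s
    using has_bochner_integral_fejer_cis by (rule integrable.intros)
  have int: "integrable (conv_pow \<nu> n \<Otimes>\<^sub>M lborel) (\<lambda>(s, z). ?F s z)"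
  proof (rule P.Fubini_integrable)
    show "AE s in conv_pow \<nu> n. integrable lborel (\<lambda>z. case (s, z) of (s, z) \<Rightarrow> ?F s z)"
      using intz by simp
  qed (auto simp: norm_mult fejer_nonneg)
  have tent: "complex_of_real (tent_c c (s - real n *\<^sub>R x)) = complex_of_real (c powr - real CARD('n) / ?K) * (\<integral>z. ?F s z \<partial>lborel)" for s
    using has_bochner_integral_integral_eq[OF has_bochner_integral_fejer_cis[of "?w s"]]
    by (simp add: tent_c_def)
  have "complex_of_real (phi \<nu> n c x) = (\<integral>s. complex_of_real (tent_c c (s - real n *\<^sub>R x)) \<partial>conv_pow \<nu> n)"
    unfolding phi_def by simp
  also have "\<dots> = complex_of_real (c powr - real CARD('n) / ?K) * (\<integral>s. \<integral>z. ?F s z \<partial>lborel \<partial>conv_pow \<nu> n)"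
    unfolding tent by simp
  also have "(\<integral>s. \<integral>z. ?F s z \<partial>lborel \<partial>conv_pow \<nu> n) = (\<integral>z. \<integral>s. ?F s z \<partial>conv_pow \<nu> n \<partial>lborel)"
    by (rule P.Fubini_integral[OF int, symmetric])
  also have "\<dots> = (\<integral>z. complex_of_real (fejer z) * ccharf x ((1 / c) *\<^sub>R z) ^ n \<partial>lborel)"
  proof (rule Bochner_Integration.integral_cong[OF refl])
    fix z
    have eq: "?F s z = complex_of_real (fejer z) * cis (- (real n * (((1 / c) *\<^sub>R z) \<bullet> x))) * cis (((1 / c) *\<^sub>R z) \<bullet> s)" for s
      by (simp add: mult.assoc cis_mult inner_diff_left inner_diff_right inner_commute diff_divide_distrib)
    have "(\<integral>s. ?F s z \<partial>conv_pow \<nu> n) = complex_of_real (fejer z) * cis (- (real n * (((1 / c) *\<^sub>R z) \<bullet> x))) * charf (conv_pow \<nu> n) ((1 / c) *\<^sub>R z)"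
      unfolding eq charf_def by simp
    also have "\<dots> = complex_of_real (fejer z) * ccharf x ((1 / c) *\<^sub>R z) ^ n"
      using Complex.DeMoivre[of "- (((1 / c) *\<^sub>R z) \<bullet> x)" n]
      unfolding charf_conv_pow ccharf_def power_mult_distrib by simp
    finally show "(\<integral>s. ?F s z \<partial>conv_pow \<nu> n) = complex_of_real (fejer z) * ccharf x ((1 / c) *\<^sub>R z) ^ n" .
  qed
  also have "c powr - real CARD('n) / ?K = (2 * pi * c) powr - real CARD('n)"
    using c by (simp add: powr_minus powr_mult powr_realpow divide_inverse mult_ac)
  finally show ?thesis .
qed

lemma phi_scaled_fourier:
  assumes c: "0 < c" and n: "0 < n"
  shows "complex_of_real (phi \<nu> n c x)
    = complex_of_real ((2 * pi * sqrt n) powr - real CARD('n)) *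
      (\<integral>z. complex_of_real (fejer ((c / sqrt n) *\<^sub>R z)) * ccharf x ((1 / sqrt n) *\<^sub>R z) ^ n \<partial>lborel)"
proof -
  let ?F = "\<lambda>z. complex_of_real (fejer z) * ccharf x ((1 / c) *\<^sub>R z) ^ n"
  have "integral\<^sup>L lborel ?F = (c / sqrt n) ^ DIM(real^'n) *\<^sub>R (\<integral>z. ?F ((c / sqrt n) *\<^sub>R z) \<partial>lborel)"
    using c n by (intro lborel_integral_scaleR) auto
  moreover
  have "(2 * pi * c) powr - real CARD('n) * (c / sqrt n) ^ DIM(real^'n) = (2 * pi * sqrt n) powr - real CARD('n)"
    using c n by (simp add: powr_minus powr_mult powr_realpow field_simps)
  then have "complex_of_real ((2 * pi * c) powr - real CARD('n)) * complex_of_real ((c / sqrt n) ^ DIM(real^'n))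
      = complex_of_real ((2 * pi * sqrt n) powr - real CARD('n))"
    by (simp only: of_real_mult[symmetric])
  ultimately show ?thesis
    unfolding tent_fourier[OF c] using c
    by (simp only: scaleR_conv_of_real[where 'a=complex] mult.assoc[symmetric]) simp
qed

end

subsection \<open>Characteristic functions of tilted measures\<close>

lemma add_power3_le:
  fixes a b :: real
  assumes "0 \<le> a" "0 \<le> b"
  shows "(a + b) ^ 3 \<le> 8 * (a ^ 3 + b ^ 3)"
proof -
  have "(a + b) ^ 3 \<le> (2 * max a b) ^ 3" using assms by (intro power_mono) auto
  also have "\<dots> = 8 * (max a b) ^ 3" by (simp add: power_mult_distrib)
  also have "\<dots> \<le> 8 * (a ^ 3 + b ^ 3)" using assms by (auto simp: max_def)
  finally show ?thesis .
qed

lemma norm_cis_taylor2: "norm (cis t - (1 + \<i> * t - t\<^sup>2 / 2)) \<le> \<bar>t\<bar> ^ 3"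
proof -
  have "norm (cis t - (1 + \<i> * t - t\<^sup>2 / 2)) = norm (iexp t - (\<Sum>k\<le>2. (\<i> * t) ^ k / fact k))"
    by (simp add: cis_conv_exp numeral_2_eq_2 power2_eq_square algebra_simps)
  also have "\<dots> \<le> \<bar>t\<bar> ^ Suc 2 / fact (Suc 2)" by (rule iexp_approx1)
  also have "\<dots> \<le> \<bar>t\<bar> ^ 3 / 1"
    by (intro frac_le) (auto simp: numeral_3_eq_3 numeral_2_eq_2)
  finally show ?thesis by simp
qed

context borel_prob
begin

abbreviation "tilt_ccharf u s \<equiv> borel_prob.ccharf (tilt u) (tilt_mean \<nu> u) s"

abbreviation "cov_form u s \<equiv> s \<bullet> (tilt_cov \<nu> u *v s)"

definition taylor_const :: "real^'n \<Rightarrow> real" where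
  "taylor_const u = 8 * (emom \<nu> (\<lambda>y. norm y ^ 3) u / mgf \<nu> u + norm (tilt_mean \<nu> u) ^ 3)"

lemma tilt_ccharf_taylor:
  assumes u: "u \<in> D"
  shows "norm (tilt_ccharf u s - complex_of_real (1 - cov_form u s / 2)) \<le> taylor_const u * norm s ^ 3"
proof -
  interpret T: borel_prob "tilt u" by (rule borel_prob_tilt[OF u])
  note M = mgf_pos[OF u]
  let ?x = "tilt_mean \<nu> u"
  let ?t = "\<lambda>y. s \<bullet> y - s \<bullet> ?x"
  have int3: "integrable (tilt u) (\<lambda>y. norm y ^ 3)"
  proof -
    have "integrable \<nu> (\<lambda>y. exp (u \<bullet> y) * norm y ^ 3)" by (rule integrable_emom[OF u, of _ 3]) auto
    then show ?thesis by (subst integrable_tilt_iff[OF u]) auto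
  qed
  have int1: "integrable (tilt u) (\<lambda>y. s \<bullet> y)"
    using integrable_emom_inner(1)[OF u, of s] by (subst integrable_tilt_iff[OF u]) auto
  have int2: "integrable (tilt u) (\<lambda>y. (s \<bullet> y)\<^sup>2)"
    using integrable_emom_inner(2)[OF u, of s] by (subst integrable_tilt_iff[OF u]) auto
  have intt: "integrable (tilt u) ?t" using int1 by simp
  have "integrable (tilt u) (\<lambda>y. (s \<bullet> y)\<^sup>2 - 2 * (s \<bullet> ?x) * (s \<bullet> y) + (s \<bullet> ?x)\<^sup>2)"
    using int1 int2 by (intro Bochner_Integration.integrable_add Bochner_Integration.integrable_diff integrable_mult_right) auto
  also have "(\<lambda>y. (s \<bullet> y)\<^sup>2 - 2 * (s \<bullet> ?x) * (s \<bullet> y) + (s \<bullet> ?x)\<^sup>2) = (\<lambda>y. (?t y)\<^sup>2)"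
    by (simp add: power2_eq_square algebra_simps)
  finally have intt2: "integrable (tilt u) (\<lambda>y. (?t y)\<^sup>2)" .
  have "(\<integral>y. s \<bullet> y \<partial>tilt u) = s \<bullet> ?x"
    by (subst integral_tilt[OF u]) (auto simp: inner_tilt_mean[OF u] emom_def)
  then have E1: "(\<integral>y. ?t y \<partial>tilt u) = 0"
    using int1 by simp
  have E2: "(\<integral>y. (?t y)\<^sup>2 \<partial>tilt u) = cov_form u s"
    by (subst integral_tilt[OF u]) (auto simp: tilt_cov_form[OF u] emom_def)
  have intcis: "integrable (tilt u) (\<lambda>y. cis (?t y))"
    by (rule T.integrable_const_bound[where B=1]) auto
  have intT: "integrable (tilt u) (\<lambda>y. 1 + \<i> * complex_of_real (?t y) - complex_of_real ((?t y)\<^sup>2) / 2)"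
    by (intro Bochner_Integration.integrable_add Bochner_Integration.integrable_diff integrable_mult_right
         integrable_divide integrable_of_real intt intt2) auto
  have A: "T.ccharf ?x s = (\<integral>y. cis (?t y) \<partial>tilt u)"
  proof -
    have "T.ccharf ?x s = (\<integral>y. cis (- (s \<bullet> ?x)) * cis (s \<bullet> y) \<partial>tilt u)"
      unfolding T.ccharf_def charf_def by simp
    then show ?thesis by (simp add: cis_mult)
  qed
  have B: "(\<integral>y. 1 + \<i> * complex_of_real (?t y) - complex_of_real ((?t y)\<^sup>2) / 2 \<partial>tilt u)
      = complex_of_real (1 - cov_form u s / 2)"
  proof -
    have "(\<integral>y. 1 + \<i> * complex_of_real (?t y) - complex_of_real ((?t y)\<^sup>2) / 2 \<partial>tilt u)
      = (\<integral>y. 1 \<partial>tilt u) + \<i> * (\<integral>y. complex_of_real (?t y) \<partial>tilt u) - (\<integral>y. complex_of_real ((?t y)\<^sup>2) \<partial>tilt u) / 2"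
      using integrable_of_real[OF intt, where 'a=complex] integrable_of_real[OF intt2, where 'a=complex]
      by (subst Bochner_Integration.integral_diff Bochner_Integration.integral_add;
          (intro Bochner_Integration.integrable_add integrable_mult_right integrable_divide)?; simp)+
    also have "(\<integral>y. complex_of_real (?t y) \<partial>tilt u) = 0"
      unfolding integral_complex_of_real E1 by simp
    also have "(\<integral>y. complex_of_real ((?t y)\<^sup>2) \<partial>tilt u) = complex_of_real (cov_form u s)"
      unfolding integral_complex_of_real E2 by simp
    finally show ?thesis by simp
  qed
  have "T.ccharf ?x s - complex_of_real (1 - cov_form u s / 2)
      = (\<integral>y. cis (?t y) - (1 + \<i> * complex_of_real (?t y) - complex_of_real ((?t y)\<^sup>2) / 2) \<partial>tilt u)"
    unfolding A B[symmetric] by (rule Bochner_Integration.integral_diff[OF intcis intT, symmetric])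
  also have "norm \<dots> \<le> (\<integral>y. norm s ^ 3 * (8 * (norm y ^ 3 + norm ?x ^ 3)) \<partial>tilt u)"
  proof (rule Bochner_Integration.integral_norm_bound_integral)
    show "integrable (tilt u) (\<lambda>y. norm s ^ 3 * (8 * (norm y ^ 3 + norm ?x ^ 3)))"
      using int3 by (intro integrable_mult_right Bochner_Integration.integrable_add) auto
    show "integrable (tilt u) (\<lambda>y. cis (?t y) - (1 + \<i> * complex_of_real (?t y) - complex_of_real ((?t y)\<^sup>2) / 2))"
      by (rule Bochner_Integration.integrable_diff[OF intcis intT])
    fix y
    have "norm (cis (?t y) - (1 + \<i> * complex_of_real (?t y) - complex_of_real ((?t y)\<^sup>2) / 2)) \<le> \<bar>?t y\<bar> ^ 3"
      using norm_cis_taylor2[of "?t y"] by simp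
    also have "\<bar>?t y\<bar> = \<bar>s \<bullet> (y - ?x)\<bar>" by (simp add: inner_diff_right)
    also have "\<bar>s \<bullet> (y - ?x)\<bar> ^ 3 \<le> (norm s * (norm y + norm ?x)) ^ 3"
      by (intro power_mono order_trans[OF Cauchy_Schwarz_ineq2] mult_left_mono norm_triangle_ineq4) auto
    also have "\<dots> \<le> norm s ^ 3 * (8 * (norm y ^ 3 + norm ?x ^ 3))"
      unfolding power_mult_distrib by (intro mult_left_mono add_power3_le) auto
    finally show "norm (cis (?t y) - (1 + \<i> * complex_of_real (?t y) - complex_of_real ((?t y)\<^sup>2) / 2))
      \<le> norm s ^ 3 * (8 * (norm y ^ 3 + norm ?x ^ 3))" .
  qed
  also have "\<dots> = norm s ^ 3 * (8 * ((\<integral>y. norm y ^ 3 \<partial>tilt u) + norm ?x ^ 3))"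
    using int3 by simp
  also have "(\<integral>y. norm y ^ 3 \<partial>tilt u) = emom \<nu> (\<lambda>y. norm y ^ 3) u / mgf \<nu> u"
    by (subst integral_tilt[OF u]) (auto simp: emom_def)
  finally show ?thesis by (simp add: taylor_const_def mult_ac)
qed

lemma continuous_on_taylor_const: "continuous_on D taylor_const"
  unfolding taylor_const_def[abs_def]
proof (intro continuous_intros continuous_on_mgf continuous_on_tilt_mean continuous_on_emom[of _ 3])
  show "\<forall>u\<in>D. mgf \<nu> u \<noteq> 0" using mgf_pos by fastforce
qed auto

lemma continuous_on_cov_form: "continuous_on (D \<times> UNIV) (\<lambda>p. cov_form (fst p) (snd p))"
  unfolding inner_vec_def matrix_vector_mult_def
  by (auto intro!: continuous_intros continuous_on_compose2[OF continuous_on_tilt_cov])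

lemma cov_form_scaleR: "cov_form u (a *\<^sub>R s) = a\<^sup>2 * cov_form u s"
  by (simp add: matrix_vector_mult_scaleR power2_eq_square)

lemma cov_form_bounds:
  assumes nd: "nondegenerate \<nu>" and U: "compact U" "U \<subseteq> D"
  obtains l \<Lambda> where "0 < l" "0 \<le> \<Lambda>" "\<And>u s. u \<in> U \<Longrightarrow> l * (norm s)\<^sup>2 \<le> cov_form u s"
    "\<And>u s. u \<in> U \<Longrightarrow> cov_form u s \<le> \<Lambda> * (norm s)\<^sup>2"
proof (cases "U = {}")
  case True
  then show ?thesis by (intro that[of 1 1]) auto
next
  case False
  let ?S = "U \<times> sphere (0::real^'n) 1" and ?q = "\<lambda>p. cov_form (fst p) (snd p)"
  have comp: "compact ?S" using U by (intro compact_Times) auto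
  have ne: "?S \<noteq> {}" using False by simp
  have cont: "continuous_on ?S ?q"
    using U by (intro continuous_on_subset[OF continuous_on_cov_form]) auto
  obtain p where p: "p \<in> ?S" "\<And>q. q \<in> ?S \<Longrightarrow> ?q p \<le> ?q q"
    using continuous_attains_inf[OF comp ne cont] by blast
  obtain r where r: "r \<in> ?S" "\<And>q. q \<in> ?S \<Longrightarrow> ?q q \<le> ?q r"
    using continuous_attains_sup[OF comp ne cont] by blast
  have pos: "0 < ?q p" using p(1) U by (intro tilt_cov_pos[OF nd]) auto
  have norm: "\<exists>w. (u, w) \<in> ?S \<and> cov_form u s = (norm s)\<^sup>2 * cov_form u w" if "u \<in> U" for u s
  proof (cases "s = 0")
    case True
    then show ?thesis
      using that by (intro exI[of _ "axis undefined 1"]) (auto simp: norm_axis_1)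
  next
    case False
    then show ?thesis
      using that cov_form_scaleR[where u=u and a="norm s" and s="(1 / norm s) *\<^sub>R s"]
      by (intro exI[of _ "(1 / norm s) *\<^sub>R s"]) auto
  qed
  show ?thesis
  proof (rule that[OF pos])
    show "0 \<le> ?q r" using r(2)[OF p(1)] pos by linarith
    fix u s assume u: "u \<in> U"
    obtain w where w: "(u, w) \<in> ?S" "cov_form u s = (norm s)\<^sup>2 * cov_form u w"
      using norm[OF u] by blast
    show "?q p * (norm s)\<^sup>2 \<le> cov_form u s"
      using mult_left_mono[OF p(2)[OF w(1)], of "(norm s)\<^sup>2"] w(2) by (simp add: mult.commute)
    show "cov_form u s \<le> ?q r * (norm s)\<^sup>2"
      using mult_left_mono[OF r(2)[OF w(1)], of "(norm s)\<^sup>2"] w(2) by (simp add: mult.commute)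
  qed
qed

lemma compact_bound_above:
  fixes f :: "real^'n \<Rightarrow> real"
  assumes "compact U" "U \<subseteq> D" "continuous_on D f"
  obtains B where "0 < B" "\<And>u. u \<in> U \<Longrightarrow> f u \<le> B"
proof -
  have "bounded (f ` U)"
    by (rule compact_imp_bounded[OF compact_continuous_image[OF continuous_on_subset[OF assms(3,2)] assms(1)]])
  then obtain B where "B > 0" "\<And>u. u \<in> U \<Longrightarrow> norm (f u) \<le> B"
    by (auto simp: bounded_pos)
  then show ?thesis by (intro that[of B]) (auto intro: order_trans[OF abs_ge_self])
qed

lemma cramer_condition_bound:
  assumes cc: "cramer_condition \<nu>" and \<alpha>: "0 < \<alpha>"
  obtains \<rho> where "\<rho> < 1" "\<And>s. \<alpha> \<le> norm s \<Longrightarrow> norm (charf \<nu> s) \<le> \<rho>"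
proof
  show "(SUP s\<in>{s. norm s \<ge> \<alpha>}. norm (charf \<nu> s)) < 1"
    using cc \<alpha> by (auto simp: cramer_condition_def)
  show "norm (charf \<nu> s) \<le> (SUP s\<in>{s. norm s \<ge> \<alpha>}. norm (charf \<nu> s))" if "\<alpha> \<le> norm s" for s
    using that norm_charf_le_1 by (intro cSUP_upper bdd_aboveI2) auto
qed

lemma tail_small:
  assumes "0 < e"
  obtains Y :: real where "0 < Y" "prob {y. Y < norm y} \<le> e"
proof -
  let ?A = "\<lambda>n. {y :: real^'n. real n < norm y}"
  have "(\<lambda>n. prob (?A n)) \<longlonglongrightarrow> prob (\<Inter>n. ?A n)"
    by (rule finite_Lim_measure_decseq) (auto simp: decseq_def)
  also have "(\<Inter>n. ?A n) = {}"
  proof -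
    have "\<exists>n. \<not> real n < norm y" for y :: "real^'n"
      using real_arch_simple[of "norm y"] by (auto simp: not_less)
    then show ?thesis by blast
  qed
  finally have "\<forall>\<^sub>F n in sequentially. prob (?A n) < e"
    using assms by (intro order_tendstoD) auto
  then obtain N where "\<And>n. n \<ge> N \<Longrightarrow> prob (?A n) < e" by (auto simp: eventually_sequentially)
  from this[of "Suc N"] show ?thesis by (intro that[of "real (Suc N)"]) auto
qed

text \<open>
  With \<open>f\<^sub>u\<close> the density of the tilted measure and \<open>\<theta>\<close> the argument of its characteristic function at \<open>s\<close>,
  \<open>1 - |\<integral> e\<^bsup>i\<langle>s,y\<rangle>\<^esup> f\<^sub>u d\<nu>| = \<integral> (1 - cos (\<langle>s,y\<rangle> - \<theta>)) f\<^sub>u d\<nu> \<ge> \<epsilon> (1 - \<rho>\<^sub>0 - 2 \<nu>(f\<^sub>u < \<epsilon>))\<close>, where \<open>\<rho>\<^sub>0\<close> comes from the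
  Cramer condition for \<open>\<nu>\<close> and \<open>\<epsilon>\<close> can be chosen uniformly in \<open>u\<close>.
\<close>

lemma tilt_charf_large:
  assumes cc: "cramer_condition \<nu>" and U: "compact U" "U \<subseteq> D" and \<alpha>: "0 < \<alpha>"
  obtains \<rho> where "0 < \<rho>" "\<rho> < 1" "\<And>u s. u \<in> U \<Longrightarrow> \<alpha> \<le> norm s \<Longrightarrow> norm (charf (tilt u) s) \<le> \<rho>"
proof -
  obtain \<rho>0 where \<rho>0: "\<rho>0 < 1" "\<And>s. \<alpha> \<le> norm s \<Longrightarrow> norm (charf \<nu> s) \<le> \<rho>0"
    using cramer_condition_bound[OF cc \<alpha>] by metis
  obtain Y where Y: "0 < Y" "prob {y. Y < norm y} \<le> (1 - \<rho>0) / 4"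
    using tail_small[of "(1 - \<rho>0) / 4"] \<rho>0 by auto
  obtain R where R: "0 < R" "\<And>u. u \<in> U \<Longrightarrow> norm u \<le> R"
    using compact_imp_bounded[OF U(1)] by (auto simp: bounded_pos)
  obtain B where B: "0 < B" "\<And>u. u \<in> U \<Longrightarrow> mgf \<nu> u \<le> B"
    using compact_bound_above[OF U continuous_on_mgf] by metis
  define \<epsilon> where "\<epsilon> = exp (- (R * Y)) / B"
  have \<epsilon>: "\<epsilon> > 0" using B by (simp add: \<epsilon>_def)
  define \<rho> where "\<rho> = max (1 - \<epsilon> * (1 - \<rho>0) / 2) (1 / 2)"
  show ?thesis
  proof (rule that[of \<rho>])
    show "0 < \<rho>" "\<rho> < 1" using \<epsilon> \<rho>0 by (auto simp: \<rho>_def)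
    fix u s assume u: "u \<in> U" and s: "\<alpha> \<le> norm (s :: real^'n)"
    have uD: "u \<in> D" using u U by auto
    note M = mgf_pos[OF uD]
    interpret T: borel_prob "tilt u" by (rule borel_prob_tilt[OF uD])
    define z where "z = charf (tilt u) s"
    define \<theta> where "\<theta> = Arg z"
    have z: "z = complex_of_real (norm z) * cis \<theta>"
      using rcis_cmod_Arg[of z] by (simp add: rcis_def \<theta>_def)
    have rot: "Re (charf \<mu> s * cis (- \<theta>)) = (\<integral>y. cos (s \<bullet> y - \<theta>) \<partial>\<mu>)" if "borel_prob \<mu>" for \<mu>
    proof -
      interpret m: borel_prob \<mu> by fact
      have "charf \<mu> s * cis (- \<theta>) = (\<integral>y. cis (s \<bullet> y - \<theta>) \<partial>\<mu>)"
        unfolding charf_def by (simp add: cis_mult flip: integral_mult_left_zero)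
      moreover have "integrable \<mu> (\<lambda>y. cis (s \<bullet> y - \<theta>))"
        by (rule m.integrable_const_bound[where B=1]) auto
      ultimately show ?thesis by (simp flip: integral_Re)
    qed
    have "norm z = Re (z * cis (- \<theta>))"
      by (subst z) (simp add: mult.assoc cis_mult)
    also have "\<dots> = (\<integral>y. cos (s \<bullet> y - \<theta>) \<partial>tilt u)"
      unfolding z_def by (rule rot) (rule borel_prob_tilt[OF uD])
    finally have nz: "norm z = (\<integral>y. cos (s \<bullet> y - \<theta>) \<partial>tilt u)" .
    have intT: "integrable (tilt u) (\<lambda>y. cos (s \<bullet> y - \<theta>))"
      by (rule T.integrable_const_bound[where B=1]) auto
    have intN: "integrable \<nu> (\<lambda>y. cos (s \<bullet> y - \<theta>))"
      by (rule integrable_const_bound[where B=1]) auto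
    have "(\<integral>y. cos (s \<bullet> y - \<theta>) \<partial>\<nu>) = Re (charf \<nu> s * cis (- \<theta>))"
      by (rule rot[symmetric]) unfold_locales
    also have "\<dots> \<le> norm (charf \<nu> s * cis (- \<theta>))" by (rule complex_Re_le_cmod)
    also have "\<dots> \<le> \<rho>0" using \<rho>0(2)[OF s] by (simp add: norm_mult)
    finally have base: "(\<integral>y. cos (s \<bullet> y - \<theta>) \<partial>\<nu>) \<le> \<rho>0" .
    have int1T: "integrable (tilt u) (\<lambda>y. 1 - cos (s \<bullet> y - \<theta>))" using intT by simp
    have "\<epsilon> * ((1 - \<rho>0) - 2 * ((1 - \<rho>0) / 4)) \<le> \<epsilon> * ((1 - (\<integral>y. cos (s \<bullet> y - \<theta>) \<partial>\<nu>)) - 2 * prob {y. Y < norm y})"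
      using \<epsilon> base Y(2) by (intro mult_left_mono diff_mono) auto
    also have "\<dots> = (\<integral>y. \<epsilon> * ((1 - cos (s \<bullet> y - \<theta>)) - 2 * indicator {y. Y < norm y} y) \<partial>\<nu>)"
      using intN by (simp add: emeasure_eq_measure)
    also have "\<dots> \<le> (\<integral>y. (exp (u \<bullet> y) / mgf \<nu> u) *\<^sub>R (1 - cos (s \<bullet> y - \<theta>)) \<partial>\<nu>)"
    proof (rule integral_mono)
      show "integrable \<nu> (\<lambda>y. \<epsilon> * ((1 - cos (s \<bullet> y - \<theta>)) - 2 * indicator {y. Y < norm y} y))"
        using intN by (intro integrable_mult_right Bochner_Integration.integrable_diff) (auto simp: emeasure_eq_measure)
      show "integrable \<nu> (\<lambda>y. (exp (u \<bullet> y) / mgf \<nu> u) *\<^sub>R (1 - cos (s \<bullet> y - \<theta>)))"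
        using int1T by (subst (asm) integrable_tilt_iff[OF uD]) auto
      fix y
      show "\<epsilon> * ((1 - cos (s \<bullet> y - \<theta>)) - 2 * indicator {y. Y < norm y} y) \<le> (exp (u \<bullet> y) / mgf \<nu> u) *\<^sub>R (1 - cos (s \<bullet> y - \<theta>))"
      proof (cases "Y < norm y")
        case True
        have "1 - cos (s \<bullet> y - \<theta>) - 2 \<le> 0" using cos_ge_minus_one[of "s \<bullet> y - \<theta>"] by linarith
        then have "\<epsilon> * ((1 - cos (s \<bullet> y - \<theta>)) - 2) \<le> 0" using \<epsilon> by (simp add: mult_nonneg_nonpos)
        moreover have "0 \<le> (exp (u \<bullet> y) / mgf \<nu> u) *\<^sub>R (1 - cos (s \<bullet> y - \<theta>))" using M by simp
        ultimately show ?thesis using True by (simp add: indicator_def)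
      next
        case False
        have "- (R * Y) \<le> u \<bullet> y"
          using Cauchy_Schwarz_ineq2[of u y] mult_mono[OF R(2)[OF u], of "norm y" Y] False R by auto
        then have "\<epsilon> \<le> exp (u \<bullet> y) / mgf \<nu> u"
          unfolding \<epsilon>_def using B(2)[OF u] M by (intro frac_le) auto
        then have "\<epsilon> * (1 - cos (s \<bullet> y - \<theta>)) \<le> exp (u \<bullet> y) / mgf \<nu> u * (1 - cos (s \<bullet> y - \<theta>))"
          by (intro mult_right_mono) auto
        then show ?thesis using False by (simp add: indicator_def)
      qed
    qed
    also have "\<dots> = (\<integral>y. 1 - cos (s \<bullet> y - \<theta>) \<partial>tilt u)"
      by (rule integral_tilt[OF uD, symmetric]) measurable
    also have "\<dots> = 1 - norm z" using intT nz by simp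
    also have "\<epsilon> * ((1 - \<rho>0) - 2 * ((1 - \<rho>0) / 4)) = \<epsilon> * (1 - \<rho>0) / 2" by (simp add: field_simps)
    finally show "norm (charf (tilt u) s) \<le> \<rho>"
      by (simp add: \<rho>_def z_def[symmetric] le_max_iff_disj)
  qed
qed

subsection \<open>The Cramer transform\<close>

lemma mgf_lower_bound:
  assumes u: "u \<in> D" and v: "v \<in> dom_L \<nu>"
  shows "mgf \<nu> u * exp ((v - u) \<bullet> tilt_mean \<nu> u) \<le> mgf \<nu> v"
proof -
  let ?b = "(v - u) \<bullet> tilt_mean \<nu> u"
  have int0: "integrable \<nu> (\<lambda>y. exp (u \<bullet> y))" using integrable_emom[OF u, of "\<lambda>_. 1" 0] by simp
  note int1 = integrable_emom_inner(1)[OF u, of "v - u"]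
  have "mgf \<nu> u * exp ?b = exp ?b * (mgf \<nu> u + emom \<nu> (\<lambda>y. (v - u) \<bullet> y) u - ?b * mgf \<nu> u)"
    using inner_tilt_mean[OF u, of "v - u"] mgf_pos[OF u] by simp
  also have "\<dots> = (\<integral>y. exp ?b * (exp (u \<bullet> y) + exp (u \<bullet> y) * ((v - u) \<bullet> y) - ?b * exp (u \<bullet> y)) \<partial>\<nu>)"
    using int0 int1 by (simp add: mgf_def emom_def)
  also have "\<dots> \<le> (\<integral>y. exp (v \<bullet> y) \<partial>\<nu>)"
  proof (rule integral_mono)
    show "integrable \<nu> (\<lambda>y. exp ?b * (exp (u \<bullet> y) + exp (u \<bullet> y) * ((v - u) \<bullet> y) - ?b * exp (u \<bullet> y)))"
      by (intro integrable_mult_right Bochner_Integration.integrable_add Bochner_Integration.integrable_diff int0 int1)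
    show "integrable \<nu> (\<lambda>y. exp (v \<bullet> y))" by (rule integrable_exp_dom_L[OF v])
    fix y
    have "exp ?b * (exp (u \<bullet> y) + exp (u \<bullet> y) * ((v - u) \<bullet> y) - ?b * exp (u \<bullet> y))
      = exp ?b * exp (u \<bullet> y) * (1 + ((v - u) \<bullet> y - ?b))" by (simp add: algebra_simps)
    also have "\<dots> \<le> exp ?b * exp (u \<bullet> y) * exp ((v - u) \<bullet> y - ?b)"
      by (intro mult_left_mono exp_ge_add_one_self) auto
    also have "\<dots> = exp (v \<bullet> y)"
      by (simp add: exp_add[symmetric] inner_diff_left)
    finally show "exp ?b * (exp (u \<bullet> y) + exp (u \<bullet> y) * ((v - u) \<bullet> y) - ?b * exp (u \<bullet> y)) \<le> exp (v \<bullet> y)" .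
  qed
  finally show ?thesis by (simp add: mgf_def emom_def)
qed

lemma cramer_tilt_mean:
  assumes u: "u \<in> D"
  shows "cramer \<nu> (tilt_mean \<nu> u) = ereal (u \<bullet> tilt_mean \<nu> u - logL \<nu> u)"
  unfolding cramer_def
proof (rule antisym)
  show "(SUP v\<in>dom_L \<nu>. ereal (v \<bullet> tilt_mean \<nu> u - logL \<nu> v)) \<le> ereal (u \<bullet> tilt_mean \<nu> u - logL \<nu> u)"
  proof (rule SUP_least)
    fix v assume v: "v \<in> dom_L \<nu>"
    have "ln (mgf \<nu> u * exp ((v - u) \<bullet> tilt_mean \<nu> u)) \<le> ln (mgf \<nu> v)"
      using mgf_lower_bound[OF u v] mgf_pos[OF u]
      by (intro ln_mono) (auto intro: less_le_trans[OF mult_pos_pos])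
    then have "logL \<nu> u + (v - u) \<bullet> tilt_mean \<nu> u \<le> logL \<nu> v"
      using mgf_pos[OF u] by (simp add: logL_eq ln_mult)
    then show "ereal (v \<bullet> tilt_mean \<nu> u - logL \<nu> v) \<le> ereal (u \<bullet> tilt_mean \<nu> u - logL \<nu> u)"
      by (simp add: inner_diff_left)
  qed
  show "ereal (u \<bullet> tilt_mean \<nu> u - logL \<nu> u) \<le> (SUP v\<in>dom_L \<nu>. ereal (v \<bullet> tilt_mean \<nu> u - logL \<nu> v))"
    using u interior_subset by (intro SUP_upper) auto
qed

lemma exp_cramer:
  assumes u: "u \<in> D"
  shows "mgf \<nu> u ^ n * exp (- real n * (u \<bullet> tilt_mean \<nu> u)) = exp (- real n * real_of_ereal (cramer \<nu> (tilt_mean \<nu> u)))"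
proof -
  have "mgf \<nu> u ^ n = exp (real n * logL \<nu> u)"
    using mgf_pos[OF u] by (simp add: logL_eq exp_of_nat_mult)
  then show ?thesis
    by (simp add: cramer_tilt_mean[OF u] exp_add[symmetric] algebra_simps)
qed

lemma tilt_mean_local_inverse:
  assumes nd: "nondegenerate \<nu>" and u: "u \<in> D"
  obtains U V g g' where "open U" "U \<subseteq> D" "u \<in> U" "open V" "tilt_mean \<nu> u \<in> V" "homeomorphism U V (tilt_mean \<nu>) g"
    "\<And>y. y \<in> V \<Longrightarrow> (g has_derivative g' y) (at y)"
    "\<And>y. y \<in> V \<Longrightarrow> g' y = inv ((*v) (tilt_cov \<nu> (g y)))"
proof -
  let ?f' = "\<lambda>v. Blinfun ((*v) (tilt_cov \<nu> v))"
  have app: "blinfun_apply (Blinfun ((*v) A)) = (*v) A" for A :: "real^'n^'n"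
    by (rule bounded_linear_Blinfun_apply) (rule matrix_vector_mul_bounded_linear)
  have inv: "invertible (tilt_cov \<nu> u)"
    using posdef_det_pos[OF transpose_tilt_cov tilt_cov_pos[OF nd u]] by (simp add: invertible_det_nz)
  have der: "(tilt_mean \<nu> has_derivative blinfun_apply (?f' v)) (at v)" if "v \<in> D" for v
    unfolding app by (rule has_derivative_tilt_mean[OF that])
  have cont: "continuous_on D ?f'"
  proof (rule continuous_on_blinfun_componentwise)
    show "continuous_on D (\<lambda>v. blinfun_apply (?f' v) i)" for i
      unfolding app matrix_vector_mult_def
      by (intro continuous_on_vec_lambda continuous_intros continuous_on_tilt_cov)
  qed
  obtain A where "A ** tilt_cov \<nu> u = mat 1" using inv by (auto simp: invertible_def)
  then have "Blinfun ((*v) A) o\<^sub>L ?f' u = id_blinfun"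
    by (intro blinfun_eqI) (simp add: app matrix_vector_mul_assoc)
  from inverse_function_theorem[OF open_interior der cont u this]
  obtain U V g g' where "open U" "U \<subseteq> D" "u \<in> U" "open V" "tilt_mean \<nu> u \<in> V" "homeomorphism U V (tilt_mean \<nu>) g"
    "\<And>y. y \<in> V \<Longrightarrow> (g has_derivative g' y) (at y)"
    "\<And>y. y \<in> V \<Longrightarrow> g' y = inv (blinfun_apply (?f' (g y)))"
    by metis
  then show ?thesis unfolding app by (rule that)
qed

lemma det_hess_cramer:
  assumes nd: "nondegenerate \<nu>" and u: "u \<in> D"
  shows "det (hess (\<lambda>y. real_of_ereal (cramer \<nu> y)) (tilt_mean \<nu> u)) = 1 / det (tilt_cov \<nu> u)"
proof -
  obtain U V g g' where U: "open U" "U \<subseteq> D" "u \<in> U" and V: "open V" "tilt_mean \<nu> u \<in> V"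
    and hom: "homeomorphism U V (tilt_mean \<nu>) g"
    and g: "\<And>y. y \<in> V \<Longrightarrow> (g has_derivative g' y) (at y)"
    and g': "\<And>y. y \<in> V \<Longrightarrow> g' y = inv ((*v) (tilt_cov \<nu> (g y)))"
    using tilt_mean_local_inverse[OF nd u] by metis
  let ?J = "\<lambda>y. real_of_ereal (cramer \<nu> y)" and ?x = "tilt_mean \<nu> u" and ?H = "tilt_cov \<nu> u"
  have gV: "g y \<in> D" "tilt_mean \<nu> (g y) = y" if "y \<in> V" for y
    using hom that U unfolding homeomorphism_def by auto
  have gx: "g ?x = u" using hom U unfolding homeomorphism_def by auto
  have J: "?J y = g y \<bullet> y - logL \<nu> (g y)" if "y \<in> V" for y
    using cramer_tilt_mean[OF gV(1)[OF that]] gV(2)[OF that] by simp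
  have dJ: "(?J has_derivative (\<lambda>h. g y \<bullet> h)) (at y)" if y: "y \<in> V" for y
  proof -
    have "((\<lambda>y. g y \<bullet> y - logL \<nu> (g y)) has_derivative
        (\<lambda>h. (g y \<bullet> h + g' y h \<bullet> y) - tilt_mean \<nu> (g y) \<bullet> g' y h)) (at y)"
      by (intro has_derivative_diff has_derivative_inner g[OF y] has_derivative_ident
          has_derivative_compose[OF g[OF y] has_derivative_logL[OF gV(1)[OF y]]])
    also have "(\<lambda>h. (g y \<bullet> h + g' y h \<bullet> y) - tilt_mean \<nu> (g y) \<bullet> g' y h) = (\<lambda>h. g y \<bullet> h)"
      by (simp add: gV(2)[OF y] inner_commute)
    finally show ?thesis
      by (rule has_derivative_transform_within_open[OF _ V(1) y]) (simp add: J)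
  qed
  have grad: "grad ?J y = g y" if "y \<in> V" for y
    unfolding grad_def frechet_derivative_at[OF dJ[OF that], symmetric] by (simp add: inner_axis vec_eq_iff)
  have "((\<lambda>y. grad ?J y $ i) has_derivative (\<lambda>h. g' ?x h $ i)) (at ?x)" for i
  proof (rule has_derivative_transform_within_open[OF _ V])
    show "((\<lambda>y. g y $ i) has_derivative (\<lambda>h. g' ?x h $ i)) (at ?x)"
      by (rule bounded_linear.has_derivative[OF bounded_linear_vec_nth g[OF V(2)]])
  qed (simp add: grad)
  note fd = frechet_derivative_at[OF this, symmetric]
  have "hess ?J ?x = matrix (g' ?x)"
    unfolding hess_def matrix_def fd ..
  moreover have "det (matrix (g' ?x)) * det ?H = 1"
  proof -
    have "invertible ?H"
      using posdef_det_pos[OF transpose_tilt_cov tilt_cov_pos[OF nd u]] by (simp add: invertible_det_nz)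
    then have "inj ((*v) ?H)" by (simp add: invertible_eq_bij bij_is_inj)
    then have "g' ?x \<circ> (*v) ?H = id" by (simp add: g'[OF V(2)] gx)
    moreover have "linear (g' ?x)" using g[OF V(2)] by (rule has_derivative_linear)
    ultimately have "matrix (g' ?x) ** ?H = mat 1"
      using matrix_compose[of "(*v) ?H" "g' ?x"] by (simp add: matrix_id_mat_1)
    then show ?thesis by (metis det_I det_mul)
  qed
  ultimately show ?thesis
    by (metis mult_zero_right nonzero_eq_divide_eq zero_neq_one)
qed

lemma admissible_eq: "admissible \<nu> = tilt_mean \<nu> ` D"
proof -
  have "GDERIV (logL \<nu>) u :> g \<longleftrightarrow> g = tilt_mean \<nu> u" if u: "u \<in> D" for u g
  proof
    assume "GDERIV (logL \<nu>) u :> g"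
    then have "(\<lambda>h. h \<bullet> g) = (\<lambda>h. tilt_mean \<nu> u \<bullet> h)"
      unfolding gderiv_def by (rule has_derivative_unique[OF _ has_derivative_logL[OF u]])
    then have "\<forall>h. h \<bullet> g = h \<bullet> tilt_mean \<nu> u" by (metis inner_commute)
    then show "g = tilt_mean \<nu> u" by (simp add: vector_eq_ldot)
  next
    assume "g = tilt_mean \<nu> u"
    then show "GDERIV (logL \<nu>) u :> g"
      using has_derivative_logL[OF u] by (simp add: gderiv_def inner_commute)
  qed
  then show ?thesis by (auto simp: admissible_def)
qed

lemma compact_lift:
  assumes nd: "nondegenerate \<nu>" and K: "compact K" "K \<subseteq> tilt_mean \<nu> ` D"
  obtains U where "compact U" "U \<subseteq> D" "K \<subseteq> tilt_mean \<nu> ` U"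
proof -
  have "\<exists>u r. cball u r \<subseteq> D \<and> open (tilt_mean \<nu> ` ball u r) \<and> x \<in> tilt_mean \<nu> ` ball u r" if x: "x \<in> K" for x
  proof -
    obtain u where u: "u \<in> D" "x = tilt_mean \<nu> u" using K x by auto
    obtain U V g g' where U: "open U" "U \<subseteq> D" "u \<in> U" and V: "open V"
      and hom: "homeomorphism U V (tilt_mean \<nu>) g"
      using tilt_mean_local_inverse[OF nd u(1)] by metis
    obtain r where r: "r > 0" "cball u r \<subseteq> U" using U open_contains_cball by blast
    then have "ball u r \<subseteq> U" using ball_subset_cball by blast
    then have "openin (top_of_set U) (ball u r)" using U by (simp add: openin_open_eq)
    then have "openin (top_of_set V) (tilt_mean \<nu> ` ball u r)"
      by (rule homeomorphism_imp_open_map[OF hom])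
    then have "open (tilt_mean \<nu> ` ball u r)" using V by (simp add: openin_open_eq)
    with r u U show ?thesis by (intro exI[of _ u] exI[of _ r]) auto
  qed
  then obtain u r where ur: "\<And>x. x \<in> K \<Longrightarrow> cball (u x) (r x) \<subseteq> D"
    "\<And>x. x \<in> K \<Longrightarrow> open (tilt_mean \<nu> ` ball (u x) (r x))"
    "\<And>x. x \<in> K \<Longrightarrow> x \<in> tilt_mean \<nu> ` ball (u x) (r x)" by metis
  from compactE_image[OF K(1), of K "\<lambda>x. tilt_mean \<nu> ` ball (u x) (r x)"] ur
  obtain T where T: "T \<subseteq> K" "finite T" "K \<subseteq> (\<Union>x\<in>T. tilt_mean \<nu> ` ball (u x) (r x))"
    by (metis (no_types, lifting) UN_I subsetI)
  show ?thesis
  proof (rule that)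
    show "compact (\<Union>x\<in>T. cball (u x) (r x))" using T by (intro compact_UN) auto
    show "(\<Union>x\<in>T. cball (u x) (r x)) \<subseteq> D" using T ur by blast
    show "K \<subseteq> tilt_mean \<nu> ` (\<Union>x\<in>T. cball (u x) (r x))"
      using T(3) ball_subset_cball by (fastforce simp: image_UN)
  qed
qed

end

subsection \<open>The local limit theorem, uniformly over compact sets of tilts\<close>

lemma lborel_integrable_scaleR:
  fixes F :: "'a::euclidean_space \<Rightarrow> 'b::{banach, second_countable_topology}"
  assumes a: "a \<noteq> 0" and F: "integrable lborel F"
  shows "integrable lborel (\<lambda>x. F (a *\<^sub>R x))"
proof -
  have [measurable]: "F \<in> borel_measurable borel" using F by auto
  have "integrable (density (distr lborel borel (\<lambda>x. 0 + a *\<^sub>R x)) (\<lambda>_. ennreal (\<bar>a\<bar> ^ DIM('a)))) F"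
    using F lborel_affine[OF a, of 0] by metis
  then have "integrable lborel (\<lambda>x. \<bar>a\<bar> ^ DIM('a) *\<^sub>R F (a *\<^sub>R x))"
    by (simp add: integrable_density integrable_distr_eq)
  from integrable_scaleR_right[OF this, of "inverse (\<bar>a\<bar> ^ DIM('a))"] show ?thesis
    using a by simp
qed

lemma integrable_exp_norm_sq:
  assumes "0 < \<delta>"
  shows "integrable lborel (\<lambda>z::real^'n. exp (- (\<delta> * (norm z)\<^sup>2)))"
proof -
  have "integrable lborel (\<lambda>z::real^'n. exp (- (z \<bullet> z) / 2))"
    using has_bochner_integral_gaussian by (rule integrable.intros)
  from lborel_integrable_scaleR[OF _ this, of "sqrt (2 * \<delta>)"] show ?thesis
    using assms by (simp add: power2_norm_eq_inner mult.assoc[symmetric])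
qed

lemma integral_fejer: "(\<integral>z. fejer (z :: real^'n) \<partial>lborel) = (2 * pi) ^ CARD('n)"
proof -
  have "complex_of_real (\<integral>z. fejer (z :: real^'n) \<partial>lborel) = complex_of_real ((2 * pi) ^ CARD('n) * tent (0 :: real^'n))"
    using has_bochner_integral_integral_eq[OF has_bochner_integral_fejer_cis[of 0]] by simp
  then show ?thesis unfolding of_real_eq_iff by (simp add: tent_def)
qed

lemma integral_fejer_scaleR:
  assumes "0 < a"
  shows "(\<integral>z. fejer (a *\<^sub>R (z :: real^'n)) \<partial>lborel) = (2 * pi / a) ^ CARD('n)"
  using lborel_integral_scaleR[of a "fejer :: real^'n \<Rightarrow> real"] assms
  by (simp add: integral_fejer power_divide field_simps)

lemma fejer_near_0:
  assumes "0 < w"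
  obtains r where "0 < r" "\<And>z :: real^'n. norm z < r \<Longrightarrow> \<bar>fejer z - 1\<bar> \<le> w"
proof -
  have "continuous_on UNIV (fejer :: real^'n \<Rightarrow> real)"
    unfolding fejer_def[abs_def] by (intro continuous_intros)
  then have "isCont (fejer :: real^'n \<Rightarrow> real) 0" by (simp add: continuous_on_eq_continuous_at)
  then obtain r where "r > 0" "\<And>z :: real^'n. dist z 0 < r \<Longrightarrow> dist (fejer z) (fejer (0 :: real^'n)) < w"
    unfolding continuous_at_eps_delta using assms by blast
  then show ?thesis by (intro that[of r]) (auto simp: dist_real_def fejer_def intro: less_imp_le)
qed

context borel_prob
begin

lemma tilt_ccharf_small:
  assumes nd: "nondegenerate \<nu>" and U: "compact U" "U \<subseteq> D"
  obtains \<alpha> \<delta> C where "0 < \<alpha>" "0 < \<delta>" "0 < C"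
    "\<And>u s. u \<in> U \<Longrightarrow> 2 * \<delta> * (norm s)\<^sup>2 \<le> cov_form u s"
    "\<And>u s. u \<in> U \<Longrightarrow> norm s \<le> \<alpha> \<Longrightarrow> norm (tilt_ccharf u s) \<le> exp (- (\<delta> * (norm s)\<^sup>2))"
    "\<And>u s. u \<in> U \<Longrightarrow> norm s \<le> \<alpha> \<Longrightarrow>
       norm (tilt_ccharf u s - complex_of_real (exp (- (cov_form u s / 2)))) \<le> C * (norm s ^ 3 + norm s ^ 4)"
proof -
  obtain l L where l: "0 < l" "0 \<le> L" "\<And>u s. u \<in> U \<Longrightarrow> l * (norm s)\<^sup>2 \<le> cov_form u s"
    and L: "\<And>u s. u \<in> U \<Longrightarrow> cov_form u s \<le> L * (norm s)\<^sup>2"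
    using cov_form_bounds[OF nd U] by metis
  obtain C3 where C3: "0 < C3" "\<And>u. u \<in> U \<Longrightarrow> taylor_const u \<le> C3"
    using compact_bound_above[OF U continuous_on_taylor_const] by metis
  define \<alpha> where "\<alpha> = min (l / (4 * C3)) (1 / (L + 1))"
  have \<alpha>: "0 < \<alpha>" using l C3 by (simp add: \<alpha>_def)
  have \<alpha>1: "C3 * \<alpha> \<le> l / 4"
  proof -
    have "C3 * \<alpha> \<le> C3 * (l / (4 * C3))" using C3 by (intro mult_left_mono) (auto simp: \<alpha>_def)
    then show ?thesis using C3 by simp
  qed
  have \<alpha>2: "L * \<alpha>\<^sup>2 \<le> 1"
  proof -
    have "\<alpha> \<le> 1 / (L + 1)" by (simp add: \<alpha>_def)
    moreover have "1 / (L + 1) \<le> 1" using l by simp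
    ultimately have "\<alpha> * \<alpha> \<le> 1 / (L + 1) * 1"
      using \<alpha> l order_trans[of \<alpha> "1 / (L + 1)" 1] by (intro mult_mono) auto
    then have "L * \<alpha>\<^sup>2 \<le> L * (1 / (L + 1))" using l by (intro mult_left_mono) (auto simp: power2_eq_square)
    also have "\<dots> \<le> 1" using l by (simp add: field_simps)
    finally show ?thesis .
  qed
  have taylor: "norm (tilt_ccharf u s - complex_of_real (1 - cov_form u s / 2)) \<le> C3 * norm s ^ 3" if u: "u \<in> U" for u s
  proof -
    have "u \<in> D" using u U by auto
    from tilt_ccharf_taylor[OF this, of s] show ?thesis
      using mult_right_mono[OF C3(2)[OF u], of "norm s ^ 3"] by simp
  qed
  have q: "0 \<le> cov_form u s" "cov_form u s \<le> 1" if u: "u \<in> U" and s: "norm s \<le> \<alpha>" for u s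
  proof -
    have "0 \<le> l * (norm s)\<^sup>2" using l by simp
    then show "0 \<le> cov_form u s" using l(3)[OF u, of s] by linarith
    have "L * (norm s)\<^sup>2 \<le> L * \<alpha>\<^sup>2" using s l by (intro mult_left_mono power_mono) auto
    then show "cov_form u s \<le> 1" using L[OF u, of s] \<alpha>2 by linarith
  qed
  show ?thesis
  proof (rule that[of \<alpha> "l / 4" "C3 + L\<^sup>2"])
    show "0 < \<alpha>" "0 < l / 4" "0 < C3 + L\<^sup>2" using \<alpha> l C3 by (auto intro: add_pos_nonneg)
    fix u s :: "real^'n" assume u: "u \<in> U"
    have "0 \<le> l * (norm s)\<^sup>2" using l by simp
    then show "2 * (l / 4) * (norm s)\<^sup>2 \<le> cov_form u s" using l(3)[OF u, of s] by simp
    assume s: "norm s \<le> \<alpha>"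
    have "norm (tilt_ccharf u s) \<le> norm (complex_of_real (1 - cov_form u s / 2)) + C3 * norm s ^ 3"
      using norm_triangle_ineq2[of "tilt_ccharf u s" "complex_of_real (1 - cov_form u s / 2)"] taylor[OF u, of s] by linarith
    also have "norm (complex_of_real (1 - cov_form u s / 2)) = 1 - cov_form u s / 2"
      unfolding norm_of_real using q[OF u s] by simp
    also have "1 - cov_form u s / 2 + C3 * norm s ^ 3 \<le> 1 - l / 4 * (norm s)\<^sup>2"
    proof -
      have "C3 * norm s ^ 3 = (C3 * norm s) * (norm s)\<^sup>2" by (simp add: power3_eq_cube power2_eq_square)
      also have "\<dots> \<le> (C3 * \<alpha>) * (norm s)\<^sup>2" using s C3 by (intro mult_right_mono mult_left_mono) auto
      also have "\<dots> \<le> l / 4 * (norm s)\<^sup>2" using \<alpha>1 by (intro mult_right_mono) auto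
      finally show ?thesis using l(3)[OF u, of s] by (simp add: field_simps)
    qed
    also have "\<dots> \<le> exp (- (l / 4 * (norm s)\<^sup>2))"
      using exp_ge_add_one_self[of "- (l / 4 * (norm s)\<^sup>2)"] by simp
    finally show "norm (tilt_ccharf u s) \<le> exp (- (l / 4 * (norm s)\<^sup>2))" .
    let ?t = "cov_form u s / 2"
    have "\<bar>exp (- ?t) - 1 - (- ?t)\<bar> \<le> (- ?t)\<^sup>2 * exp \<bar>- ?t\<bar>" by (rule abs_exp_minus_linear_le)
    also have "\<dots> \<le> (- ?t)\<^sup>2 * 3"
    proof (rule mult_left_mono)
      have "exp \<bar>- ?t\<bar> \<le> exp 1" using q[OF u s] by simp
      then show "exp \<bar>- ?t\<bar> \<le> 3" using exp_le by linarith
    qed simp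
    also have "\<dots> \<le> (cov_form u s)\<^sup>2" by (simp add: power2_eq_square)
    also have "\<dots> \<le> (L * (norm s)\<^sup>2)\<^sup>2" using q[OF u s] L[OF u, of s] by (intro power_mono) auto
    also have "\<dots> = L\<^sup>2 * norm s ^ 4" by (simp add: power_mult_distrib)
    finally have e: "\<bar>(1 - ?t) - exp (- ?t)\<bar> \<le> L\<^sup>2 * norm s ^ 4" by (simp add: abs_minus_commute algebra_simps)
    have "norm (tilt_ccharf u s - complex_of_real (exp (- ?t)))
      \<le> norm (tilt_ccharf u s - complex_of_real (1 - ?t)) + norm (complex_of_real (1 - ?t) - complex_of_real (exp (- ?t)))"
      by (rule order_trans[OF eq_refl norm_triangle_ineq]) simp
    also have "norm (complex_of_real (1 - ?t) - complex_of_real (exp (- ?t))) = \<bar>(1 - ?t) - exp (- ?t)\<bar>"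
      unfolding of_real_diff[symmetric] norm_of_real ..
    finally have "norm (tilt_ccharf u s - complex_of_real (exp (- ?t))) \<le> C3 * norm s ^ 3 + L\<^sup>2 * norm s ^ 4"
      using taylor[OF u, of s] e by linarith
    also have "\<dots> \<le> (C3 + L\<^sup>2) * (norm s ^ 3 + norm s ^ 4)"
    proof -
      have "0 \<le> C3 * norm s ^ 4" "0 \<le> L\<^sup>2 * norm s ^ 3" using C3 by auto
      then show ?thesis by (simp add: algebra_simps)
    qed
    finally show "norm (tilt_ccharf u s - complex_of_real (exp (- ?t))) \<le> (C3 + L\<^sup>2) * (norm s ^ 3 + norm s ^ 4)" .
  qed
qed

lemma continuous_on_det_tilt_cov: "continuous_on D (\<lambda>u. det (tilt_cov \<nu> u))"
  unfolding det_def by (intro continuous_intros continuous_on_tilt_cov)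

lemma ccharf_power_gaussian_le:
  fixes n :: nat and u z :: "real^'n"
  assumes n: "0 < n" and C: "0 < C" and u: "u \<in> D"
    and form: "\<And>s. 2 * \<delta> * (norm s)\<^sup>2 \<le> cov_form u s"
    and small: "\<And>s. norm s \<le> \<alpha> \<Longrightarrow> norm (tilt_ccharf u s) \<le> exp (- (\<delta> * (norm s)\<^sup>2))"
    and gauss: "\<And>s. norm s \<le> \<alpha> \<Longrightarrow>
       norm (tilt_ccharf u s - complex_of_real (exp (- (cov_form u s / 2)))) \<le> C * (norm s ^ 3 + norm s ^ 4)"
    and z: "norm z \<le> \<alpha> * sqrt n"
  shows "norm (tilt_ccharf u ((1 / sqrt n) *\<^sub>R z) ^ n) \<le> exp (- (\<delta> * (norm z)\<^sup>2))"
    and "norm (tilt_ccharf u ((1 / sqrt n) *\<^sub>R z) ^ n - complex_of_real (exp (- (cov_form u z / 2))))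
       \<le> min (2 * exp (- (\<delta> * (norm z)\<^sup>2))) (C * (norm z ^ 3 + norm z ^ 4) / sqrt n)"
proof -
  interpret T: borel_prob "tilt u" by (rule borel_prob_tilt[OF u])
  define s where "s = (1 / sqrt n) *\<^sub>R z"
  let ?\<psi> = "tilt_ccharf u s"
  have ns: "norm s = norm z / sqrt n" by (simp add: s_def)
  have s: "norm s \<le> \<alpha>" using z n by (simp add: ns divide_le_eq)
  have ns2: "real n * (norm s)\<^sup>2 = (norm z)\<^sup>2" using n by (simp add: ns power_divide)
  have qs: "real n * cov_form u s = cov_form u z"
    unfolding s_def cov_form_scaleR using n by (simp add: power_divide)
  have "norm (?\<psi> ^ n) \<le> exp (- (\<delta> * (norm s)\<^sup>2)) ^ n"
    unfolding norm_power by (intro power_mono small s) auto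
  also have "\<dots> = exp (- (\<delta> * (norm z)\<^sup>2))"
    by (simp add: exp_of_nat_mult[symmetric] ns2[symmetric] mult_ac)
  finally show p: "norm (tilt_ccharf u ((1 / sqrt n) *\<^sub>R z) ^ n) \<le> exp (- (\<delta> * (norm z)\<^sup>2))"
    by (simp add: s_def)
  have ez: "exp (- (cov_form u z / 2)) = exp (- (cov_form u s / 2)) ^ n"
    by (simp add: exp_of_nat_mult[symmetric] qs[symmetric])
  have e: "exp (- (cov_form u z / 2)) \<le> exp (- (\<delta> * (norm z)\<^sup>2))"
    using form[of z] by simp
  have "norm (?\<psi> ^ n - complex_of_real (exp (- (cov_form u z / 2)))) \<le> norm (?\<psi> ^ n) + norm (complex_of_real (exp (- (cov_form u z / 2))))"
    by (rule norm_triangle_ineq4)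
  also have "\<dots> \<le> 2 * exp (- (\<delta> * (norm z)\<^sup>2))"
    using p[folded s_def] e unfolding norm_of_real abs_exp_cancel by linarith
  finally have 1: "norm (?\<psi> ^ n - complex_of_real (exp (- (cov_form u z / 2)))) \<le> 2 * exp (- (\<delta> * (norm z)\<^sup>2))" .
  have "0 \<le> cov_form u s" 
    using tilt_cov_form[OF u, of s] mgf_pos[OF u] by (simp add: emom_def)
  then have "norm (?\<psi> ^ n - complex_of_real (exp (- (cov_form u s / 2))) ^ n) \<le> real n * norm (?\<psi> - complex_of_real (exp (- (cov_form u s / 2))))"
    by (intro norm_power_diff) (use T.norm_charf_le_1 in \<open>auto simp: T.norm_ccharf\<close>)
  also have "\<dots> \<le> real n * (C * (norm s ^ 3 + norm s ^ 4))"
    by (intro mult_left_mono gauss s) auto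
  also have "\<dots> \<le> C * (norm z ^ 3 + norm z ^ 4) / sqrt n"
  proof -
    have 3: "real n * norm s ^ 3 = norm z ^ 3 / sqrt n"
      using n unfolding ns power_divide power3_eq_cube by (simp add: field_simps)
    have "real n * norm s ^ 4 = (real n * (norm s)\<^sup>2) * (norm s)\<^sup>2" by (simp add: power2_eq_square power4_eq_xxxx)
    also have "\<dots> = norm z ^ 4 / real n"
      unfolding ns2 using n by (simp add: ns power_divide power2_eq_square power4_eq_xxxx)
    also have "\<dots> \<le> norm z ^ 4 / sqrt n"
    proof (rule divide_left_mono)
      have "1 * sqrt n \<le> sqrt n * sqrt n" using n by (intro mult_right_mono) auto
      then show "sqrt n \<le> real n" by simp
    qed (use n in auto)
    finally have 4: "real n * norm s ^ 4 \<le> norm z ^ 4 / sqrt n" .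
    have "real n * (C * (norm s ^ 3 + norm s ^ 4)) = C * (real n * norm s ^ 3 + real n * norm s ^ 4)"
      by (simp add: algebra_simps)
    also have "\<dots> \<le> C * (norm z ^ 3 / sqrt n + norm z ^ 4 / sqrt n)"
      using 3 4 C by (intro mult_left_mono add_mono) auto
    finally show ?thesis by (simp add: add_divide_distrib distrib_left)
  qed
  finally have 2: "norm (?\<psi> ^ n - complex_of_real (exp (- (cov_form u z / 2)))) \<le> C * (norm z ^ 3 + norm z ^ 4) / sqrt n"
    unfolding ez of_real_power .
  show "norm (tilt_ccharf u ((1 / sqrt n) *\<^sub>R z) ^ n - complex_of_real (exp (- (cov_form u z / 2))))
       \<le> min (2 * exp (- (\<delta> * (norm z)\<^sup>2))) (C * (norm z ^ 3 + norm z ^ 4) / sqrt n)"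
    using 1 2 by (simp add: s_def)
qed

end

text \<open>
  \<open>g n\<close> majorizes, uniformly over the tilts, the error of the Gaussian approximation after rescaling
  frequencies by \<open>1 / sqrt n\<close>.
\<close>

lemma gaussian_remainder_tendsto_0:
  fixes \<alpha> \<delta> C :: real
  assumes "0 < \<alpha>" "0 < \<delta>" "0 < C"
  defines "g \<equiv> \<lambda>(n::nat) (z::real^'n). if norm z \<le> \<alpha> * sqrt n
     then min (2 * exp (- (\<delta> * (norm z)\<^sup>2))) (C * (norm z ^ 3 + norm z ^ 4) / sqrt n) else 2 * exp (- (\<delta> * (norm z)\<^sup>2))"
  shows "integrable lborel (g n)" and "(\<lambda>n. integral\<^sup>L lborel (g n)) \<longlonglongrightarrow> 0"
proof -
  let ?E = "\<lambda>z::real^'n. 2 * exp (- (\<delta> * (norm z)\<^sup>2))"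
  have E: "integrable lborel ?E" by (intro integrable_mult_right integrable_exp_norm_sq assms)
  have meas [measurable]: "g n \<in> borel_measurable borel" for n unfolding g_def by measurable
  have g0: "0 \<le> g n z" and gE: "g n z \<le> ?E z" for n z using assms by (auto simp: g_def)
  show "integrable lborel (g n)"
    using g0 gE by (intro Bochner_Integration.integrable_bound[OF E]) auto
  have lim: "(\<lambda>n. g n z) \<longlonglongrightarrow> 0" for z
  proof (rule tendsto_sandwich)
    show "\<forall>\<^sub>F n in sequentially. 0 \<le> g n z" using g0 by simp
    have "\<forall>\<^sub>F n in sequentially. norm z / \<alpha> \<le> sqrt (real n)"
      using filterlim_compose[OF sqrt_at_top filterlim_real_sequentially]
      by (simp add: filterlim_at_top)
    then show "\<forall>\<^sub>F n in sequentially. g n z \<le> (C * (norm z ^ 3 + norm z ^ 4)) / sqrt (real n)"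
      by eventually_elim (use assms in \<open>simp add: g_def field_simps\<close>)
    show "(\<lambda>n. (C * (norm z ^ 3 + norm z ^ 4)) / sqrt (real n)) \<longlonglongrightarrow> 0"
      by (intro tendsto_divide_0[OF tendsto_const] filterlim_at_top_imp_at_infinity
          filterlim_compose[OF sqrt_at_top filterlim_real_sequentially])
  qed simp
  have "(\<lambda>n. integral\<^sup>L lborel (g n)) \<longlonglongrightarrow> (\<integral>z. 0 \<partial>(lborel :: (real^'n) measure))"
    by (rule integral_dominated_convergence[where w="?E"]) (use E lim g0 gE in \<open>auto\<close>)
  then show "(\<lambda>n. integral\<^sup>L lborel (g n)) \<longlonglongrightarrow> 0" by simp
qed

context borel_prob
begin

lemma local_limit:
  assumes nd: "nondegenerate \<nu>" and cc: "cramer_condition \<nu>" and U: "compact U" "U \<subseteq> D"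
  obtains \<gamma> C where "0 < \<gamma>" "0 \<le> C"
    "\<And>e. 0 < e \<Longrightarrow> \<exists>N. \<exists>\<delta>>0. \<forall>n\<ge>N. \<forall>c. 0 < c \<and> c < \<delta> \<longrightarrow> (\<forall>u\<in>U.
       \<bar>(2 * pi * real n) powr (real CARD('n) / 2) * sqrt (det (tilt_cov \<nu> u)) * phi (tilt u) n c (tilt_mean \<nu> u) - 1\<bar>
       \<le> e + C * real n powr (real CARD('n) / 2) * exp (- \<gamma> * real n) * c powr (- real CARD('n)))"
proof -
  let ?d = "CARD('n)"
  obtain \<alpha> \<delta> C where pos: "0 < \<alpha>" "0 < \<delta>" "0 < C"
    and form: "\<And>u s. u \<in> U \<Longrightarrow> 2 * \<delta> * (norm s)\<^sup>2 \<le> cov_form u s"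
    and small: "\<And>u s. u \<in> U \<Longrightarrow> norm s \<le> \<alpha> \<Longrightarrow> norm (tilt_ccharf u s) \<le> exp (- (\<delta> * (norm s)\<^sup>2))"
    and gauss: "\<And>u s. u \<in> U \<Longrightarrow> norm s \<le> \<alpha> \<Longrightarrow>
       norm (tilt_ccharf u s - complex_of_real (exp (- (cov_form u s / 2)))) \<le> C * (norm s ^ 3 + norm s ^ 4)"
    using tilt_ccharf_small[OF nd U] by blast
  obtain \<rho> where \<rho>: "0 < \<rho>" "\<rho> < 1" "\<And>u s. u \<in> U \<Longrightarrow> \<alpha> \<le> norm s \<Longrightarrow> norm (charf (tilt u) s) \<le> \<rho>"
    using tilt_charf_large[OF cc U pos(1)] by blast
  obtain Q where Q: "0 < Q" "\<And>u. u \<in> U \<Longrightarrow> det (tilt_cov \<nu> u) \<le> Q"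
    using compact_bound_above[OF U continuous_on_det_tilt_cov] by metis
  define g where "g n z = (if norm z \<le> \<alpha> * sqrt n
     then min (2 * exp (- (\<delta> * (norm z)\<^sup>2))) (C * (norm z ^ 3 + norm z ^ 4) / sqrt n) else 2 * exp (- (\<delta> * (norm z)\<^sup>2)))"
    for n :: nat and z :: "real^'n"
  have g_int: "integrable lborel (g n)" for n
    unfolding g_def[abs_def] by (rule gaussian_remainder_tendsto_0(1)[OF pos])
  have g_lim: "(\<lambda>n. integral\<^sup>L lborel (g n)) \<longlonglongrightarrow> 0"
    unfolding g_def[abs_def] by (rule gaussian_remainder_tendsto_0(2)[OF pos])
  let ?E = "\<lambda>z::real^'n. exp (- (\<delta> * (norm z)\<^sup>2))"
  have E_int: "integrable lborel ?E" by (rule integrable_exp_norm_sq[OF pos(2)])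
  define IE where "IE = integral\<^sup>L lborel ?E"
  have IE: "0 \<le> IE" unfolding IE_def by (rule integral_nonneg_AE) simp
  define K where "K = (2 * pi) powr (- (real ?d / 2)) * sqrt Q"
  have K: "0 < K" using Q by (simp add: K_def)

  have core: "\<bar>(2 * pi * real n) powr (real ?d / 2) * sqrt (det (tilt_cov \<nu> u)) * phi (tilt u) n c (tilt_mean \<nu> u) - 1\<bar>
      \<le> K * (w * IE + integral\<^sup>L lborel (g n) + \<rho> ^ n * (2 * pi * sqrt n / c) ^ ?d)"
    if n: "0 < n" and c: "0 < c" and u: "u \<in> U"
      and w: "0 \<le> w" "\<And>z :: real^'n. norm z \<le> c * \<alpha> \<Longrightarrow> \<bar>fejer z - 1\<bar> \<le> w" for n :: nat and c u w
  proof -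
    have uD: "u \<in> D" using u U by auto
    interpret T: borel_prob "tilt u" by (rule borel_prob_tilt[OF uD])
    let ?H = "tilt_cov \<nu> u"
    have H: "0 < det ?H" by (rule posdef_det_pos[OF transpose_tilt_cov tilt_cov_pos[OF nd uD]])
    let ?\<psi> = "\<lambda>z. tilt_ccharf u ((1 / sqrt n) *\<^sub>R z) ^ n"
    let ?f = "\<lambda>z::real^'n. fejer ((c / sqrt n) *\<^sub>R z)"
    let ?G = "\<lambda>z::real^'n. exp (- (cov_form u z / 2))"
    let ?J = "\<lambda>z. complex_of_real (?f z) * ?\<psi> z"
    have f_int: "integrable lborel ?f"
      using n c by (intro lborel_integrable_scaleR integrable_fejer) auto
    have If: "integral\<^sup>L lborel ?f = (2 * pi * sqrt n / c) ^ ?d"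
      using n c by (subst integral_fejer_scaleR) auto
    have G: "has_bochner_integral lborel ?G ((2 * pi) powr (real ?d / 2) / sqrt (det ?H))"
      using has_bochner_integral_gaussian_form[OF transpose_tilt_cov tilt_cov_pos[OF nd uD]] by simp
    have [measurable]: "?\<psi> \<in> borel_measurable borel" by measurable
    have \<psi>_le_1: "norm (?\<psi> z) \<le> 1" for z
      unfolding norm_power T.norm_ccharf by (intro power_le_one T.norm_charf_le_1) auto
    have J_int: "integrable lborel ?J"
      by (rule Bochner_Integration.integrable_bound[OF f_int])
         (use \<psi>_le_1 in \<open>auto simp: norm_mult fejer_nonneg intro!: mult_left_le\<close>)
    have G_int: "integrable lborel (\<lambda>z. complex_of_real (?G z))"
      using G by (intro integrable_of_real) (rule integrable.intros)
    have ptw: "norm (?J z - complex_of_real (?G z)) \<le> w * ?E z + g n z + \<rho> ^ n * ?f z" for z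
    proof (cases "norm z \<le> \<alpha> * sqrt n")
      case True
      note cp = ccharf_power_gaussian_le[OF n pos(3) uD form[OF u] small[OF u] gauss[OF u] True]
      have "norm ((c / sqrt n) *\<^sub>R z) \<le> c * \<alpha>"
        using True n c by (simp add: field_simps)
      then have fw: "\<bar>?f z - 1\<bar> \<le> w" by (rule w(2))
      have "?J z - complex_of_real (?G z) = complex_of_real (?f z - 1) * ?\<psi> z + (?\<psi> z - complex_of_real (?G z))"
        by (simp add: algebra_simps)
      also have "norm \<dots> \<le> norm (complex_of_real (?f z - 1) * ?\<psi> z) + norm (?\<psi> z - complex_of_real (?G z))"
        by (rule norm_triangle_ineq)
      also have "norm (complex_of_real (?f z - 1) * ?\<psi> z) = \<bar>?f z - 1\<bar> * norm (?\<psi> z)"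
        by (simp only: norm_mult norm_of_real)
      also have "\<dots> \<le> w * ?E z" using fw cp(1) by (intro mult_mono) (auto intro: w)
      also have "norm (?\<psi> z - complex_of_real (?G z)) \<le> g n z" using cp(2) True by (simp add: g_def)
      also have "w * ?E z + g n z \<le> w * ?E z + g n z + \<rho> ^ n * ?f z"
        using \<rho>(1) by (simp add: fejer_nonneg)
      finally show ?thesis by simp
    next
      case False
      then have "\<alpha> \<le> norm ((1 / sqrt n) *\<^sub>R z)" using n by (simp add: field_simps)
      then have "norm (?\<psi> z) \<le> \<rho> ^ n"
        unfolding norm_power T.norm_ccharf using \<rho>(3)[OF u] by (intro power_mono) auto
      then have "norm (?J z) \<le> ?f z * \<rho> ^ n"
        by (simp add: norm_mult fejer_nonneg mult_left_mono)
      moreover have "?G z \<le> ?E z" using form[OF u, of z] by simp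
      moreover have "norm (?J z - complex_of_real (?G z)) \<le> norm (?J z) + norm (complex_of_real (?G z))"
        by (rule norm_triangle_ineq4)
      moreover have "g n z = 2 * ?E z" using False by (simp add: g_def)
      moreover have "0 \<le> w * ?E z" using w by simp
      moreover have "0 < ?E z" by simp
      ultimately show ?thesis unfolding norm_of_real abs_exp_cancel mult.commute[of "\<rho> ^ n"] by linarith
    qed
    have "norm (integral\<^sup>L lborel ?J - complex_of_real ((2 * pi) powr (real ?d / 2) / sqrt (det ?H)))
       = norm (\<integral>z. ?J z - complex_of_real (?G z) \<partial>lborel)"
      using J_int G_int has_bochner_integral_integral_eq[OF G] by (simp add: Bochner_Integration.integral_diff)
    also have "\<dots> \<le> (\<integral>z. w * ?E z + g n z + \<rho> ^ n * ?f z \<partial>lborel)"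
      by (intro Bochner_Integration.integral_norm_bound_integral Bochner_Integration.integrable_diff
          Bochner_Integration.integrable_add integrable_mult_right J_int G_int E_int g_int f_int ptw)
    also have "\<dots> = w * IE + integral\<^sup>L lborel (g n) + \<rho> ^ n * (2 * pi * sqrt n / c) ^ ?d"
      using E_int g_int[of n] f_int by (simp add: If IE_def)
    finally have JG: "norm (integral\<^sup>L lborel ?J - complex_of_real ((2 * pi) powr (real ?d / 2) / sqrt (det ?H)))
       \<le> w * IE + integral\<^sup>L lborel (g n) + \<rho> ^ n * (2 * pi * sqrt n / c) ^ ?d" .
    let ?m = "(2 * pi) powr (- (real ?d / 2)) * sqrt (det ?H)"
    have phi: "complex_of_real (phi (tilt u) n c (tilt_mean \<nu> u)) = complex_of_real ((2 * pi * sqrt n) powr - real ?d) * integral\<^sup>L lborel ?J"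
      by (rule T.phi_scaled_fourier[OF c n])
    have const: "(2 * pi * real n) powr (real ?d / 2) * (2 * pi * sqrt n) powr - real ?d = (2 * pi) powr (- (real ?d / 2))"
    proof -
      have "sqrt n powr - real ?d = real n powr (- (real ?d / 2))"
        using n by (simp add: powr_half_sqrt[symmetric] powr_powr)
      then have "(2 * pi * real n) powr (real ?d / 2) * (2 * pi * sqrt n) powr - real ?d
        = ((2 * pi) powr (real ?d / 2) * (2 * pi) powr - real ?d) * (real n powr (real ?d / 2) * real n powr (- (real ?d / 2)))"
        by (simp add: powr_mult)
      also have "\<dots> = (2 * pi) powr (- (real ?d / 2))"
        using n by (simp add: powr_add[symmetric])
      finally show ?thesis .
    qed
    have one: "?m * ((2 * pi) powr (real ?d / 2) / sqrt (det ?H)) = 1"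
      using H by (simp add: powr_minus field_simps)
    have "complex_of_real ((2 * pi * real n) powr (real ?d / 2) * sqrt (det ?H) * phi (tilt u) n c (tilt_mean \<nu> u) - 1)
      = complex_of_real ((2 * pi * real n) powr (real ?d / 2) * (2 * pi * sqrt n) powr - real ?d * sqrt (det ?H)) * integral\<^sup>L lborel ?J - 1"
      unfolding of_real_diff of_real_mult phi by (simp add: mult_ac)
    also have "\<dots> = complex_of_real ?m * integral\<^sup>L lborel ?J - complex_of_real (?m * ((2 * pi) powr (real ?d / 2) / sqrt (det ?H)))"
      unfolding const one by simp
    also have "\<dots> = complex_of_real ?m * (integral\<^sup>L lborel ?J - complex_of_real ((2 * pi) powr (real ?d / 2) / sqrt (det ?H)))"
      unfolding of_real_mult right_diff_distrib ..
    finally have "norm (complex_of_real ((2 * pi * real n) powr (real ?d / 2) * sqrt (det ?H) * phi (tilt u) n c (tilt_mean \<nu> u) - 1))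
       = norm (complex_of_real ?m * (integral\<^sup>L lborel ?J - complex_of_real ((2 * pi) powr (real ?d / 2) / sqrt (det ?H))))"
      by (rule arg_cong[where f=norm])
    moreover have "\<bar>?m\<bar> = ?m" using H by simp
    ultimately have "\<bar>(2 * pi * real n) powr (real ?d / 2) * sqrt (det ?H) * phi (tilt u) n c (tilt_mean \<nu> u) - 1\<bar>
       = ?m * norm (integral\<^sup>L lborel ?J - complex_of_real ((2 * pi) powr (real ?d / 2) / sqrt (det ?H)))"
      unfolding norm_mult norm_of_real by (simp only:)
    also have "\<dots> \<le> K * (w * IE + integral\<^sup>L lborel (g n) + \<rho> ^ n * (2 * pi * sqrt n / c) ^ ?d)"
      unfolding K_def using Q(2)[OF u] Q(1) H JG by (intro mult_mono[OF _ JG]) auto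
    finally show ?thesis .
  qed

  define \<gamma> where "\<gamma> = - ln \<rho>"
  show ?thesis
  proof (rule that[of \<gamma> "K * (2 * pi) ^ ?d"])
    show "0 < \<gamma>" using \<rho> by (simp add: \<gamma>_def)
    show "0 \<le> K * (2 * pi) ^ ?d" using K by simp
    fix e :: real assume e: "0 < e"
    define w where "w = e / (2 * K * (IE + 1))"
    have w: "0 < w" using e K IE by (simp add: w_def)
    obtain r where r: "0 < r" "\<And>z :: real^'n. norm z < r \<Longrightarrow> \<bar>fejer z - 1\<bar> \<le> w"
      using fejer_near_0[OF w] by metis
    have "\<forall>\<^sub>F n in sequentially. integral\<^sup>L lborel (g n) < e / (2 * K)"
      using e K by (intro order_tendstoD(2)[OF g_lim]) simp
    then obtain N where N: "\<And>n. n \<ge> N \<Longrightarrow> integral\<^sup>L lborel (g n) < e / (2 * K)"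
      by (auto simp: eventually_sequentially)
    show "\<exists>N. \<exists>\<delta>>0. \<forall>n\<ge>N. \<forall>c. 0 < c \<and> c < \<delta> \<longrightarrow> (\<forall>u\<in>U.
       \<bar>(2 * pi * real n) powr (real CARD('n) / 2) * sqrt (det (tilt_cov \<nu> u)) * phi (tilt u) n c (tilt_mean \<nu> u) - 1\<bar>
       \<le> e + K * (2 * pi) ^ ?d * real n powr (real CARD('n) / 2) * exp (- \<gamma> * real n) * c powr (- real CARD('n)))"
    proof (intro exI[of _ "max N 1"] exI[of _ "r / \<alpha>"] conjI allI impI ballI)
      show "0 < r / \<alpha>" using r pos by simp
      fix n c u assume n: "max N 1 \<le> n" and c: "0 < c \<and> c < r / \<alpha>" and u: "u \<in> U"
      have n0: "0 < n" using n by auto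
      have "c * \<alpha> < r" using c pos by (simp add: field_simps)
      then have "\<bar>(2 * pi * real n) powr (real ?d / 2) * sqrt (det (tilt_cov \<nu> u)) * phi (tilt u) n c (tilt_mean \<nu> u) - 1\<bar>
        \<le> K * (w * IE + integral\<^sup>L lborel (g n) + \<rho> ^ n * (2 * pi * sqrt n / c) ^ ?d)"
        using c w by (intro core n0 u r(2)) auto
      also have "\<dots> = K * w * IE + K * integral\<^sup>L lborel (g n) + K * (\<rho> ^ n * (2 * pi * sqrt n / c) ^ ?d)"
        by (simp add: algebra_simps)
      also have "K * w * IE \<le> e / 2"
      proof -
        have "K * w * IE = e / 2 * (IE / (IE + 1))" using K by (simp add: w_def)
        also have "\<dots> \<le> e / 2 * 1" using e IE by (intro mult_left_mono) auto
        finally show ?thesis by simp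
      qed
      also have "K * integral\<^sup>L lborel (g n) \<le> e / 2"
        using N[of n] n K by (simp add: field_simps)
      also have "K * (\<rho> ^ n * (2 * pi * sqrt n / c) ^ ?d)
        = K * (2 * pi) ^ ?d * real n powr (real ?d / 2) * exp (- \<gamma> * real n) * c powr (- real ?d)"
      proof -
        have "exp (- \<gamma> * real n) = \<rho> ^ n"
          using \<rho> by (simp add: \<gamma>_def exp_of_nat2_mult)
        moreover have "sqrt n ^ ?d = real n powr (real ?d / 2)"
          using n0 by (simp add: powr_realpow[symmetric] powr_half_sqrt[symmetric] powr_powr)
        moreover have "c powr (- real ?d) = 1 / c ^ ?d"
          using c by (simp add: powr_minus powr_realpow divide_inverse)
        ultimately show ?thesis by (simp add: power_divide power_mult_distrib)
      qed
      finally show "\<bar>(2 * pi * real n) powr (real CARD('n) / 2) * sqrt (det (tilt_cov \<nu> u)) * phi (tilt u) n c (tilt_mean \<nu> u) - 1\<bar>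
       \<le> e + K * (2 * pi) ^ ?d * real n powr (real CARD('n) / 2) * exp (- \<gamma> * real n) * c powr (- real CARD('n))"
        by simp
    qed
  qed
qed

end

lemma abs_mult_minus_1_le:
  fixes t V e B :: real
  assumes t: "\<bar>t - 1\<bar> \<le> e" "t \<le> 2" "0 \<le> t" and V: "\<bar>V - 1\<bar> \<le> e + B"
  shows "\<bar>t * V - 1\<bar> \<le> 3 * e + 2 * B"
proof -
  have "\<bar>t * V - 1\<bar> = \<bar>t * (V - 1) + (t - 1)\<bar>" by (simp add: algebra_simps)
  also have "\<dots> \<le> t * \<bar>V - 1\<bar> + \<bar>t - 1\<bar>"
    using t(3) by (intro order_trans[OF abs_triangle_ineq]) (simp add: abs_mult)
  also have "t * \<bar>V - 1\<bar> \<le> 2 * (e + B)" using t V by (intro mult_mono) auto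
  finally show ?thesis using t(1) by simp
qed

theorem theorem8:
  fixes \<nu> :: "('n::finite) vect measure" and K :: "'n vect set"
  assumes "prob_space \<nu>" and "sets \<nu> = sets borel"
    and "nondegenerate \<nu>"
    and "interior (dom_L \<nu>) \<noteq> {}"
    and "compact K" and "K \<subseteq> admissible \<nu>"
    and "cramer_condition \<nu>"
  shows "\<exists>\<gamma>>0. \<exists>C::real. \<exists>\<epsilon> R :: nat \<Rightarrow> real \<Rightarrow> 'n vect \<Rightarrow> real.
    (\<forall>n\<ge>1. \<forall>c>0. \<forall>x\<in>K.
       phi \<nu> n c x =
         (2 * pi * real n) powr (- real CARD('n) / 2)
         * sqrt (det (hess (\<lambda>y. real_of_ereal (cramer \<nu> y)) x))
         * exp (- real n * real_of_ereal (cramer \<nu> x))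
         * (1 + \<epsilon> n c x + R n c x))
    \<and> (\<forall>e>0. \<exists>N. \<exists>\<delta>>0. \<forall>n\<ge>N. \<forall>c. 0 < c \<and> c < \<delta> \<longrightarrow> (\<forall>x\<in>K. \<bar>\<epsilon> n c x\<bar> \<le> e))
    \<and> (\<forall>n\<ge>1. \<forall>c>0. \<forall>x\<in>K.
       \<bar>R n c x\<bar> \<le> C * real n powr (real CARD('n) / 2) * exp (- \<gamma> * real n) * c powr (- real CARD('n)))"
proof -
  interpret prob_space \<nu> by fact
  interpret borel_prob \<nu> by unfold_locales fact
  note nd = \<open>nondegenerate \<nu>\<close> and cc = \<open>cramer_condition \<nu>\<close>
  let ?d = "CARD('n)"
  obtain U where U: "compact U" "U \<subseteq> D" "K \<subseteq> tilt_mean \<nu> ` U"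
    using compact_lift[OF nd \<open>compact K\<close>] \<open>K \<subseteq> admissible \<nu>\<close> unfolding admissible_eq by metis
  define v where "v x = (SOME u. u \<in> U \<and> tilt_mean \<nu> u = x)" for x
  have v: "v x \<in> U" "tilt_mean \<nu> (v x) = x" if "x \<in> K" for x
    using someI_ex[of "\<lambda>u. u \<in> U \<and> tilt_mean \<nu> u = x"] U(3) that by (auto simp: v_def)
  obtain R where R: "0 < R" "\<And>u. u \<in> U \<Longrightarrow> norm u \<le> R"
    using compact_imp_bounded[OF U(1)] by (auto simp: bounded_pos)
  define main where "main n x = (2 * pi * real n) powr (- real ?d / 2)
      * sqrt (det (hess (\<lambda>y. real_of_ereal (cramer \<nu> y)) x)) * exp (- real n * real_of_ereal (cramer \<nu> x))"
    for n :: nat and x :: "real^'n"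
  have det_pos: "0 < det (tilt_cov \<nu> (v x))" if "x \<in> K" for x
    using posdef_det_pos[OF transpose_tilt_cov tilt_cov_pos[OF nd]] v(1)[OF that] U(2) by blast
  have main: "main n x * ((2 * pi * real n) powr (real ?d / 2) * sqrt (det (tilt_cov \<nu> (v x))))
      = mgf \<nu> (v x) ^ n * exp (- real n * (v x \<bullet> x))" and main_pos: "0 < main n x"
    if x: "x \<in> K" and n: "0 < n" for n x
  proof -
    have vD: "v x \<in> D" using v(1)[OF x] U(2) by auto
    have h: "det (hess (\<lambda>y. real_of_ereal (cramer \<nu> y)) x) = 1 / det (tilt_cov \<nu> (v x))"
      using det_hess_cramer[OF nd vD] unfolding v(2)[OF x] .
    have e: "exp (- real n * real_of_ereal (cramer \<nu> x)) = mgf \<nu> (v x) ^ n * exp (- real n * (v x \<bullet> x))"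
      using exp_cramer[OF vD, of n] unfolding v(2)[OF x] by simp
    have p: "(2 * pi * real n) powr (- real ?d / 2) * (2 * pi * real n) powr (real ?d / 2) = 1"
      using n by (simp add: powr_add[symmetric])
    have s: "sqrt (1 / det (tilt_cov \<nu> (v x))) * sqrt (det (tilt_cov \<nu> (v x))) = 1"
      using det_pos[OF x] by (simp add: real_sqrt_divide)
    have "main n x * ((2 * pi * real n) powr (real ?d / 2) * sqrt (det (tilt_cov \<nu> (v x))))
      = ((2 * pi * real n) powr (- real ?d / 2) * (2 * pi * real n) powr (real ?d / 2))
        * (sqrt (1 / det (tilt_cov \<nu> (v x))) * sqrt (det (tilt_cov \<nu> (v x))))
        * exp (- real n * real_of_ereal (cramer \<nu> x))"
      unfolding main_def h by (simp only: mult_ac)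
    then show "main n x * ((2 * pi * real n) powr (real ?d / 2) * sqrt (det (tilt_cov \<nu> (v x))))
      = mgf \<nu> (v x) ^ n * exp (- real n * (v x \<bullet> x))"
      unfolding p s e by simp
    show "0 < main n x" unfolding main_def h using det_pos[OF x] n by simp
  qed
  obtain \<gamma> C where \<gamma>: "0 < \<gamma>" and C: "0 \<le> C" and limit:
    "\<And>e. 0 < e \<Longrightarrow> \<exists>N. \<exists>\<delta>>0. \<forall>n\<ge>N. \<forall>c. 0 < c \<and> c < \<delta> \<longrightarrow> (\<forall>u\<in>U.
       \<bar>(2 * pi * real n) powr (real CARD('n) / 2) * sqrt (det (tilt_cov \<nu> u)) * phi (tilt u) n c (tilt_mean \<nu> u) - 1\<bar>
       \<le> e + C * real n powr (real CARD('n) / 2) * exp (- \<gamma> * real n) * c powr (- real CARD('n)))"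
    using local_limit[OF nd cc U(1,2)] by blast
  define B where "B n c = (2 * C) * real n powr (real ?d / 2) * exp (- \<gamma> * real n) * c powr (- real ?d)" for n :: nat and c :: real
  have B: "0 \<le> B n c" for n c using C by (simp add: B_def)
  define q where "q n c x = phi \<nu> n c x / main n x - 1" for n c x
  have key: "\<exists>N. \<exists>\<delta>>0. \<forall>n\<ge>N. \<forall>c. 0 < c \<and> c < \<delta> \<longrightarrow> (\<forall>x\<in>K. \<bar>q n c x\<bar> \<le> e + B n c)" if e: "0 < e" for e
  proof -
    define e' where "e' = min (e / 3) (1 / 2)"
    have e': "0 < e'" "3 * e' \<le> e" "e' \<le> 1 / 2" using e by (auto simp: e'_def)
    from limit[OF e'(1)] obtain N \<delta> where \<delta>: "\<delta> > 0" and N: "\<And>n c u. n \<ge> N \<Longrightarrow> 0 < c \<Longrightarrow> c < \<delta> \<Longrightarrow> u \<in> U \<Longrightarrow>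
       \<bar>(2 * pi * real n) powr (real ?d / 2) * sqrt (det (tilt_cov \<nu> u)) * phi (tilt u) n c (tilt_mean \<nu> u) - 1\<bar>
       \<le> e' + C * real n powr (real ?d / 2) * exp (- \<gamma> * real n) * c powr (- real ?d)" by blast
    define \<delta>' where "\<delta>' = min \<delta> (ln (1 + e') / (R * real ?d))"
    have ln_pos: "0 < ln (1 + e')" using e' by simp
    show ?thesis
    proof (intro exI[of _ "max N 1"] exI[of _ \<delta>'] conjI allI impI ballI)
      show "0 < \<delta>'" using \<delta> ln_pos R by (simp add: \<delta>'_def)
      fix n c x assume n: "max N 1 \<le> n" and c: "0 < c \<and> c < \<delta>'" and x: "x \<in> K"
      have n0: "0 < n" using n by auto
      have vD: "v x \<in> D" using v(1)[OF x] U(2) by auto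
      define r where "r = R * real ?d * c"
      have r: "0 < r" "r \<le> ln (1 + e')"
        using c R by (auto simp: r_def \<delta>'_def field_simps)
      have exp_r: "exp r \<le> 1 + e'" using r(2) e' by (subst (asm) exp_le_cancel_iff[symmetric]) simp
      have exp_mr: "1 - e' \<le> exp (- r)"
      proof -
        have "exp (- r) \<ge> 1 / (1 + e')" using exp_r by (simp add: exp_minus divide_inverse le_imp_inverse_le)
        moreover have "(1 - e') * (1 + e') \<le> 1" by (simp add: algebra_simps)
        then have "1 - e' \<le> 1 / (1 + e')" using e' by (simp add: field_simps)
        ultimately show ?thesis by linarith
      qed
      define W where "W = (2 * pi * real n) powr (real ?d / 2) * sqrt (det (tilt_cov \<nu> (v x)))"
      have W: "0 < W" unfolding W_def using det_pos[OF x] n0 by simp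
      define I where "I = phi (tilt (v x)) n c x"
      have I0: "0 \<le> I" unfolding I_def phi_def by (rule integral_nonneg_AE) (simp add: tent_c_nonneg)
      note ptb = phi_tilt_bounds[OF vD R(2)[OF v(1)[OF x]], of c n x, folded I_def, folded r_def]
      have lo: "main n x * W * exp (- r) * I \<le> phi \<nu> n c x" and hi: "phi \<nu> n c x \<le> main n x * W * exp r * I"
        using ptb c unfolding main[OF x n0, folded W_def] by auto
      have mp: "0 < main n x" by (rule main_pos[OF x n0])
      have VB: "\<bar>W * I - 1\<bar> \<le> e' + B n c / 2"
        using N[of n c "v x"] n c v[OF x] by (simp add: W_def I_def B_def \<delta>'_def)
      have lo': "exp (- r) * (W * I) \<le> q n c x + 1"
        using lo mp by (simp add: q_def field_simps)
      have hi': "q n c x + 1 \<le> exp r * (W * I)"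
        using hi mp by (simp add: q_def field_simps)
      have t1: "\<bar>exp (- r) - 1\<bar> \<le> e'" "exp (- r) \<le> 2" using exp_mr r(1) exp_le_one_iff[of "- r"] by linarith+
      have t2: "\<bar>exp r - 1\<bar> \<le> e'" "exp r \<le> 2" using exp_r r e' by auto
      have "\<bar>exp (- r) * (W * I) - 1\<bar> \<le> 3 * e' + 2 * (B n c / 2)"
        by (rule abs_mult_minus_1_le[OF t1 _ VB]) simp
      moreover have "\<bar>exp r * (W * I) - 1\<bar> \<le> 3 * e' + 2 * (B n c / 2)"
        by (rule abs_mult_minus_1_le[OF t2 _ VB]) simp
      ultimately show "\<bar>q n c x\<bar> \<le> e + B n c" using lo' hi' e' by linarith
    qed
  qed
  \<comment> \<open>The relative error \<open>q\<close> is truncated at the level \<open>B\<close>; by \<open>key\<close> the excess is the \<open>o(1)\<close> term.\<close>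
  define rem where "rem n c x = max (- B n c) (min (B n c) (q n c x))" for n c x
  define eps where "eps n c x = q n c x - rem n c x" for n c x
  show ?thesis
  proof (rule exI[of _ \<gamma>], rule conjI[OF \<gamma>], rule exI[of _ "2 * C"], rule exI[of _ eps], rule exI[of _ rem],
      intro conjI allI impI ballI)
    fix n :: nat and c x assume n: "1 \<le> n" and x: "x \<in> K"
    then have "main n x \<noteq> 0" using main_pos[OF x, of n] by auto
    then have "phi \<nu> n c x = main n x * (1 + eps n c x + rem n c x)"
      by (simp add: eps_def q_def)
    then show "phi \<nu> n c x = (2 * pi * real n) powr (- real ?d / 2)
      * sqrt (det (hess (\<lambda>y. real_of_ereal (cramer \<nu> y)) x)) * exp (- real n * real_of_ereal (cramer \<nu> x))
      * (1 + eps n c x + rem n c x)"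
      by (simp only: main_def)
    show "\<bar>rem n c x\<bar> \<le> 2 * C * real n powr (real ?d / 2) * exp (- \<gamma> * real n) * c powr (- real ?d)"
      using B[of n c] unfolding B_def[symmetric] by (auto simp: rem_def)
  next
    fix e :: real assume e: "0 < e"
    have "\<bar>eps n c x\<bar> \<le> e" if "\<bar>q n c x\<bar> \<le> e + B n c" for n c x
      using that B[of n c] e by (auto simp: eps_def rem_def)
    then show "\<exists>N. \<exists>\<delta>>0. \<forall>n\<ge>N. \<forall>c. 0 < c \<and> c < \<delta> \<longrightarrow> (\<forall>x\<in>K. \<bar>eps n c x\<bar> \<le> e)"
      using key[OF e] by meson
  qed
qed

end
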